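(* Let $1<p<\infty$ and let $I$ be an inner function. Then $$\{S^\ast|K_I^p\}'=\{T_{\bar\varphi}|K_I^p:\ \varphi\in H^\infty\},$$ i.e. the bounded linear operators on $K_I^p$ that commute with the restriction of the backward shift $S^\ast$ to $K_I^p$ are exactly the restrictions to $K_I^p$ of the Toeplitz operators $T_{\bar\varphi}$ with $\varphi\in H^\infty$.
   Context: $\mathbb{D}$ is the open unit disc in $\mathbb{C}$ and $\mathbb{T}$ is the unit circle, with normalized Lebesgue measure. For $1\le p<\infty$, $H^p\subset L^p(\mathbb{T})$ is the Hardy space of functions with vanishing negative Fourier coefficients, identified with their holomorphic extensions to $\mathbb{D}$; $H^\infty$ is the space of bounded holomorphic functions on $\mathbb{D}$ (identified with their boundary values on $\mathbb{T}$). $H_0^p$ is the subspace of $H^p$ of functions vanishing at $0$, and $\overline{H_0^p}$ is the space of complex conjugates of functions in $H_0^p$. An inner function is $I\in H^\infty$ with $|I|=1$ a.e. on $\mathbb{T}$. For an inner function $I$ and $1<p<\infty$, $$K_I^p=H^p\cap I\,\overline{H_0^p},$$ a closed subspace of $H^p$ (the product and intersection being taken in $L^p(\mathbb{T})$). For $1<p<\infty$, $P_+:L^p(\mathbb{T})\to H^p$ is the Riesz projection (the bounded projection onto $H^p$ that annihilates $\overline{H_0^p}$). For $\psi\in L^\infty(\mathbb{T})$ the Toeplitz operator on $H^p$ is $T_\psi f=P_+(\psi f)$. The backward shift on $H^p$ is $(S^\ast f)(z)=\frac{f(z)-f(0)}{z}$, $z\in\mathbb{D}$. The space $K_I^p$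 is invariant under $S^\ast$ and under $T_{\bar\varphi}$ for every $\varphi\in H^\infty$; $S^\ast|K_I^p$ and $T_{\bar\varphi}|K_I^p$ denote the restrictions, viewed as operators on $K_I^p$. For a bounded operator $B$ on a Banach space $X$, $\{B\}'$ denotes its commutant, the set of all bounded linear operators $A$ on $X$ with $AB=BA$. *)

theory Defs
  imports "HOL-Analysis.Analysis"
begin

section \<open>Functions on the unit circle modulo null sets\<close>

text \<open>Normalized Lebesgue measure on the unit circle, as a Borel probability measure on the
  complex plane: the image of the uniform distribution on \<open>[0, 2\<pi>]\<close> under \<open>t \<mapsto> e\<^sup>i\<^sup>t\<close>.\<close>

definition circle_measure :: "complex measure" where
  "circle_measure = distr (uniform_measure lborel {0..2 * pi}) borel cis"

lemma measurable_cis [measurable]: "cis \<in> borel_measurable borel"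
  by (intro borel_measurable_continuous_onI continuous_intros)

lemma measurable_cnj [measurable]: "cnj \<in> borel_measurable borel"
  by (intro borel_measurable_continuous_onI continuous_intros)

lemma emeasure_circle_measure_UNIV: "emeasure circle_measure UNIV = 1"
proof -
  have "cis \<in> borel_measurable (uniform_measure lborel {0..2 * pi})"
    by (simp add: measurable_cis)
  then have "emeasure circle_measure UNIV = emeasure (uniform_measure lborel {0..2 * pi}) UNIV"
    by (simp add: circle_measure_def emeasure_distr)
  also have "\<dots> = 1"
    by (simp add: divide_ennreal)
  finally show ?thesis .
qed

definition circle_eq :: "(complex \<Rightarrow> complex) \<Rightarrow> (complex \<Rightarrow> complex) \<Rightarrow> bool" where
  "circle_eq f g \<longleftrightarrow> f \<in> borel_measurable circle_measure \<and> g \<in> borel_measurable circle_measure \<and>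
     (AE \<zeta> in circle_measure. f \<zeta> = g \<zeta>)"

lemma part_equivp_circle_eq: "part_equivp circle_eq"
proof (rule part_equivpI)
  show "\<exists>f. circle_eq f f"
    by (rule exI[of _ "\<lambda>_. 0"]) (simp add: circle_eq_def)
  show "symp circle_eq"
    by (rule sympI) (auto simp: circle_eq_def eq_commute)
  show "transp circle_eq"
    by (rule transpI) (auto simp: circle_eq_def)
qed

text \<open>The ring of all measurable functions on the circle modulo almost everywhere equality.
  The Lebesgue and Hardy spaces below are subsets of this type.\<close>

quotient_type circle_fun = "complex \<Rightarrow> complex" / partial: circle_eq
  by (rule part_equivp_circle_eq)

instantiation circle_fun :: comm_ring_1
begin

lift_definition zero_circle_fun :: circle_fun is "\<lambda>_. 0"
  by (simp add: circle_eq_def)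

lift_definition one_circle_fun :: circle_fun is "\<lambda>_. 1"
  by (simp add: circle_eq_def)

lift_definition plus_circle_fun :: "circle_fun \<Rightarrow> circle_fun \<Rightarrow> circle_fun"
  is "\<lambda>f g \<zeta>. f \<zeta> + g \<zeta>"
  by (auto simp: circle_eq_def)

lift_definition minus_circle_fun :: "circle_fun \<Rightarrow> circle_fun \<Rightarrow> circle_fun"
  is "\<lambda>f g \<zeta>. f \<zeta> - g \<zeta>"
  by (auto simp: circle_eq_def)

lift_definition uminus_circle_fun :: "circle_fun \<Rightarrow> circle_fun"
  is "\<lambda>f \<zeta>. - f \<zeta>"
  by (auto simp: circle_eq_def)

lift_definition times_circle_fun :: "circle_fun \<Rightarrow> circle_fun \<Rightarrow> circle_fun"
  is "\<lambda>f g \<zeta>. f \<zeta> * g \<zeta>"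
  by (auto simp: circle_eq_def)

instance
proof
  have "\<not> (AE \<zeta> in circle_measure. False)"
    using emeasure_circle_measure_UNIV
    by (simp add: AE_iff_measurable[OF _ refl] circle_measure_def)
  then show "(0 :: circle_fun) \<noteq> 1"
    by transfer (simp add: circle_eq_def)
qed (transfer; simp add: circle_eq_def algebra_simps)+

end

lift_definition circle_const :: "complex \<Rightarrow> circle_fun" is "\<lambda>c _. c"
  by (simp add: circle_eq_def)

lift_definition circle_cnj :: "circle_fun \<Rightarrow> circle_fun" is "\<lambda>f \<zeta>. cnj (f \<zeta>)"
  by (auto simp: circle_eq_def intro: measurable_compose[OF _ measurable_cnj])

lift_definition unimodular :: "circle_fun \<Rightarrow> bool"
  is "\<lambda>f. AE \<zeta> in circle_measure. cmod (f \<zeta>) = 1"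
  by (auto simp: circle_eq_def elim: AE_mp)

lift_definition power_integrable :: "real \<Rightarrow> circle_fun \<Rightarrow> bool"
  is "\<lambda>p f. integrable circle_measure (\<lambda>\<zeta>. cmod (f \<zeta>) powr p)"
proof -
  fix p :: real and f g :: "complex \<Rightarrow> complex"
  assume "circle_eq f g"
  then show "integrable circle_measure (\<lambda>\<zeta>. cmod (f \<zeta>) powr p) =
      integrable circle_measure (\<lambda>\<zeta>. cmod (g \<zeta>) powr p)"
    by (intro integrable_cong_AE) (auto simp: circle_eq_def)
qed

lift_definition lp_norm :: "real \<Rightarrow> circle_fun \<Rightarrow> real"
  is "\<lambda>p f. (\<integral>\<zeta>. cmod (f \<zeta>) powr p \<partial>circle_measure) powr (1 / p)"
  by (auto simp: circle_eq_def intro!: arg_cong[where f = "\<lambda>x. x powr _"] integral_cong_AE)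

lift_definition fourier_coeff :: "circle_fun \<Rightarrow> int \<Rightarrow> complex"
  is "\<lambda>f n. \<integral>\<zeta>. f \<zeta> * cnj \<zeta> powi n \<partial>circle_measure"
proof (rule ext)
  fix n :: int and f g :: "complex \<Rightarrow> complex"
  assume fg: "circle_eq f g"
  have "(\<lambda>\<zeta>. cnj \<zeta> powi n) \<in> borel_measurable circle_measure"
    unfolding power_int_def circle_measure_def
    by (cases "n \<ge> 0") (simp_all add: measurable_cnj)
  with fg show "(\<integral>\<zeta>. f \<zeta> * cnj \<zeta> powi n \<partial>circle_measure) =
        (\<integral>\<zeta>. g \<zeta> * cnj \<zeta> powi n \<partial>circle_measure)"
    by (intro integral_cong_AE) (auto simp: circle_eq_def)
qed

lift_definition has_radial_limits :: "(complex \<Rightarrow> complex) \<Rightarrow> circle_fun \<Rightarrow> bool"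
  is "\<lambda>F f. AE \<zeta> in circle_measure. ((\<lambda>r. F (complex_of_real r * \<zeta>)) \<longlongrightarrow> f \<zeta>) (at_left 1)"
  by (auto simp: circle_eq_def elim: AE_mp)

section \<open>Hardy spaces\<close>

definition Lp :: "real \<Rightarrow> circle_fun set" where
  "Lp p = {f. power_integrable p f}"

definition Hp :: "real \<Rightarrow> circle_fun set" where
  "Hp p = {f \<in> Lp p. \<forall>n<0. fourier_coeff f n = 0}"

text \<open>The holomorphic extension to the open unit disc of a function whose negative Fourier
  coefficients vanish.\<close>

definition disc_ext :: "circle_fun \<Rightarrow> complex \<Rightarrow> complex" where
  "disc_ext f z = (\<Sum>n. fourier_coeff f (int n) * z ^ n)"

definition Hp0 :: "real \<Rightarrow> circle_fun set" where
  "Hp0 p = {f \<in> Hp p. disc_ext f 0 = 0}"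

text \<open>The boundary values of the bounded holomorphic functions on the open unit disc.\<close>

definition Hinf :: "circle_fun set" where
  "Hinf = {f. \<exists>F. F holomorphic_on ball 0 1 \<and> bounded (F ` ball 0 1) \<and> has_radial_limits F f}"

definition inner_function :: "circle_fun \<Rightarrow> bool" where
  "inner_function I \<longleftrightarrow> I \<in> Hinf \<and> unimodular I"

definition model_space :: "real \<Rightarrow> circle_fun \<Rightarrow> circle_fun set" where
  "model_space p I = Hp p \<inter> (\<lambda>g. I * circle_cnj g) ` Hp0 p"

section \<open>Operators\<close>

text \<open>Bounded complex-linear operators on a subspace \<open>X\<close> of \<open>Lp p\<close>. They are represented by
  extensional functions on \<open>X\<close>, so that two operators are equal iff they agree on \<open>X\<close>.\<close>

definition bounded_operators ::
    "real \<Rightarrow> circle_fun set \<Rightarrow> (circle_fun \<Rightarrow> circle_fun) set" where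
  "bounded_operators p X = {A \<in> X \<rightarrow>\<^sub>E X.
     (\<forall>f\<in>X. \<forall>g\<in>X. A (f + g) = A f + A g) \<and>
     (\<forall>c. \<forall>f\<in>X. A (circle_const c * f) = circle_const c * A f) \<and>
     (\<exists>C. \<forall>f\<in>X. lp_norm p (A f) \<le> C * lp_norm p f)}"

definition commutant ::
    "real \<Rightarrow> circle_fun set \<Rightarrow> (circle_fun \<Rightarrow> circle_fun) \<Rightarrow> (circle_fun \<Rightarrow> circle_fun) set" where
  "commutant p X B = {A \<in> bounded_operators p X. compose X A B = compose X B A}"

text \<open>The bounded projection of \<open>Lp p\<close> onto \<open>Hp p\<close> that annihilates the conjugates of the
  functions in \<open>Hp0 p\<close>; it exists for \<open>1 < p < \<infinity>\<close>.\<close>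

definition riesz_projection :: "real \<Rightarrow> circle_fun \<Rightarrow> circle_fun" where
  "riesz_projection p = (THE P. P \<in> bounded_operators p (Lp p) \<and> P ` Lp p = Hp p \<and>
     (\<forall>f\<in>Lp p. P (P f) = P f) \<and> (\<forall>g\<in>Hp0 p. P (circle_cnj g) = 0))"

definition toeplitz :: "real \<Rightarrow> circle_fun \<Rightarrow> circle_fun \<Rightarrow> circle_fun" where
  "toeplitz p \<psi> f = riesz_projection p (\<psi> * f)"

text \<open>The point \<open>z = 0\<close> is a removable singularity of the quotient and is omitted because
  division by zero is total in HOL.\<close>

definition backward_shift :: "real \<Rightarrow> circle_fun \<Rightarrow> circle_fun" where
  "backward_shift p f = (THE g. g \<in> Hp p \<and>
     (\<forall>z\<in>ball 0 1 - {0}. disc_ext g z = (disc_ext f z - disc_ext f 0) / z))"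

end

theory Submission
  imports Defs "HOL-Complex_Analysis.Complex_Analysis" "HOL-Computational_Algebra.Fundamental_Theorem_Algebra"
begin

text \<open>
  For \<open>g\<close> in \<open>Hp0 p\<close> put \<open>R g = P\<^sub>+ (I g\<^sup>*)\<close>, where \<open>g\<^sup>*\<close> is the conjugate of \<open>g\<close>. This maps onto the model
  space, and \<open>T\<close> with symbol \<open>\<phi>\<^sup>*\<close> sends \<open>R g\<close> to \<open>R (\<phi> g)\<close>. If \<open>A\<close> commutes with the backward shift, then \<open>A\<close> is
  determined by the functional \<open>\<Lambda> g = (A (R g))(0)\<close>, because the \<open>n\<close>-th coefficient of \<open>A (R g)\<close> is
  \<open>\<Lambda> (z\<^sup>n g)\<close>. More generally \<open>\<Lambda> (h g)\<close> is the pairing of \<open>A (R g)\<close> with \<open>h\<close>, so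
  \<open>\<bar>\<Lambda> (h g)\<bar> \<le> C \<parallel>g\<parallel>\<^sub>p \<parallel>h\<parallel>\<^sub>q\<close> for conjugate exponents. A polynomial \<open>F\<close> vanishing at \<open>0\<close> splits as \<open>F = h g\<close> with
  \<open>\<bar>h\<bar>\<^sup>q = \<bar>F\<bar> = \<bar>g\<bar>\<^sup>p\<close> on the circle, so \<open>\<Lambda>\<close> is bounded in the \<open>L\<^sup>1\<close> norm. By Hahn-Banach and Radon-Nikodym
  it is given by a bounded function \<open>\<psi>\<close>. Since \<open>R (z\<^sup>n I) = 0\<close> for \<open>n \<ge> 1\<close>, the function \<open>\<phi> = I \<psi>\<^sup>*\<close> has no
  negative Fourier coefficients, and comparing coefficients gives \<open>A = T\<close> with symbol \<open>\<phi>\<^sup>*\<close>.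

  The Riesz projection is bounded for \<open>1 < p \<le> 2\<close> by the mean value property of \<open>F\<^sup>p\<close> for \<open>Re F > 0\<close>, and for \<open>p > 2\<close>
  by duality. That \<open>\<phi>\<close> has radial limits is Fatou's theorem, which follows from a weak type bound for the maximal function.
\<close>

section \<open>Integration on the circle\<close>

text \<open>The obstacle is the boundedness of the symbol. Boundedness of \<open>A\<close> on L^p
  alone bounds \<Lambda> by the L^p norm of g, and duality would then give \<psi> only in L^q.
  Control by the L^1 norm is required, and this is why \<Lambda> is tested on products: commutation
  lets h leave the argument of \<Lambda> and enter a pairing, where Hoelder applies. Polynomials
  serve as test functions because their powers 1/q and 1/p can be formed one linear factor at a time
  inside \<open>Hinf\<close>, and because they are dense. The formula for \<phi> is forced: if k = I
  conj g lies in the model space, then conj \<phi> k = \<psi> conj g, and its n-th coefficient for n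
  >= 0 is \<Lambda> (z^n g), which is that of \<open>A k\<close>. Both R and \<Lambda> are conjugate
  linear, as g enters conjugated. For the Riesz projection, the range 1 < p <= 2 comes from an
  inequality between |w|^p, (Re w)^p and Re (w^p) for Re w > 0: it uses that cos decreases on
  [0, pi], an interval that contains p |\<theta>| for all |\<theta>| < pi/2 only if p <= 2.\<close>

abbreviation "\<mu> \<equiv> circle_measure"

lemma sets_circle_measure [measurable_cong, simp]: "sets \<mu> = sets borel"
  by (simp add: circle_measure_def)

lemma space_circle_measure [simp]: "space \<mu> = UNIV"
  by (simp add: circle_measure_def)

lemma measurable_circle_measure [simp]: "borel_measurable \<mu> = borel_measurable borel"
  by (rule measurable_cong_sets) simp_all

interpretation circle: finite_measure \<mu>
  by standard (simp add: emeasure_circle_measure_UNIV)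

lemma measure_circle_UNIV [simp]: "measure \<mu> UNIV = 1"
  by (simp add: measure_def emeasure_circle_measure_UNIV)

lemma AE_circle_iff:
  assumes [measurable]: "Measurable.pred borel P"
  shows "(AE \<zeta> in \<mu>. P \<zeta>) \<longleftrightarrow> (AE t in uniform_measure lborel {0..2*pi}. P (cis t))"
  unfolding circle_measure_def
  by (subst AE_distr_iff) (auto simp: measurable_cis)

lemma AE_circle_norm: "AE \<zeta> in \<mu>. cmod \<zeta> = 1"
  by (subst AE_circle_iff) (auto)

lemma AE_circleI: "(\<And>\<zeta>. cmod \<zeta> = 1 \<Longrightarrow> P \<zeta>) \<Longrightarrow> AE \<zeta> in \<mu>. P \<zeta>"
  using AE_circle_norm by eventually_elim auto

text \<open>Integrals on the circle become Lebesgue integrals over one period with density 1/(2 pi);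
  this gives access to the fundamental theorem of calculus and to lengths of arcs.\<close>

lemma circle_integral_eq:
  fixes f :: "complex \<Rightarrow> 'b::{banach, second_countable_topology}"
  assumes f [measurable]: "f \<in> borel_measurable borel"
  shows "(\<integral>\<zeta>. f \<zeta> \<partial>\<mu>) = (\<integral>t. (indicator {0..2*pi} t / (2*pi)) *\<^sub>R f (cis t) \<partial>lborel)"
proof -
  have "(\<integral>\<zeta>. f \<zeta> \<partial>\<mu>) = (\<integral>t. f (cis t) \<partial>uniform_measure lborel {0..2*pi})"
    unfolding circle_measure_def by (rule integral_distr) (auto simp: measurable_cis)
  also have "uniform_measure lborel {0..2*pi} = density lborel (\<lambda>t. ennreal (indicator {0..2*pi} t / (2*pi)))"
    unfolding uniform_measure_def
    by (intro density_cong) (auto simp: ennreal_indicator indicator_def divide_ennreal simp flip: ennreal_1)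
  also have "(\<integral>t. f (cis t) \<partial>density lborel (\<lambda>t. ennreal (indicator {0..2*pi} t / (2*pi)))) =
     (\<integral>t. (indicator {0..2*pi} t / (2*pi)) *\<^sub>R f (cis t) \<partial>lborel)"
    by (rule integral_density) (auto simp: measurable_cis)
  finally show ?thesis .
qed

lemma integral_power_circle:
  assumes "n > 0"
  shows "(\<integral>\<zeta>. \<zeta> ^ n \<partial>\<mu>) = 0"
proof -
  have "(\<integral>\<zeta>. \<zeta> ^ n \<partial>\<mu>) = (\<integral>t. (indicator {0..2*pi} t / (2*pi)) *\<^sub>R (cis t ^ n) \<partial>lborel)"
    by (rule circle_integral_eq) auto
  also have "\<dots> = (1 / (2*pi)) *\<^sub>R (\<integral>t. indicator {0..2*pi} t *\<^sub>R (cis t ^ n) \<partial>lborel)"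
    by (subst integral_scaleR_right[symmetric]) (auto simp: field_simps)
  also have "(\<integral>t. indicator {0..2*pi} t *\<^sub>R (cis t ^ n) \<partial>lborel) =
     cis (real n * (2*pi)) / (\<i> * n) - cis (real n * 0) / (\<i> * n)"
  proof (intro integral_FTC_Icc)
    fix t
    have "((\<lambda>t. cis (n * t) / (\<i> * n)) has_vector_derivative cis t ^ n) (at t)"
      unfolding cis_conv_exp Complex.DeMoivre using assms
      by (auto intro!: derivative_eq_intros has_vector_derivative_real_field simp: exp_of_nat_mult[symmetric] ac_simps)
    then show "((\<lambda>t. cis (n * t) / (\<i> * n)) has_vector_derivative cis t ^ n) (at t within {0..2*pi})"
      by (rule has_vector_derivative_at_within)
  qed (auto intro!: continuous_intros)
  also have "\<dots> = 0" using cis_multiple_2pi[of "real n"] by (simp add: mult.commute mult.left_commute)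
  finally show ?thesis by simp
qed

text \<open>Follows from a + b <= 2 max a b. This quasi-triangle inequality for p-th powers holds
  for every exponent p >= 0, including the exponents 1/p that occur when roots are taken, and its
  constant is harmless for boundedness and for convergence to 0.\<close>

lemma powr_add_le:
  fixes a b p :: real
  assumes "0 \<le> a" "0 \<le> b" "0 \<le> p"
  shows "(a + b) powr p \<le> 2 powr p * (a powr p + b powr p)"
proof -
  have "(a + b) powr p \<le> (2 * max a b) powr p"
    using assms by (intro powr_mono2) auto
  also have "\<dots> = 2 powr p * max a b powr p" using assms by (simp add: powr_mult)
  also have "max a b powr p \<le> a powr p + b powr p" by (simp add: max_def)
  finally show ?thesis by simp
qed

lemma norm_add_powr_le:
  fixes a b :: "'a::real_normed_vector"
  assumes "0 \<le> p"
  shows "norm (a + b) powr p \<le> 2 powr p * (norm a powr p + norm b powr p)"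
proof -
  have "norm (a + b) powr p \<le> (norm a + norm b) powr p"
    using assms by (intro powr_mono2 norm_triangle_ineq) auto
  also have "\<dots> \<le> 2 powr p * (norm a powr p + norm b powr p)"
    using assms by (intro powr_add_le) auto
  finally show ?thesis .
qed

section \<open>Integrals of p-th powers and Hoelder's inequality\<close>

definition pint :: "real \<Rightarrow> (complex \<Rightarrow> complex) \<Rightarrow> bool" where
  "pint p f \<longleftrightarrow> f \<in> borel_measurable borel \<and> integrable \<mu> (\<lambda>\<zeta>. cmod (f \<zeta>) powr p)"

text \<open>The p-th power of the L^p norm, on representatives. The root is postponed to
  \<open>lp_norm\<close>, because most estimates below compare p-th powers and pass to
  limits.\<close>

definition pmass :: "real \<Rightarrow> (complex \<Rightarrow> complex) \<Rightarrow> real" where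
  "pmass p f = (\<integral>\<zeta>. cmod (f \<zeta>) powr p \<partial>\<mu>)"

lemma pint_measurable [measurable_dest]: "pint p f \<Longrightarrow> f \<in> borel_measurable borel"
  by (simp add: pint_def)

lemma pint_integrable: "pint p f \<Longrightarrow> integrable \<mu> (\<lambda>\<zeta>. cmod (f \<zeta>) powr p)"
  by (simp add: pint_def)

lemma pmass_nonneg [simp]: "0 \<le> pmass p f"
  by (simp add: pmass_def)

lemma pint_bounded:
  assumes [measurable]: "f \<in> borel_measurable borel" and "AE \<zeta> in \<mu>. cmod (f \<zeta>) \<le> B" "p \<ge> 0"
  shows "pint p f"
  unfolding pint_def
proof (intro conjI circle.integrable_const_bound[where B = "B powr p"])
  show "AE \<zeta> in \<mu>. norm (cmod (f \<zeta>) powr p) \<le> B powr p"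
    using assms(2) by eventually_elim (use assms(3) in \<open>auto intro!: powr_mono2\<close>)
qed auto

lemma pmass_bounded:
  assumes [measurable]: "f \<in> borel_measurable borel" and "AE \<zeta> in \<mu>. cmod (f \<zeta>) \<le> B" "p \<ge> 0"
  shows "pmass p f \<le> B powr p"
proof -
  have "pmass p f \<le> (\<integral>\<zeta>. B powr p \<partial>\<mu>)" unfolding pmass_def
    using assms(2) pint_integrable[OF pint_bounded[OF assms]]
    by (intro integral_mono_AE) (auto elim!: eventually_mono intro!: powr_mono2 assms)
  then show ?thesis by simp
qed

lemma pint_add:
  assumes "pint p f" "pint p g" "p \<ge> 0"
  shows "pint p (\<lambda>\<zeta>. f \<zeta> + g \<zeta>)" "pmass p (\<lambda>\<zeta>. f \<zeta> + g \<zeta>) \<le> 2 powr p * (pmass p f + pmass p g)"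
proof -
  note [measurable] = assms(1,2)[THEN pint_measurable]
  have int: "integrable \<mu> (\<lambda>\<zeta>. 2 powr p * (cmod (f \<zeta>) powr p + cmod (g \<zeta>) powr p))"
    using assms by (auto simp: pint_def)
  have *: "integrable \<mu> (\<lambda>\<zeta>. cmod (f \<zeta> + g \<zeta>) powr p)"
    by (rule Bochner_Integration.integrable_bound[OF int]) (auto intro!: norm_add_powr_le assms)
  then show "pint p (\<lambda>\<zeta>. f \<zeta> + g \<zeta>)" by (auto simp: pint_def)
  have "pmass p (\<lambda>\<zeta>. f \<zeta> + g \<zeta>) \<le> (\<integral>\<zeta>. 2 powr p * (cmod (f \<zeta>) powr p + cmod (g \<zeta>) powr p) \<partial>\<mu>)"
    unfolding pmass_def by (intro integral_mono * int norm_add_powr_le assms)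
  also have "\<dots> = 2 powr p * (pmass p f + pmass p g)"
    using assms by (simp add: pmass_def pint_def)
  finally show "pmass p (\<lambda>\<zeta>. f \<zeta> + g \<zeta>) \<le> 2 powr p * (pmass p f + pmass p g)" .
qed

lemma pint_bounded_mult:
  assumes "pint p f" and [measurable]: "h \<in> borel_measurable borel"
    and "AE \<zeta> in \<mu>. cmod (h \<zeta>) \<le> B" "p \<ge> 0"
  shows "pint p (\<lambda>\<zeta>. h \<zeta> * f \<zeta>)" "pmass p (\<lambda>\<zeta>. h \<zeta> * f \<zeta>) \<le> B powr p * pmass p f"
proof -
  note [measurable] = assms(1)[THEN pint_measurable]
  have int: "integrable \<mu> (\<lambda>\<zeta>. B powr p * cmod (f \<zeta>) powr p)"
    using assms by (auto simp: pint_def)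
  have le: "AE \<zeta> in \<mu>. cmod (h \<zeta> * f \<zeta>) powr p \<le> B powr p * cmod (f \<zeta>) powr p"
    using assms(3)
  proof eventually_elim
    case (elim \<zeta>)
    then have "0 \<le> B" by (meson norm_ge_zero order_trans)
    with elim assms(4) show ?case
      by (auto simp: norm_mult powr_mult intro!: mult_right_mono powr_mono2)
  qed
  have *: "integrable \<mu> (\<lambda>\<zeta>. cmod (h \<zeta> * f \<zeta>) powr p)"
    by (rule Bochner_Integration.integrable_bound[OF int]) (use le in auto)
  then show "pint p (\<lambda>\<zeta>. h \<zeta> * f \<zeta>)" by (auto simp: pint_def)
  have "pmass p (\<lambda>\<zeta>. h \<zeta> * f \<zeta>) \<le> (\<integral>\<zeta>. B powr p * cmod (f \<zeta>) powr p \<partial>\<mu>)"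
    unfolding pmass_def by (intro integral_mono_AE * int le)
  then show "pmass p (\<lambda>\<zeta>. h \<zeta> * f \<zeta>) \<le> B powr p * pmass p f" by (simp add: pmass_def)
qed

lemma pint_cmult:
  assumes "pint p f" "p \<ge> 0"
  shows "pint p (\<lambda>\<zeta>. c * f \<zeta>)" "pmass p (\<lambda>\<zeta>. c * f \<zeta>) = cmod c powr p * pmass p f"
  using assms by (auto simp: pint_def pmass_def norm_mult powr_mult)

lemma pmass_minus: "pmass p (\<lambda>\<zeta>. - f \<zeta>) = pmass p f"
  by (simp add: pmass_def)

lemma pint_minus: "pint p f \<Longrightarrow> pint p (\<lambda>\<zeta>. - f \<zeta>)"
  by (auto simp: pint_def)

lemma pint_diff:
  assumes "pint p f" "pint p g" "p \<ge> 0"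
  shows "pint p (\<lambda>\<zeta>. f \<zeta> - g \<zeta>)" "pmass p (\<lambda>\<zeta>. f \<zeta> - g \<zeta>) \<le> 2 powr p * (pmass p f + pmass p g)"
  using pint_add[OF assms(1) pint_minus[OF assms(2)] assms(3)] by (auto simp: pmass_minus)

lemma pint_cnj: "pint p f \<Longrightarrow> pint p (\<lambda>\<zeta>. cnj (f \<zeta>))"
  by (auto simp: pint_def)

text \<open>Young's inequality applied pointwise to f/A and g/B, where A and B are the two norms,
  and then integrated; the normalised integrals contribute 1/p + 1/q = 1. If A or B vanishes,
  division is impossible but the product is zero almost everywhere.\<close>

lemma Holder_inequality:
  fixes f g :: "'a \<Rightarrow> real"
  assumes pq: "p > 1" "q > 1" "1/p + 1/q = 1"
    and [measurable]: "f \<in> borel_measurable M" "g \<in> borel_measurable M"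
    and fi: "integrable M (\<lambda>x. \<bar>f x\<bar> powr p)" and gi: "integrable M (\<lambda>x. \<bar>g x\<bar> powr q)"
  shows "integrable M (\<lambda>x. f x * g x)"
    and "(\<integral>x. \<bar>f x * g x\<bar> \<partial>M) \<le> (\<integral>x. \<bar>f x\<bar> powr p \<partial>M) powr (1/p) * (\<integral>x. \<bar>g x\<bar> powr q \<partial>M) powr (1/q)"
proof -
  have young: "\<bar>a * b\<bar> \<le> \<bar>a\<bar> powr p / p + \<bar>b\<bar> powr q / q" for a b :: real
    using Youngs_inequality[of p q "\<bar>a\<bar>" "\<bar>b\<bar>"] pq by (simp add: abs_mult)
  have int: "integrable M (\<lambda>x. \<bar>f x\<bar> powr p / p + \<bar>g x\<bar> powr q / q)" using fi gi by auto
  show fg: "integrable M (\<lambda>x. f x * g x)"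
    by (rule Bochner_Integration.integrable_bound[OF int]) (use young in \<open>auto simp: order_trans[OF _ abs_ge_self]\<close>)
  define A where "A = (\<integral>x. \<bar>f x\<bar> powr p \<partial>M) powr (1/p)"
  define B where "B = (\<integral>x. \<bar>g x\<bar> powr q \<partial>M) powr (1/q)"
  have A: "A \<ge> 0" "A powr p = (\<integral>x. \<bar>f x\<bar> powr p \<partial>M)" and B: "B \<ge> 0" "B powr q = (\<integral>x. \<bar>g x\<bar> powr q \<partial>M)"
    using pq by (auto simp: A_def B_def powr_powr)
  have "(\<integral>x. \<bar>f x * g x\<bar> \<partial>M) \<le> A * B"
  proof (cases "A = 0 \<or> B = 0")
    case True
    have "AE x in M. f x = 0 \<or> g x = 0"
    proof (cases "A = 0")
      case True
      then have "AE x in M. \<bar>f x\<bar> powr p = 0"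
        using A fi integral_nonneg_eq_0_iff_AE[OF fi] pq by auto
      then show ?thesis by eventually_elim auto
    next
      case False
      then have "AE x in M. \<bar>g x\<bar> powr q = 0"
        using True B gi integral_nonneg_eq_0_iff_AE[OF gi] pq by auto
      then show ?thesis by eventually_elim auto
    qed
    then have "(\<integral>x. \<bar>f x * g x\<bar> \<partial>M) = (\<integral>x. 0 \<partial>M)"
      by (intro integral_cong_AE) (auto elim!: eventually_mono)
    then show ?thesis using A B by simp
  next
    case False
    with A B have pos: "A > 0" "B > 0" by auto
    have "(\<integral>x. \<bar>f x * g x\<bar> \<partial>M) / (A * B) = (\<integral>x. \<bar>(f x / A) * (g x / B)\<bar> \<partial>M)"
      using pos by (simp add: abs_mult field_simps)
    also have "\<dots> \<le> (\<integral>x. \<bar>f x / A\<bar> powr p / p + \<bar>g x / B\<bar> powr q / q \<partial>M)"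
      using fi gi integrable_abs[OF fg] pos by (intro integral_mono young) (auto simp: powr_divide abs_mult)
    also have "\<dots> = (A powr p) / (A powr p) / p + (B powr q) / (B powr q) / q"
      using fi gi pos A B by (simp add: powr_divide)
    also have "\<dots> = 1" using pos pq by (simp add: field_simps)
    finally show ?thesis using pos by (simp add: field_simps)
  qed
  then show "(\<integral>x. \<bar>f x * g x\<bar> \<partial>M) \<le> (\<integral>x. \<bar>f x\<bar> powr p \<partial>M) powr (1/p) * (\<integral>x. \<bar>g x\<bar> powr q \<partial>M) powr (1/q)"
    by (simp add: A_def B_def)
qed

lemma pint_Holder:
  assumes pq: "p > 1" "q > 1" "1/p + 1/q = 1" and "pint p f" "pint q g"
  shows "integrable \<mu> (\<lambda>\<zeta>. f \<zeta> * g \<zeta>)"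
    and "(\<integral>\<zeta>. cmod (f \<zeta> * g \<zeta>) \<partial>\<mu>) \<le> pmass p f powr (1/p) * pmass q g powr (1/q)"
    and "cmod (\<integral>\<zeta>. f \<zeta> * g \<zeta> \<partial>\<mu>) \<le> pmass p f powr (1/p) * pmass q g powr (1/q)"
proof -
  note [measurable] = assms(4,5)[THEN pint_measurable]
  have "integrable \<mu> (\<lambda>\<zeta>. cmod (f \<zeta>) * cmod (g \<zeta>))"
    by (rule Holder_inequality(1)[OF pq]) (use assms in \<open>auto simp: pint_def\<close>)
  then show *: "integrable \<mu> (\<lambda>\<zeta>. f \<zeta> * g \<zeta>)"
    by (subst integrable_norm_iff[symmetric]) (auto simp: norm_mult)
  show **: "(\<integral>\<zeta>. cmod (f \<zeta> * g \<zeta>) \<partial>\<mu>) \<le> pmass p f powr (1/p) * pmass q g powr (1/q)"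
    using Holder_inequality(2)[OF pq, of "\<lambda>\<zeta>. cmod (f \<zeta>)" \<mu> "\<lambda>\<zeta>. cmod (g \<zeta>)"] assms
    by (auto simp: pint_def pmass_def norm_mult abs_mult)
  show "cmod (\<integral>\<zeta>. f \<zeta> * g \<zeta> \<partial>\<mu>) \<le> pmass p f powr (1/p) * pmass q g powr (1/q)"
    using integral_norm_bound[of \<mu> "\<lambda>\<zeta>. f \<zeta> * g \<zeta>"] ** by linarith
qed

text \<open>Integrability comes from x^p <= 1 + x^s, the estimate from Hoelder with exponent s/p
  against the constant 1. Since the total mass is 1, no constant appears.\<close>

lemma pint_mono_exponent:
  assumes "pint s f" "0 < p" "p \<le> s"
  shows "pint p f" "pmass p f \<le> pmass s f powr (p / s)"
proof -
  note [measurable] = assms(1)[THEN pint_measurable]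
  have "integrable \<mu> (\<lambda>\<zeta>. 1 + cmod (f \<zeta>) powr s)" using assms by (auto simp: pint_def)
  moreover have "x powr p \<le> 1 + x powr s" if "x \<ge> 0" for x :: real
  proof (cases "x \<le> 1")
    case True
    then have "x powr p \<le> 1" using that assms by (simp add: powr_le1)
    then show ?thesis by (simp add: add_increasing2)
  next
    case False
    then have "x powr p \<le> x powr s" using assms by (intro powr_mono) auto
    then show ?thesis by simp
  qed
  ultimately show *: "pint p f"
    unfolding pint_def by (auto intro: Bochner_Integration.integrable_bound)
  show "pmass p f \<le> pmass s f powr (p / s)"
  proof (cases "p = s")
    case True
    then show ?thesis using assms by (simp add: pmass_nonneg)
  next
    case False
    define r where "r = s / p"
    have r: "r > 1" using assms False by (simp add: r_def)
    define r' where "r' = r / (r - 1)"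
    have "(\<integral>\<zeta>. \<bar>cmod (f \<zeta>) powr p * 1\<bar> \<partial>\<mu>) \<le>
      (\<integral>\<zeta>. \<bar>cmod (f \<zeta>) powr p\<bar> powr r \<partial>\<mu>) powr (1/r) * (\<integral>\<zeta>. \<bar>1\<bar> powr r' \<partial>\<mu>) powr (1/r')"
      using r assms by (intro Holder_inequality(2)) (auto simp: r'_def field_simps powr_powr r_def pint_def)
    then show ?thesis using r assms by (simp add: pmass_def powr_powr r_def)
  qed
qed

section \<open>Approximation by trigonometric polynomials\<close>

lemma circle_mult_cnj: "cmod \<zeta> = 1 \<Longrightarrow> \<zeta> * cnj \<zeta> = 1"
  by (simp add: complex_norm_square[symmetric])

text \<open>On the circle \<zeta> times its conjugate is 1, so removing the constant terms of both
  polynomials and one factor \<zeta> from each leaves a product of the same kind with a shorter Q.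
  Hence the functions Q + conj R are closed under multiplication there.\<close>

lemma poly_mult_cnj_poly_circle:
  "\<exists>Q' R'. \<forall>\<zeta>. cmod \<zeta> = 1 \<longrightarrow> poly Q \<zeta> * cnj (poly R \<zeta>) = poly Q' \<zeta> + cnj (poly R' \<zeta>)"
proof (induction Q arbitrary: R)
  case 0
  show ?case by (rule exI[of _ 0], rule exI[of _ 0]) simp
next
  case (pCons a Q)
  obtain b R0 where R: "R = pCons b R0" by (cases R) auto
  obtain Q' R' where *: "\<And>\<zeta>. cmod \<zeta> = 1 \<Longrightarrow> poly Q \<zeta> * cnj (poly R0 \<zeta>) = poly Q' \<zeta> + cnj (poly R' \<zeta>)"
    using pCons.IH[of R0] by blast
  show ?case
  proof (intro exI allI impI)
    fix \<zeta> :: complex assume \<zeta>: "cmod \<zeta> = 1"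
    have "poly (pCons a Q) \<zeta> * cnj (poly R \<zeta>) = a * cnj (poly R \<zeta>) + cnj b * (\<zeta> * poly Q \<zeta>) +
        (\<zeta> * cnj \<zeta>) * (poly Q \<zeta> * cnj (poly R0 \<zeta>))"
      by (simp add: R algebra_simps)
    also have "\<dots> = a * cnj (poly R \<zeta>) + cnj b * (\<zeta> * poly Q \<zeta>) + (poly Q' \<zeta> + cnj (poly R' \<zeta>))"
      using *[OF \<zeta>] circle_mult_cnj[OF \<zeta>] by simp
    also have "\<dots> = poly (smult (cnj b) (pCons 0 Q) + Q') \<zeta> + cnj (poly (smult (cnj a) R + R') \<zeta>)"
      by simp
    finally show "poly (pCons a Q) \<zeta> * cnj (poly R \<zeta>) = \<dots>" .
  qed
qed

text \<open>Real parts of polynomials form an algebra on the circle, and a real linear form g is Re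
  (c \<zeta>) with c = g(1) - i g(i). This converts Stone-Weierstrass in two real variables into
  approximation by real parts of holomorphic polynomials.\<close>

lemma real_polynomial_function_circle:
  assumes "real_polynomial_function (g :: complex \<Rightarrow> real)"
  shows "\<exists>F. \<forall>\<zeta>. cmod \<zeta> = 1 \<longrightarrow> g \<zeta> = Re (poly F \<zeta>)"
  using assms
proof induction
  case (linear g)
  interpret bounded_linear g by fact
  show ?case
  proof (intro exI allI impI)
    fix \<zeta> :: complex
    have "\<zeta> = Re \<zeta> *\<^sub>R 1 + Im \<zeta> *\<^sub>R \<i>" by (simp add: complex_eq_iff)
    then have "g \<zeta> = Re \<zeta> * g 1 + Im \<zeta> * g \<i>" by (metis add scaleR real_scaleR_def)
    then show "g \<zeta> = Re (poly [:0, Complex (g 1) (- g \<i>):] \<zeta>)" by simp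
  qed
next
  case (const c)
  show ?case by (rule exI[of _ "[:of_real c:]"]) simp
next
  case (add f g)
  then show ?case by (metis poly_add plus_complex.sel(1))
next
  case (mult f g)
  then obtain F G where F: "\<And>\<zeta>. cmod \<zeta> = 1 \<Longrightarrow> f \<zeta> = Re (poly F \<zeta>)"
    and G: "\<And>\<zeta>. cmod \<zeta> = 1 \<Longrightarrow> g \<zeta> = Re (poly G \<zeta>)" by blast
  obtain Q' R' where *: "\<And>\<zeta>. cmod \<zeta> = 1 \<Longrightarrow> poly F \<zeta> * cnj (poly G \<zeta>) = poly Q' \<zeta> + cnj (poly R' \<zeta>)"
    using poly_mult_cnj_poly_circle by blast
  show ?case
  proof (intro exI allI impI)
    fix \<zeta> :: complex assume \<zeta>: "cmod \<zeta> = 1"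
    \<comment> \<open>Re a Re b = Re (a b + a conj b) / 2; the second product is split by the
      preceding lemma, and conj R' has the same real part as R'.\<close>
    have "f \<zeta> * g \<zeta> = Re (poly F \<zeta> * poly G \<zeta> + poly F \<zeta> * cnj (poly G \<zeta>)) / 2"
      using F[OF \<zeta>] G[OF \<zeta>] by simp
    also have "\<dots> = Re (poly (smult (1/2) (F * G + Q' + R')) \<zeta>)"
      unfolding *[OF \<zeta>] by simp
    finally show "f \<zeta> * g \<zeta> = \<dots>" .
  qed
qed

lemma real_continuous_approx_Re_poly:
  assumes "continuous_on (sphere 0 1) f" "e > 0"
  shows "\<exists>F. Im (poly F 0) = 0 \<and> (\<forall>\<zeta>::complex. cmod \<zeta> = 1 \<longrightarrow> \<bar>f \<zeta> - Re (poly F \<zeta>)\<bar> < e)"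
proof -
  obtain g where g: "real_polynomial_function g" "\<And>\<zeta>. \<zeta> \<in> sphere 0 1 \<Longrightarrow> \<bar>f \<zeta> - g \<zeta>\<bar> < e"
    using Stone_Weierstrass_real_polynomial_function[OF compact_sphere assms] by blast
  obtain F where F: "\<And>\<zeta>. cmod \<zeta> = 1 \<Longrightarrow> g \<zeta> = Re (poly F \<zeta>)"
    using real_polynomial_function_circle[OF g(1)] by blast
  show ?thesis
    \<comment> \<open>Subtracting an imaginary constant leaves the real part unchanged and makes the
      value at 0 real. The Riesz estimate needs this normalisation, since a real part determines a
      polynomial only up to such a constant.\<close>
    by (rule exI[of _ "F - [:\<i> * of_real (Im (poly F 0)):]"]) (use g(2) F in auto)
qed

lemma continuous_approx_trig:
  assumes "continuous_on (sphere 0 1) f" "e > 0"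
  shows "\<exists>Q R. poly R 0 = 0 \<and> (\<forall>\<zeta>::complex. cmod \<zeta> = 1 \<longrightarrow> cmod (f \<zeta> - (poly Q \<zeta> + cnj (poly R \<zeta>))) < e)"
proof -
  have *: "continuous_on (sphere 0 1) (\<lambda>\<zeta>. Re (f \<zeta>))" "continuous_on (sphere 0 1) (\<lambda>\<zeta>. Im (f \<zeta>))" "e/2 > 0"
    using assms by (auto intro: continuous_intros)
  obtain F G where F: "\<And>\<zeta>. cmod \<zeta> = 1 \<Longrightarrow> \<bar>Re (f \<zeta>) - Re (poly F \<zeta>)\<bar> < e/2"
    and G: "\<And>\<zeta>. cmod \<zeta> = 1 \<Longrightarrow> \<bar>Im (f \<zeta>) - Re (poly G \<zeta>)\<bar> < e/2"
    using real_continuous_approx_Re_poly[OF *(1,3)] real_continuous_approx_Re_poly[OF *(2,3)] by metis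
  \<comment> \<open>Chosen so that Q + conj R = Re F + i Re G. The constant term c of R is then
    moved to Q in conjugated form.\<close>
  define Q where "Q = smult (1/2) (F + smult \<i> G)"
  define R where "R = smult (1/2) (F - smult \<i> G)"
  define c where "c = poly R 0"
  have eq: "poly (Q + [:cnj c:]) \<zeta> + cnj (poly (R - [:c:]) \<zeta>) = Complex (Re (poly F \<zeta>)) (Re (poly G \<zeta>))" for \<zeta>
    by (simp add: Q_def R_def complex_eq_iff field_simps)
  show ?thesis
  proof (intro exI conjI allI impI)
    show "poly (R - [:c:]) 0 = 0" by (simp add: c_def)
    fix \<zeta> :: complex assume \<zeta>: "cmod \<zeta> = 1"
    have "cmod (f \<zeta> - Complex (Re (poly F \<zeta>)) (Re (poly G \<zeta>))) \<le>
      \<bar>Re (f \<zeta>) - Re (poly F \<zeta>)\<bar> + \<bar>Im (f \<zeta>) - Re (poly G \<zeta>)\<bar>"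
      by (rule order_trans[OF cmod_le]) simp
    then show "cmod (f \<zeta> - (poly (Q + [:cnj c:]) \<zeta> + cnj (poly (R - [:c:]) \<zeta>))) < e"
      unfolding eq using F[OF \<zeta>] G[OF \<zeta>] by linarith
  qed
qed

lemma continuous_circle_bounded:
  assumes "continuous_on (sphere 0 1) f"
  shows "\<exists>B. \<forall>\<zeta>::complex. cmod \<zeta> = 1 \<longrightarrow> norm (f \<zeta> :: 'b::real_normed_vector) \<le> B"
proof -
  have "compact (f ` sphere 0 1)" by (rule compact_continuous_image[OF assms compact_sphere])
  then obtain B where "\<And>x. x \<in> f ` sphere 0 1 \<Longrightarrow> norm x \<le> B" using compact_imp_bounded bounded_iff by metis
  then show ?thesis by (intro exI[of _ B]) auto
qed

lemma poly_measurable [measurable]: "poly Q \<in> borel_measurable (borel :: complex measure)"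
  by (intro borel_measurable_continuous_onI continuous_intros)

lemma pint_continuous:
  assumes "continuous_on UNIV f" "p \<ge> 0"
  shows "pint p f"
proof -
  obtain B where "\<And>\<zeta>. cmod \<zeta> = 1 \<Longrightarrow> norm (f \<zeta>) \<le> B"
    using continuous_circle_bounded[of f] assms continuous_on_subset by blast
  then show ?thesis
    by (intro pint_bounded[where B = B] AE_circleI borel_measurable_continuous_onI assms)
qed

lemma pint_poly: "p \<ge> 0 \<Longrightarrow> pint p (poly Q)"
  by (rule pint_continuous) (auto intro!: continuous_intros)

lemma pint_trig: "p \<ge> 0 \<Longrightarrow> pint p (\<lambda>\<zeta>. poly Q \<zeta> + cnj (poly R \<zeta>))"
  by (rule pint_continuous) (auto intro!: continuous_intros)

lemma continuous_imp_integrable_circle: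
  assumes "continuous_on UNIV f"
  shows "integrable \<mu> (f :: complex \<Rightarrow> 'b::{banach,second_countable_topology})"
proof -
  obtain B where "\<And>\<zeta>. cmod \<zeta> = 1 \<Longrightarrow> norm (f \<zeta>) \<le> B"
    using continuous_circle_bounded[of f] assms continuous_on_subset by blast
  moreover have "f \<in> borel_measurable borel" using assms by (rule borel_measurable_continuous_onI)
  ultimately show ?thesis
    by (intro circle.integrable_const_bound[where B = B] AE_circleI) auto
qed

lemma poly_integrable [simp]: "integrable \<mu> (poly Q)"
  by (intro continuous_imp_integrable_circle continuous_intros)

lemma integral_poly_circle: "(\<integral>\<zeta>. poly Q \<zeta> \<partial>\<mu>) = poly Q 0"
proof -
  have int: "integrable \<mu> (\<lambda>\<zeta>::complex. \<zeta> ^ n)" for n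
    by (intro continuous_imp_integrable_circle continuous_intros)
  have "(\<integral>\<zeta>. poly Q \<zeta> \<partial>\<mu>) = (\<Sum>i\<le>degree Q. coeff Q i * (\<integral>\<zeta>. \<zeta> ^ i \<partial>\<mu>))"
    unfolding poly_altdef by (subst Bochner_Integration.integral_sum) (auto simp: int)
  also have "\<dots> = (\<Sum>i\<le>degree Q. if i = 0 then coeff Q 0 else 0)"
    by (intro sum.cong) (auto simp: integral_power_circle)
  also have "\<dots> = poly Q 0" by (simp add: poly_0_coeff_0)
  finally show ?thesis .
qed

text \<open>Membership in the L^p closure of the trigonometric polynomials Q + conj R. The condition
  \<open>poly R 0 = 0\<close> assigns the constant term to Q, so that Q is the analytic part of the
  sum.\<close>

definition trig_dense :: "real \<Rightarrow> (complex \<Rightarrow> complex) \<Rightarrow> bool" where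
  "trig_dense p f \<longleftrightarrow> pint p f \<and>
     (\<forall>e>0. \<exists>Q R. poly R 0 = 0 \<and> pmass p (\<lambda>\<zeta>. f \<zeta> - (poly Q \<zeta> + cnj (poly R \<zeta>))) < e)"

lemma trig_dense_limit:
  assumes f: "pint p f" and "p \<ge> 0" and lim: "\<And>e. e > 0 \<Longrightarrow> \<exists>g. trig_dense p g \<and> pmass p (\<lambda>\<zeta>. f \<zeta> - g \<zeta>) < e"
  shows "trig_dense p f"
  unfolding trig_dense_def
proof (intro conjI allI impI f)
  fix e :: real assume e: "e > 0"
  \<comment> \<open>Two errors of size d enter the quasi-triangle inequality with factor
    \<open>2 powr p\<close>.\<close>
  define d where "d = e / (2 * 2 powr p)"
  have d: "d > 0" using e by (simp add: d_def)
  obtain g where g: "trig_dense p g" "pmass p (\<lambda>\<zeta>. f \<zeta> - g \<zeta>) < d" using lim[OF d] by blast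
  obtain Q R where QR: "poly R 0 = 0" "pmass p (\<lambda>\<zeta>. g \<zeta> - (poly Q \<zeta> + cnj (poly R \<zeta>))) < d"
    using g(1) d unfolding trig_dense_def by blast
  have gi: "pint p g" using g by (simp add: trig_dense_def)
  have "pmass p (\<lambda>\<zeta>. (f \<zeta> - g \<zeta>) + (g \<zeta> - (poly Q \<zeta> + cnj (poly R \<zeta>)))) \<le>
     2 powr p * (pmass p (\<lambda>\<zeta>. f \<zeta> - g \<zeta>) + pmass p (\<lambda>\<zeta>. g \<zeta> - (poly Q \<zeta> + cnj (poly R \<zeta>))))"
    using f gi \<open>p \<ge> 0\<close> by (intro pint_add pint_diff pint_trig) auto
  also have "\<dots> < 2 powr p * (d + d)" using g QR by (intro mult_strict_left_mono add_strict_mono) auto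
  also have "\<dots> = e" by (simp add: d_def)
  finally have "pmass p (\<lambda>\<zeta>. f \<zeta> - (poly Q \<zeta> + cnj (poly R \<zeta>))) < e" by (simp add: algebra_simps)
  then show "\<exists>Q R. poly R 0 = 0 \<and> pmass p (\<lambda>\<zeta>. f \<zeta> - (poly Q \<zeta> + cnj (poly R \<zeta>))) < e"
    using QR(1) by blast
qed

lemma trig_dense_add:
  assumes f: "trig_dense p f" and g: "trig_dense p g" and p: "p \<ge> 0"
  shows "trig_dense p (\<lambda>\<zeta>. f \<zeta> + g \<zeta>)"
  unfolding trig_dense_def
proof (intro conjI allI impI)
  have fi: "pint p f" and gi: "pint p g" using f g by (auto simp: trig_dense_def)
  then show "pint p (\<lambda>\<zeta>. f \<zeta> + g \<zeta>)" using p by (rule pint_add)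
  fix e :: real assume e: "e > 0"
  define d where "d = e / (2 * 2 powr p)"
  have d: "d > 0" using e by (simp add: d_def)
  obtain Q R where QR: "poly R 0 = 0" "pmass p (\<lambda>\<zeta>. f \<zeta> - (poly Q \<zeta> + cnj (poly R \<zeta>))) < d"
    using f d unfolding trig_dense_def by blast
  obtain Q' R' where QR': "poly R' 0 = 0" "pmass p (\<lambda>\<zeta>. g \<zeta> - (poly Q' \<zeta> + cnj (poly R' \<zeta>))) < d"
    using g d unfolding trig_dense_def by blast
  have "pmass p (\<lambda>\<zeta>. (f \<zeta> - (poly Q \<zeta> + cnj (poly R \<zeta>))) + (g \<zeta> - (poly Q' \<zeta> + cnj (poly R' \<zeta>)))) \<le>
     2 powr p * (pmass p (\<lambda>\<zeta>. f \<zeta> - (poly Q \<zeta> + cnj (poly R \<zeta>))) + pmass p (\<lambda>\<zeta>. g \<zeta> - (poly Q' \<zeta> + cnj (poly R' \<zeta>))))"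
    using fi gi p by (intro pint_add pint_diff pint_trig) auto
  also have "\<dots> < 2 powr p * (d + d)" using QR' QR by (intro mult_strict_left_mono add_strict_mono) auto
  also have "\<dots> = e" by (simp add: d_def)
  finally have "pmass p (\<lambda>\<zeta>. (f \<zeta> + g \<zeta>) - (poly (Q + Q') \<zeta> + cnj (poly (R + R') \<zeta>))) < e"
    by (simp add: algebra_simps)
  then show "\<exists>Q R. poly R 0 = 0 \<and> pmass p (\<lambda>\<zeta>. f \<zeta> + g \<zeta> - (poly Q \<zeta> + cnj (poly R \<zeta>))) < e"
    using QR(1) QR'(1) by (intro exI[of _ "Q + Q'"] exI[of _ "R + R'"]) simp
qed

lemma trig_dense_cmult:
  assumes f: "trig_dense p f" and p: "p \<ge> 0"
  shows "trig_dense p (\<lambda>\<zeta>. c * f \<zeta>)"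
  unfolding trig_dense_def
proof (intro conjI allI impI)
  have fi: "pint p f" using f by (auto simp: trig_dense_def)
  then show "pint p (\<lambda>\<zeta>. c * f \<zeta>)" using p by (rule pint_cmult)
  fix e :: real assume e: "e > 0"
  define d where "d = e / (cmod c powr p + 1)"
  have c1: "cmod c powr p + 1 > 0" by (simp add: add_nonneg_pos)
  have d: "d > 0" using e c1 by (simp add: d_def)
  obtain Q R where QR: "poly R 0 = 0" "pmass p (\<lambda>\<zeta>. f \<zeta> - (poly Q \<zeta> + cnj (poly R \<zeta>))) < d"
    using f d unfolding trig_dense_def by blast
  have "pmass p (\<lambda>\<zeta>. c * (f \<zeta> - (poly Q \<zeta> + cnj (poly R \<zeta>)))) =
     cmod c powr p * pmass p (\<lambda>\<zeta>. f \<zeta> - (poly Q \<zeta> + cnj (poly R \<zeta>)))"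
    using fi p by (intro pint_cmult pint_diff pint_trig) auto
  also have "\<dots> \<le> cmod c powr p * d" using QR by (intro mult_left_mono) auto
  also have "\<dots> < (cmod c powr p + 1) * d" using d by (intro mult_strict_right_mono) auto
  also have "\<dots> = e" using c1 by (simp add: d_def)
  finally have "pmass p (\<lambda>\<zeta>. c * f \<zeta> - (poly (smult c Q) \<zeta> + cnj (poly (smult (cnj c) R) \<zeta>))) < e"
    by (simp add: algebra_simps)
  then show "\<exists>Q R. poly R 0 = 0 \<and> pmass p (\<lambda>\<zeta>. c * f \<zeta> - (poly Q \<zeta> + cnj (poly R \<zeta>))) < e"
    using QR(1) by (intro exI[of _ "smult c Q"] exI[of _ "smult (cnj c) R"]) simp
qed

lemma trig_dense_sum:
  assumes "finite A" "\<And>y. y \<in> A \<Longrightarrow> trig_dense p (f y)" and p: "p \<ge> 0"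
  shows "trig_dense p (\<lambda>\<zeta>. \<Sum>y\<in>A. f y \<zeta>)"
  using assms(1,2)
proof (induction rule: finite_induct)
  case empty
  show ?case unfolding trig_dense_def
    by (auto intro!: exI[of _ 0] simp: pint_def pmass_def)
qed (auto intro!: trig_dense_add p)

lemma trig_dense_continuous:
  assumes f: "continuous_on UNIV f" and p: "p > 0"
  shows "trig_dense p f"
  unfolding trig_dense_def
proof (intro conjI allI impI)
  show fi: "pint p f" by (rule pint_continuous) (use assms in auto)
  fix e :: real assume e: "e > 0"
  define d where "d = (e / 2) powr (1/p)"
  have d: "d > 0" using e by (simp add: d_def)
  obtain Q R where QR: "poly R 0 = 0" "\<And>\<zeta>. cmod \<zeta> = 1 \<Longrightarrow> cmod (f \<zeta> - (poly Q \<zeta> + cnj (poly R \<zeta>))) < d"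
    using continuous_approx_trig[OF continuous_on_subset[OF f] d] by blast
  note [measurable] = pint_measurable[OF fi]
  have "pmass p (\<lambda>\<zeta>. f \<zeta> - (poly Q \<zeta> + cnj (poly R \<zeta>))) \<le> d powr p"
    using QR p by (intro pmass_bounded AE_circleI less_imp_le) auto
  also have "\<dots> < e" using e p by (simp add: d_def powr_powr)
  finally show "\<exists>Q R. poly R 0 = 0 \<and> pmass p (\<lambda>\<zeta>. f \<zeta> - (poly Q \<zeta> + cnj (poly R \<zeta>))) < e"
    using QR(1) by blast
qed

text \<open>Regularity gives a compact K inside E and an open U around E with small difference, and
  Urysohn a continuous g equal to 1 on K and 0 off U. The error is at most the indicator of U - K,
  whose p-th power is itself.\<close>

lemma trig_dense_indicator:
  assumes E: "E \<in> sets borel" and p: "p > 0"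
  shows "trig_dense p (indicator E)"
proof (rule trig_dense_limit)
  have [measurable]: "E \<in> sets borel" by fact
  show "pint p (indicator E)"
    by (rule pint_bounded[where B = 1]) (use p in \<open>auto simp: indicator_def\<close>)
  show "p \<ge> 0" using p by simp
  fix e :: real assume e: "e > 0"
  have fin: "emeasure \<mu> (space \<mu>) \<noteq> \<infinity>" by simp
  have E': "emeasure \<mu> E \<noteq> \<infinity>" by simp
  have em: "emeasure \<mu> A = ennreal (measure \<mu> A)" for A by (rule circle.emeasure_eq_measure)
  have "\<exists>K. K \<subseteq> E \<and> compact K \<and> measure \<mu> E - e / 2 < measure \<mu> K"
  proof -
    \<comment> \<open>The case distinction is forced by \<open>ennreal\<close>, which truncates a
      negative argument to 0; in that case the empty set serves as K.\<close>
    have "ennreal (measure \<mu> E - e/2) < emeasure \<mu> E \<or> measure \<mu> E - e/2 < 0"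
      using e by (cases "measure \<mu> E - e/2 < 0") (auto simp: em ennreal_less_iff)
    then show ?thesis
    proof
      assume "measure \<mu> E - e/2 < 0"
      then show ?thesis by (intro exI[of _ "{}"]) auto
    next
      assume "ennreal (measure \<mu> E - e/2) < emeasure \<mu> E"
      then obtain K where K: "K \<subseteq> E" "compact K" "ennreal (measure \<mu> E - e/2) < emeasure \<mu> K"
        unfolding inner_regular[OF sets_circle_measure fin E] less_SUP_iff by auto
      then have "measure \<mu> E - e/2 < measure \<mu> K"
        using less_le_trans[OF _ measure_nonneg[of \<mu> K]]
        by (cases "measure \<mu> E - e/2 < 0") (blast, simp add: em ennreal_less_iff)
      with K show ?thesis by blast
    qed
  qed
  then obtain K where K: "K \<subseteq> E" "compact K" "measure \<mu> E - e / 2 < measure \<mu> K" by blast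
  have "emeasure \<mu> E < ennreal (measure \<mu> E + e/2)" using e by (simp add: em ennreal_less_iff)
  then obtain U where U: "E \<subseteq> U" "open U" "emeasure \<mu> U < ennreal (measure \<mu> E + e/2)"
    unfolding outer_regular[OF sets_circle_measure fin E] INF_less_iff by auto
  have U': "measure \<mu> U < measure \<mu> E + e/2" using U(3) by (simp add: em ennreal_less_iff)
  have [measurable]: "K \<in> sets borel" "U \<in> sets borel" using K U by (auto simp: borel_compact)
  obtain g :: "complex \<Rightarrow> real" where g: "continuous_on UNIV g" "\<And>x. g x \<in> closed_segment 1 0"
      "\<And>x. x \<in> K \<Longrightarrow> g x = 1" "\<And>x. x \<in> - U \<Longrightarrow> g x = 0"
    using Urysohn_local[of UNIV K "- U" "1::real" 0] K U compact_imp_closed[OF K(2)]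
    by (auto simp: closed_Compl)
  have g01: "0 \<le> g x" "g x \<le> 1" for x using g(2)[of x] by (auto simp: closed_segment_eq_real_ivl)
  have gm [measurable]: "g \<in> borel_measurable borel" using g(1) by (rule borel_measurable_continuous_onI)
  show "\<exists>g. trig_dense p g \<and> pmass p (\<lambda>\<zeta>. indicator E \<zeta> - g \<zeta>) < e"
  proof (intro exI conjI)
    show "trig_dense p (\<lambda>x. of_real (g x))"
      by (rule trig_dense_continuous) (intro continuous_intros g p)+
    have "pmass p (\<lambda>\<zeta>. indicator E \<zeta> - complex_of_real (g \<zeta>)) \<le> (\<integral>\<zeta>. indicator (U - K) \<zeta> \<partial>\<mu>)"
      unfolding pmass_def
    proof (rule integral_mono')
      show "integrable \<mu> (indicat_real (U - K))"
        using circle.emeasure_finite[of "U - K"] by (intro integrable_real_indicator) (simp_all add: less_top del: circle.emeasure_finite)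
      fix \<zeta>
      have "indicator E \<zeta> - complex_of_real (g \<zeta>) = of_real (indicator E \<zeta> - g \<zeta>)"
        by (simp add: indicator_def)
      then have "cmod (indicator E \<zeta> - complex_of_real (g \<zeta>)) = \<bar>indicator E \<zeta> - g \<zeta>\<bar>"
        by (simp only: norm_of_real)
      then have "cmod (indicator E \<zeta> - complex_of_real (g \<zeta>)) \<le> indicator (U - K) \<zeta>"
        using K(1) U(1) g(3,4)[of \<zeta>] g01[of \<zeta>] by (auto simp: indicator_def)
      moreover have "\<dots> = 0 \<or> \<dots> = (1::real)" by (auto simp: indicator_def)
      ultimately show "cmod (indicator E \<zeta> - complex_of_real (g \<zeta>)) powr p \<le> indicator (U - K) \<zeta>"
        using p by (auto simp: powr_le1)
    qed auto
    also have "\<dots> = measure \<mu> (U - K)" by simp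
    also have "\<dots> = measure \<mu> U - measure \<mu> K"
      using K U by (intro circle.finite_measure_Diff) auto
    also have "\<dots> < e" using K U' by simp
    finally show "pmass p (\<lambda>\<zeta>. indicator E \<zeta> - complex_of_real (g \<zeta>)) < e" .
  qed
qed

lemma trig_dense_pint:
  assumes f: "pint p f" and p: "p > 0"
  shows "trig_dense p f"
proof (rule trig_dense_limit[OF f])
  show "p \<ge> 0" using p by simp
  note [measurable] = pint_measurable[OF f]
  obtain F where F: "\<And>i. simple_function borel (F i)" "\<And>x. (\<lambda>i. F i x) \<longlonglongrightarrow> f x"
      "\<And>i x. cmod (F i x) \<le> 2 * cmod (f x)"
    using borel_measurable_implies_sequence_metric[of f borel 0] by (auto simp: dist_norm)
  have Fm [measurable]: "F i \<in> borel_measurable borel" for i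
    using F(1) borel_measurable_simple_function by blast
  have Fd: "trig_dense p (F i)" for i
  proof -
    have fin: "finite (range (F i))" using F(1)[of i] by (simp add: simple_function_def)
    have eq: "F i = (\<lambda>\<zeta>. \<Sum>y\<in>range (F i). y * indicator (F i -` {y}) \<zeta>)"
    proof
      fix \<zeta>
      have "(\<Sum>y\<in>range (F i). y * indicator (F i -` {y}) \<zeta>) = (\<Sum>y\<in>range (F i). if F i \<zeta> = y then y else 0)"
        by (intro sum.cong) (auto simp: indicator_def)
      then show "F i \<zeta> = (\<Sum>y\<in>range (F i). y * indicator (F i -` {y}) \<zeta>)" using fin by simp
    qed
    have "F i -` {y} \<in> sets borel" for y using measurable_sets[OF Fm, of "{y}" i] by simp
    then show ?thesis
      using p fin by (subst eq) (intro trig_dense_sum trig_dense_cmult trig_dense_indicator; simp)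
  qed
  fix e :: real assume e: "e > 0"
  \<comment> \<open>Dominated convergence: the simple functions satisfy |F i| <= 2 |f|, so the
    differences are bounded by 3 |f|.\<close>
  have "(\<lambda>i. pmass p (\<lambda>\<zeta>. f \<zeta> - F i \<zeta>)) \<longlonglongrightarrow> (\<integral>\<zeta>. 0 \<partial>\<mu>)"
    unfolding pmass_def
  proof (rule integral_dominated_convergence)
    show "integrable \<mu> (\<lambda>\<zeta>. 3 powr p * cmod (f \<zeta>) powr p)" using f by (simp add: pint_def)
    show "AE \<zeta> in \<mu>. norm (cmod (f \<zeta> - F i \<zeta>) powr p) \<le> 3 powr p * cmod (f \<zeta>) powr p" for i
    proof (rule AE_I2)
      fix \<zeta>
      have "cmod (f \<zeta> - F i \<zeta>) \<le> 3 * cmod (f \<zeta>)"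
        using norm_triangle_ineq4[of "f \<zeta>" "F i \<zeta>"] F(3)[of i \<zeta>] by linarith
      then have "cmod (f \<zeta> - F i \<zeta>) powr p \<le> (3 * cmod (f \<zeta>)) powr p" using p by (intro powr_mono2) auto
      then show "norm (cmod (f \<zeta> - F i \<zeta>) powr p) \<le> 3 powr p * cmod (f \<zeta>) powr p" by (simp add: powr_mult)
    qed
    show "AE \<zeta> in \<mu>. (\<lambda>i. cmod (f \<zeta> - F i \<zeta>) powr p) \<longlonglongrightarrow> 0"
    proof (rule AE_I2)
      fix \<zeta>
      have "(\<lambda>i. cmod (f \<zeta> - F i \<zeta>)) \<longlonglongrightarrow> cmod (f \<zeta> - f \<zeta>)" by (intro tendsto_intros F)
      then have "(\<lambda>i. cmod (f \<zeta> - F i \<zeta>) powr p) \<longlonglongrightarrow> 0 powr p"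
        using p by (intro tendsto_powr' tendsto_const) auto
      then show "(\<lambda>i. cmod (f \<zeta> - F i \<zeta>) powr p) \<longlonglongrightarrow> 0" by simp
    qed
  qed auto
  then have "eventually (\<lambda>i. pmass p (\<lambda>\<zeta>. f \<zeta> - F i \<zeta>) < e) sequentially"
    using e by (simp add: order_tendsto_iff)
  then obtain i where "pmass p (\<lambda>\<zeta>. f \<zeta> - F i \<zeta>) < e"
    by (auto simp: eventually_sequentially)
  with Fd show "\<exists>g. trig_dense p g \<and> pmass p (\<lambda>\<zeta>. f \<zeta> - g \<zeta>) < e" by blast
qed

lemma trig_dense_Lp:
  assumes "pint p f" "p > 0" "e > 0"
  obtains Q R where "poly R 0 = 0" "pmass p (\<lambda>\<zeta>. f \<zeta> - (poly Q \<zeta> + cnj (poly R \<zeta>))) < e"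
  using trig_dense_pint[OF assms(1,2)] assms(3) unfolding trig_dense_def by blast

section \<open>The inequality of M. Riesz\<close>

text \<open>Near |\<theta>| = pi/2 the value cos (p \<theta>) is negative and bounded away from 0,
  since p > 1, so the term with B produces the 1; away from there cos \<theta> is bounded below and
  the term with A does. The assumption p <= 2 keeps p |\<theta>| in [0, pi], where cos
  decreases.\<close>

lemma cos_powr_bound:
  fixes p :: real
  assumes p: "1 < p" "p \<le> 2"
  shows "\<exists>A\<ge>0. \<exists>B\<ge>0. \<forall>\<theta>. \<bar>\<theta>\<bar> < pi/2 \<longrightarrow> 1 \<le> A * cos \<theta> powr p - B * cos (p * \<theta>)"
proof -
  \<comment> \<open>The midpoint between pi/(2p), where cos (p \<theta>) changes sign, and
    pi/2.\<close>
  define \<theta>0 where "\<theta>0 = (pi/2 + pi/(2*p)) / 2"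
  have t0: "0 < \<theta>0" "\<theta>0 < pi/2" using p by (auto simp: \<theta>0_def field_simps intro!: add_pos_pos mult_pos_pos)
  have pt0: "pi/2 < p * \<theta>0" "p * \<theta>0 < pi"
  proof -
    have "p * \<theta>0 - pi/2 = (p - 1) * pi / 4" "pi - p * \<theta>0 = (3 - p) * pi / 4"
      using p by (simp_all add: \<theta>0_def field_simps)
    moreover have "(p - 1) * pi / 4 > 0" "(3 - p) * pi / 4 > 0" using p by auto
    ultimately show "pi/2 < p * \<theta>0" "p * \<theta>0 < pi" by (metis diff_gt_0_iff_gt)+
  qed
  define c where "c = - cos (p * \<theta>0)"
  have c: "c > 0" using pt0 cos_lt_zero_pi[of "p * \<theta>0"] by (simp add: c_def)
  define d where "d = cos \<theta>0 powr p"
  have cos0: "cos \<theta>0 > 0" using t0 by (intro cos_gt_zero) auto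
  have d: "d > 0" using cos0 by (simp add: d_def)
  show ?thesis
  proof (intro exI conjI allI impI)
    \<comment> \<open>B = 1/c makes the second term contribute at least 1 beyond \<theta>0. Before
      \<theta>0 that term may cost as much as 1/c, which the numerator 1 + 1/c of A covers.\<close>
    show "(1 + 1/c) / d \<ge> 0" "1/c \<ge> 0" using c d by auto
    have main: "1 \<le> (1 + 1/c) / d * cos \<theta> powr p - 1/c * cos (p * \<theta>)" if \<theta>: "0 \<le> \<theta>" "\<theta> < pi/2" for \<theta>
    proof (cases "\<theta> \<le> \<theta>0")
      case True
      have "cos \<theta>0 \<le> cos \<theta>" using True \<theta> t0 by (intro cos_monotone_0_pi_le) auto
      then have "d \<le> cos \<theta> powr p" using cos0 p unfolding d_def by (intro powr_mono2) auto
      then have "1 + 1/c \<le> (1 + 1/c) / d * cos \<theta> powr p"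
        using c d by (simp add: pos_le_divide_eq mult_left_mono)
      moreover have "1/c * cos (p * \<theta>) \<le> 1/c * 1" using c by (intro mult_left_mono) auto
      ultimately show ?thesis by simp
    next
      case False
      have "p * \<theta> \<le> pi" using p \<theta> mult_mono[of p 2 \<theta> "pi/2"] by auto
      then have "cos (p * \<theta>) \<le> cos (p * \<theta>0)" using False p t0
        by (intro cos_monotone_0_pi_le) auto
      then have "cos (p * \<theta>) \<le> - c" by (simp add: c_def)
      then have "1/c * cos (p * \<theta>) \<le> 1/c * (-c)" using c by (intro mult_left_mono) auto
      moreover have "0 \<le> (1 + 1/c) / d * cos \<theta> powr p" using c d by auto
      ultimately show ?thesis using c by simp
    qed
    fix \<theta> :: real assume "\<bar>\<theta>\<bar> < pi/2"
    then show "1 \<le> (1 + 1/c) / d * cos \<theta> powr p - 1/c * cos (p * \<theta>)"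
      using main[of "\<bar>\<theta>\<bar>"] by (cases "\<theta> \<ge> 0") (auto simp: cos_minus)
  qed
qed

text \<open>The trigonometric inequality multiplied by |w|^p, with \<theta> the argument of w: then
  (Re w)^p is |w|^p times the p-th power of cos \<theta>, and Re (w^p) = |w|^p cos (p
  \<theta>).\<close>

lemma norm_powr_le_Re:
  fixes p :: real
  assumes p: "1 < p" "p \<le> 2"
  shows "\<exists>A\<ge>0. \<exists>B\<ge>0. \<forall>w. Re w > 0 \<longrightarrow> cmod w powr p \<le> A * Re w powr p - B * Re (w powr (of_real p))"
proof -
  obtain A B where AB: "A \<ge> 0" "B \<ge> 0" "\<And>\<theta>. \<bar>\<theta>\<bar> < pi/2 \<Longrightarrow> 1 \<le> A * cos \<theta> powr p - B * cos (p * \<theta>)"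
    using cos_powr_bound[OF p] by blast
  have "cmod w powr p \<le> A * Re w powr p - B * Re (w powr (of_real p))" if w: "Re w > 0" for w
  proof -
    from w have w0: "w \<noteq> 0" by auto
    define \<theta> where "\<theta> = Im (Ln w)"
    have th: "\<bar>\<theta>\<bar> < pi/2" using w w0 Re_Ln_pos_lt[of w] by (simp add: \<theta>_def)
    have "Re w = cmod w * cos \<theta>"
      using Re_exp[of "Ln w"] w0 by (simp add: \<theta>_def)
    then have 1: "Re w powr p = cmod w powr p * cos \<theta> powr p"
      using th by (simp add: powr_mult cos_ge_zero)
    have 2: "Re (w powr (of_real p)) = cmod w powr p * cos (p * \<theta>)"
      using w0 by (simp add: powr_def Re_exp \<theta>_def powr_def[of "cmod w"])
    have "cmod w powr p * 1 \<le> cmod w powr p * (A * cos \<theta> powr p - B * cos (p * \<theta>))"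
      using AB(3)[OF th] by (intro mult_left_mono) auto
    then show "cmod w powr p \<le> A * Re w powr p - B * Re (w powr (of_real p))"
      by (simp add: 1 2 algebra_simps)
  qed
  with AB(1,2) show ?thesis by blast
qed

text \<open>Termwise integration of the power series on the circle of radius r: every monomial of
  positive degree has mean 0. The cut-off \<open>G'\<close> provides a Borel function on the whole
  plane.\<close>

lemma integral_holomorphic_circle:
  assumes G: "G holomorphic_on ball 0 1" and r: "0 \<le> r" "r < 1"
  defines "G' \<equiv> (\<lambda>z. indicator (ball 0 1) z *\<^sub>R G z)"
  shows "(\<integral>\<zeta>. G' (of_real r * \<zeta>) * \<zeta> ^ m \<partial>\<mu>) = (if m = 0 then G 0 else 0)"
proof -
  define c where "c n = (deriv ^^ n) G 0 / fact n" for n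
    have [measurable]: "G' \<in> borel_measurable borel" unfolding G'_def
      using G by (intro borel_measurable_continuous_on_indicator holomorphic_on_imp_continuous_on) auto
  have sums: "(\<lambda>n. c n * z ^ n) sums G z" if "z \<in> ball 0 1" for z
    using holomorphic_power_series[OF G that] by (simp add: c_def)
  \<comment> \<open>Convergence at the larger radius s gives absolute convergence at r.\<close>
  define s where "s = (r + 1) / 2"
  have s: "r < s" "s < 1" using r by (auto simp: s_def)
  have "summable (\<lambda>n. c n * (of_real s) ^ n)" using sums[of "of_real s"] s r by (auto simp: sums_iff)
  then have sm: "summable (\<lambda>n. norm (c n * of_real r ^ n))"
    by (rule powser_insidea) (use s r in auto)
  have int: "integrable \<mu> (\<lambda>\<zeta>::complex. c n * of_real r ^ n * \<zeta> ^ (n + m))" for n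
    by (intro continuous_imp_integrable_circle continuous_intros)
  have nrm: "AE \<zeta> in \<mu>. norm (c n * of_real r ^ n * \<zeta> ^ (n + m)) = norm (c n * of_real r ^ n)" for n
    by (intro AE_circleI) (simp add: norm_mult norm_power)
  have 1: "(\<integral>\<zeta>. norm (c n * of_real r ^ n * \<zeta> ^ (n + m)) \<partial>\<mu>) = norm (c n * of_real r ^ n)" for n
  proof -
    have "(\<integral>\<zeta>. norm (c n * of_real r ^ n * \<zeta> ^ (n + m)) \<partial>\<mu>) = (\<integral>\<zeta>. norm (c n * of_real r ^ n) \<partial>\<mu>)"
      using nrm by (intro integral_cong_AE) auto
    then show ?thesis by simp
  qed
  have sums1: "(\<lambda>n. \<integral>\<zeta>. c n * of_real r ^ n * \<zeta> ^ (n + m) \<partial>\<mu>) sums (\<integral>\<zeta>. (\<Sum>n. c n * of_real r ^ n * \<zeta> ^ (n + m)) \<partial>\<mu>)"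
  proof (rule sums_integral[OF int])
    show "AE \<zeta> in \<mu>. summable (\<lambda>n. norm (c n * of_real r ^ n * \<zeta> ^ (n + m)))"
      by (intro AE_circleI) (use sm in \<open>simp add: norm_mult norm_power\<close>)
    show "summable (\<lambda>n. \<integral>\<zeta>. norm (c n * of_real r ^ n * \<zeta> ^ (n + m)) \<partial>\<mu>)"
      unfolding 1 by (rule sm)
  qed
  have coeff: "(\<integral>\<zeta>. c n * of_real r ^ n * \<zeta> ^ (n + m) \<partial>\<mu>) = (if n = 0 then if m = 0 then c 0 else 0 else 0)" for n
    by (auto simp: integral_power_circle)
  have sums2: "(\<lambda>n. if n = 0 then if m = 0 then c 0 else 0 else 0) sums (if m = 0 then c 0 else 0)"
    using sums_single[of 0 "\<lambda>_. if m = 0 then c 0 else 0"] by (simp add: if_distrib cong: if_cong)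
  have "(\<integral>\<zeta>. (\<Sum>n. c n * of_real r ^ n * \<zeta> ^ (n + m)) \<partial>\<mu>) = (if m = 0 then c 0 else 0)"
    by (rule sums_unique2[OF sums1[unfolded coeff] sums2])
  moreover have "(\<integral>\<zeta>. G' (of_real r * \<zeta>) * \<zeta> ^ m \<partial>\<mu>) = (\<integral>\<zeta>. (\<Sum>n. c n * of_real r ^ n * \<zeta> ^ (n + m)) \<partial>\<mu>)"
  proof (rule integral_cong_AE)
    show "AE \<zeta> in \<mu>. G' (of_real r * \<zeta>) * \<zeta> ^ m = (\<Sum>n. c n * of_real r ^ n * \<zeta> ^ (n + m))"
    proof (rule AE_circleI)
      fix \<zeta> :: complex assume \<zeta>: "cmod \<zeta> = 1"
      then have "(\<lambda>n. c n * (of_real r * \<zeta>) ^ n * \<zeta> ^ m) sums (G (of_real r * \<zeta>) * \<zeta> ^ m)"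
        using r by (intro sums_mult2 sums) (auto simp: norm_mult)
      then show "G' (of_real r * \<zeta>) * \<zeta> ^ m = (\<Sum>n. c n * of_real r ^ n * \<zeta> ^ (n + m))"
        using \<zeta> r by (simp add: sums_iff power_mult_distrib power_add mult_ac G'_def norm_mult)
    qed
  qed measurable
  moreover have "c 0 = G 0" by (simp add: c_def)
  ultimately show ?thesis by simp
qed

text \<open>The identities on circles of radius r < 1 pass to the boundary by dominated convergence,
  along a sequence of radii tending to 1. Hence the boundary values of a bounded holomorphic
  function have no negative Fourier coefficients.\<close>

lemma radial_limit_integral:
  assumes G: "G holomorphic_on ball 0 1" and B: "\<And>z. z \<in> ball 0 1 \<Longrightarrow> cmod (G z) \<le> B"
    and [measurable]: "g \<in> borel_measurable borel"
    and lim: "AE \<zeta> in \<mu>. ((\<lambda>r. G (of_real r * \<zeta>)) \<longlongrightarrow> g \<zeta>) (at_left 1)"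
  shows "(\<integral>\<zeta>. g \<zeta> * \<zeta> ^ m \<partial>\<mu>) = (if m = 0 then G 0 else 0)"
    and "AE \<zeta> in \<mu>. cmod (g \<zeta>) \<le> B"
proof -
  define G' where "G' = (\<lambda>z. indicator (ball 0 1) z *\<^sub>R G z)"
  have [measurable]: "G' \<in> borel_measurable borel" unfolding G'_def
    using G by (intro borel_measurable_continuous_on_indicator holomorphic_on_imp_continuous_on) auto
  define r where "r k = 1 - 1 / (real k + 1)" for k
  have r: "0 \<le> r k" "r k < 1" for k by (auto simp: r_def)
  have "r \<longlonglongrightarrow> 1" unfolding r_def by real_asymp
  then have rl: "filterlim r (at_left 1) sequentially"
    by (auto simp: filterlim_at r intro!: always_eventually less_imp_neq)
  have lim': "AE \<zeta> in \<mu>. (\<lambda>k. G' (of_real (r k) * \<zeta>)) \<longlonglongrightarrow> g \<zeta>"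
    using lim AE_circle_norm
  proof eventually_elim
    case (elim \<zeta>)
    have "(\<lambda>k. G (of_real (r k) * \<zeta>)) \<longlonglongrightarrow> g \<zeta>" using filterlim_compose[OF elim(1) rl] by simp
    moreover have "G' (of_real (r k) * \<zeta>) = G (of_real (r k) * \<zeta>)" for k
      using elim(2) r[of k] by (simp add: G'_def norm_mult)
    ultimately show ?case by simp
  qed
  have B0: "B \<ge> 0" using order_trans[OF norm_ge_zero B[of 0]] by simp
  have G'B: "cmod (G' z) \<le> B" for z using B[of z] B0 by (auto simp: G'_def indicator_def)
  show "AE \<zeta> in \<mu>. cmod (g \<zeta>) \<le> B" using lim'
  proof eventually_elim
    case (elim \<zeta>)
    then have "(\<lambda>k. cmod (G' (of_real (r k) * \<zeta>))) \<longlonglongrightarrow> cmod (g \<zeta>)" by (rule tendsto_norm)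
    then show ?case by (rule LIMSEQ_le_const2) (use G'B in auto)
  qed
  have L: "(\<lambda>k. \<integral>\<zeta>. G' (of_real (r k) * \<zeta>) * \<zeta> ^ m \<partial>\<mu>) \<longlonglongrightarrow> (\<integral>\<zeta>. g \<zeta> * \<zeta> ^ m \<partial>\<mu>)"
  proof (rule integral_dominated_convergence)
    show "integrable \<mu> (\<lambda>\<zeta>. B)" by simp
    show "AE \<zeta> in \<mu>. norm (G' (of_real (r k) * \<zeta>) * \<zeta> ^ m) \<le> B" for k
      by (rule AE_circleI) (use G'B in \<open>auto simp: norm_mult norm_power\<close>)
    show "AE \<zeta> in \<mu>. (\<lambda>k. G' (of_real (r k) * \<zeta>) * \<zeta> ^ m) \<longlonglongrightarrow> g \<zeta> * \<zeta> ^ m"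
      using lim' by eventually_elim (intro tendsto_intros)
  qed measurable
  have C: "(\<integral>\<zeta>. G' (of_real (r k) * \<zeta>) * \<zeta> ^ m \<partial>\<mu>) = (if m = 0 then G 0 else 0)" for k
    unfolding G'_def by (rule integral_holomorphic_circle[OF G r])
  show "(\<integral>\<zeta>. g \<zeta> * \<zeta> ^ m \<partial>\<mu>) = (if m = 0 then G 0 else 0)"
    by (rule LIMSEQ_unique[OF L]) (simp only: C tendsto_const)
qed

text \<open>Maximum principle for the real part of -F on the closed disc.\<close>

lemma poly_Re_pos_disc:
  assumes "\<And>\<zeta>. cmod \<zeta> = 1 \<Longrightarrow> Re (poly F \<zeta>) > 0" and z: "cmod z \<le> 1"
  shows "Re (poly F z) > 0"
proof -
  have ne: "sphere (0::complex) 1 \<noteq> {}" by (metis sphere_eq_empty zero_less_one not_less_iff_gr_or_eq)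
  have "continuous_on (sphere 0 1) (\<lambda>\<zeta>. Re (poly F \<zeta>))" by (intro continuous_intros)
  then obtain \<zeta>0 where z0: "\<zeta>0 \<in> sphere 0 1" "\<And>\<zeta>. \<zeta> \<in> sphere 0 1 \<Longrightarrow> Re (poly F \<zeta>0) \<le> Re (poly F \<zeta>)"
    using continuous_attains_inf[OF compact_sphere ne] by blast
  have "Re (poly F \<zeta>0) \<le> Re (poly F z)"
  proof -
    have "(\<lambda>z. - poly F z) holomorphic_on ball 0 1" by (intro holomorphic_intros)
    moreover have "continuous_on (cball 0 1) (\<lambda>z. - poly F z)" by (intro continuous_intros)
    ultimately show ?thesis
      using maximum_real_frontier[of "\<lambda>z. - poly F z" "cball 0 1" "- Re (poly F \<zeta>0)" z] z z0 by auto
  qed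
  then show ?thesis using assms(1)[of \<zeta>0] z0(1) by simp
qed

lemma Re_poly_measurable [measurable]: "(\<lambda>\<zeta>. Re (poly F \<zeta>)) \<in> borel_measurable (borel :: complex measure)"
  by (intro borel_measurable_continuous_onI continuous_intros)

lemma integrable_Re_poly_powr:
  assumes "p > 0"
  shows "integrable \<mu> (\<lambda>\<zeta>. \<bar>Re (poly F \<zeta>)\<bar> powr p)"
  by (rule continuous_imp_integrable_circle) (use assms in \<open>auto intro!: continuous_intros continuous_on_powr'\<close>)

lemma riesz_positive:
  fixes p :: real
  assumes p: "1 < p" "p \<le> 2"
  shows "\<exists>A\<ge>0. \<forall>F. (\<forall>\<zeta>. cmod \<zeta> = 1 \<longrightarrow> Re (poly F \<zeta>) > 0) \<longrightarrow> Im (poly F 0) = 0 \<longrightarrow>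
    pmass p (poly F) \<le> A * (\<integral>\<zeta>. \<bar>Re (poly F \<zeta>)\<bar> powr p \<partial>\<mu>)"
proof -
  obtain A B where AB: "A \<ge> 0" "B \<ge> 0"
      "\<And>w. Re w > 0 \<Longrightarrow> cmod w powr p \<le> A * Re w powr p - B * Re (w powr (of_real p))"
    using norm_powr_le_Re[OF p] by blast
  show ?thesis
  proof (intro exI[of _ A] conjI allI impI AB(1))
    fix F :: "complex poly" assume "\<forall>\<zeta>. cmod \<zeta> = 1 \<longrightarrow> Re (poly F \<zeta>) > 0" and F0: "Im (poly F 0) = 0"
    then have pos: "Re (poly F z) > 0" if "cmod z \<le> 1" for z using poly_Re_pos_disc that by blast
    define G where "G z = poly F z powr (of_real p)" for z
    have nonneg: "poly F z \<notin> \<real>\<^sub>\<le>\<^sub>0" if "cmod z \<le> 1" for z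
      using pos[OF that] by (auto simp: complex_nonpos_Reals_iff)
    have holG: "G holomorphic_on ball 0 1" unfolding G_def
      by (intro holomorphic_intros) (use nonneg in auto)
    have contG: "continuous_on (cball 0 1) G" unfolding G_def
    proof (rule continuous_on_powr_complex)
      show "cball 0 1 \<subseteq> {z. 0 \<le> Re (poly F z) \<or> Im (poly F z) \<noteq> 0}"
        using pos by (auto intro: less_imp_le)
      show "0 < Re (complex_of_real p)" if "z \<in> cball 0 1" "poly F z = 0" for z
        using p by simp
    qed (intro continuous_intros)+
    then have "compact (G ` cball 0 1)" by (rule compact_continuous_image) simp
    then obtain C where "\<And>x. x \<in> G ` cball 0 1 \<Longrightarrow> norm x \<le> C" using compact_imp_bounded bounded_iff by metis
    then have C: "cmod (G z) \<le> C" if "cmod z \<le> 1" for z using that by auto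
    define g where "g \<zeta> = indicator (cball 0 1) \<zeta> *\<^sub>R G \<zeta>" for \<zeta>
    have [measurable]: "g \<in> borel_measurable borel" unfolding g_def[abs_def]
      using contG by (intro borel_measurable_continuous_on_indicator) auto
    have gb: "AE \<zeta> in \<mu>. cmod (g \<zeta>) \<le> C" by (rule AE_circleI) (use C in \<open>auto simp: g_def\<close>)
    have lim: "AE \<zeta> in \<mu>. ((\<lambda>r. G (of_real r * \<zeta>)) \<longlongrightarrow> g \<zeta>) (at_left 1)"
    proof (rule AE_circleI)
      fix \<zeta> :: complex assume \<zeta>: "cmod \<zeta> = 1"
      have "continuous_on {0..1} (\<lambda>r. G (of_real r * \<zeta>))"
        by (intro continuous_on_compose2[OF contG] continuous_intros) (auto simp: norm_mult \<zeta>)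
      then have "((\<lambda>r. G (of_real r * \<zeta>)) \<longlongrightarrow> G \<zeta>) (at 1 within {0..1})"
        unfolding continuous_on_def by (metis atLeastAtMost_iff mult_1 of_real_1 order_refl zero_le_one)
      moreover have "at_left (1::real) = at 1 within {0..1}"
        by (metis at_within_Icc_at_left zero_less_one)
      ultimately show "((\<lambda>r. G (of_real r * \<zeta>)) \<longlongrightarrow> g \<zeta>) (at_left 1)" using \<zeta> by (simp add: g_def)
    qed
    have "(\<integral>\<zeta>. g \<zeta> * \<zeta> ^ 0 \<partial>\<mu>) = G 0"
      using radial_limit_integral(1)[OF holG _ _ lim, of C 0] C by auto
    moreover have "Re (G 0) \<ge> 0"
    proof -
      have "poly F 0 = of_real (Re (poly F 0))" using F0 by (simp add: complex_eq_iff)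
      then have "G 0 = of_real (Re (poly F 0) powr p)" using pos[of 0] unfolding G_def
        by (metis less_eq_real_def norm_zero powr_of_real zero_le_one)
      then show ?thesis by simp
    qed
    ultimately have Re0: "(\<integral>\<zeta>. Re (g \<zeta>) \<partial>\<mu>) \<ge> 0"
      using gb by (subst integral_Re) (auto intro: circle.integrable_const_bound[where B = C])
    have intg: "integrable \<mu> g" using gb by (intro circle.integrable_const_bound[where B = C]) auto
    have "pmass p (poly F) \<le> (\<integral>\<zeta>. A * \<bar>Re (poly F \<zeta>)\<bar> powr p - B * Re (g \<zeta>) \<partial>\<mu>)"
      unfolding pmass_def
    proof (rule integral_mono_AE)
      show "integrable \<mu> (\<lambda>\<zeta>. cmod (poly F \<zeta>) powr p)" using pint_poly[of p F] p by (simp add: pint_def)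
      show "integrable \<mu> (\<lambda>\<zeta>. A * \<bar>Re (poly F \<zeta>)\<bar> powr p - B * Re (g \<zeta>))"
        using intg integrable_Re_poly_powr[of p F] p by auto
      show "AE \<zeta> in \<mu>. cmod (poly F \<zeta>) powr p \<le> A * \<bar>Re (poly F \<zeta>)\<bar> powr p - B * Re (g \<zeta>)"
      proof (rule AE_circleI)
        fix \<zeta> :: complex assume \<zeta>: "cmod \<zeta> = 1"
        show "cmod (poly F \<zeta>) powr p \<le> A * \<bar>Re (poly F \<zeta>)\<bar> powr p - B * Re (g \<zeta>)"
          using AB(3)[OF pos[of \<zeta>]] pos[of \<zeta>] \<zeta> by (simp add: g_def G_def)
      qed
    qed
    also have "\<dots> = A * (\<integral>\<zeta>. \<bar>Re (poly F \<zeta>)\<bar> powr p \<partial>\<mu>) - B * (\<integral>\<zeta>. Re (g \<zeta>) \<partial>\<mu>)"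
      using intg integrable_Re_poly_powr[of p F] p by simp
    also have "\<dots> \<le> A * (\<integral>\<zeta>. \<bar>Re (poly F \<zeta>)\<bar> powr p \<partial>\<mu>)" using Re0 AB by simp
    finally show "pmass p (poly F) \<le> A * (\<integral>\<zeta>. \<bar>Re (poly F \<zeta>)\<bar> powr p \<partial>\<mu>)" .
  qed
qed

lemma powr_minus2_mult_square: "x > 0 \<Longrightarrow> x powr (p - 2) * x^2 = x powr p" for x p :: real
proof -
  assume x: "x > 0"
  have "x powr (p - 2) * x powr 2 = x powr p" by (subst powr_add[symmetric]) simp
  then show ?thesis using x by simp
qed

text \<open>Up to \<open>\<epsilon>\<close>, the positive and negative parts of \<open>Re H\<close> are real parts of polynomials with positive real part; the
  remaining polynomial is small in \<open>L\<^sup>2\<close> by the mean value property of its square.\<close>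

lemma riesz_real_part:
  fixes p :: real
  assumes p: "1 < p" "p \<le> 2"
  shows "\<exists>K\<ge>0. \<forall>H. Im (poly H 0) = 0 \<longrightarrow> pmass p (poly H) \<le> K * (\<integral>\<zeta>. \<bar>Re (poly H \<zeta>)\<bar> powr p \<partial>\<mu>)"
proof -
  obtain A where A: "A \<ge> 0" and posF: "\<And>F. (\<And>\<zeta>. cmod \<zeta> = 1 \<Longrightarrow> Re (poly F \<zeta>) > 0) \<Longrightarrow> Im (poly F 0) = 0 \<Longrightarrow>
    pmass p (poly F) \<le> A * (\<integral>\<zeta>. \<bar>Re (poly F \<zeta>)\<bar> powr p \<partial>\<mu>)"
    using riesz_positive[OF p] by metis
  define c where "c = 2 powr p"
  have c0: "c > 0" by (simp add: c_def)
  define K1 where "K1 = c * (c * (2 * (A * c)))"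
  define K2 where "K2 = c * (c * (2 * (A * (c * 3 powr p))) + 9)"
  have K: "K1 \<ge> 0" "K2 \<ge> 0" using A c0 by (auto simp: K1_def K2_def)
  have main: "pmass p (poly H) \<le> K1 * (\<integral>\<zeta>. \<bar>Re (poly H \<zeta>)\<bar> powr p \<partial>\<mu>)" if H0: "Im (poly H 0) = 0" for H
  proof (rule field_le_epsilon)
    fix \<delta> :: real assume \<delta>: "\<delta> > 0"
    define U where "U = (\<integral>\<zeta>. \<bar>Re (poly H \<zeta>)\<bar> powr p \<partial>\<mu>)"
    \<comment> \<open>Makes the accumulated error \<open>K2\<close> times \<epsilon>^p at most
      \<delta>; adding 1 to \<open>K2\<close> avoids division by 0.\<close>
    define \<epsilon> where "\<epsilon> = (\<delta> / (K2 + 1)) powr (1/p)"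
    have \<epsilon>: "\<epsilon> > 0" "K2 * \<epsilon> powr p \<le> \<delta>"
      using \<delta> K p by (auto simp: \<epsilon>_def powr_powr field_simps)
    \<comment> \<open>The shift by 2 \<epsilon> keeps the real part of an \<epsilon>-approximation
      strictly positive, and at most 3 \<epsilon> above the positive part of s Re H.\<close>
    have approx: "\<exists>F. Im (poly F 0) = 0 \<and> (\<forall>\<zeta>. cmod \<zeta> = 1 \<longrightarrow> \<bar>(max (s * Re (poly H \<zeta>)) 0 + 2 * \<epsilon>) - Re (poly F \<zeta>)\<bar> < \<epsilon>)" for s
      by (intro real_continuous_approx_Re_poly continuous_intros \<epsilon>)
    obtain F1 where F1: "Im (poly F1 0) = 0" "\<And>\<zeta>. cmod \<zeta> = 1 \<Longrightarrow> \<bar>(max (Re (poly H \<zeta>)) 0 + 2 * \<epsilon>) - Re (poly F1 \<zeta>)\<bar> < \<epsilon>"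
      using approx[of 1] by auto
    obtain F2 where F2: "Im (poly F2 0) = 0" "\<And>\<zeta>. cmod \<zeta> = 1 \<Longrightarrow> \<bar>(max (- Re (poly H \<zeta>)) 0 + 2 * \<epsilon>) - Re (poly F2 \<zeta>)\<bar> < \<epsilon>"
      using approx[of "-1"] by auto
    have bound: "pmass p (poly F) \<le> A * (c * (U + 3 powr p * \<epsilon> powr p))"
      if F: "Im (poly F 0) = 0" "\<And>\<zeta>. cmod \<zeta> = 1 \<Longrightarrow> 0 < Re (poly F \<zeta>) \<and> Re (poly F \<zeta>) \<le> \<bar>Re (poly H \<zeta>)\<bar> + 3 * \<epsilon>" for F
    proof -
      have "pmass p (poly F) \<le> A * (\<integral>\<zeta>. \<bar>Re (poly F \<zeta>)\<bar> powr p \<partial>\<mu>)"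
        by (rule posF) (use F in auto)
      also have "(\<integral>\<zeta>. \<bar>Re (poly F \<zeta>)\<bar> powr p \<partial>\<mu>) \<le> (\<integral>\<zeta>. c * (\<bar>Re (poly H \<zeta>)\<bar> powr p + 3 powr p * \<epsilon> powr p) \<partial>\<mu>)"
      proof (rule integral_mono_AE)
        show "AE \<zeta> in \<mu>. \<bar>Re (poly F \<zeta>)\<bar> powr p \<le> c * (\<bar>Re (poly H \<zeta>)\<bar> powr p + 3 powr p * \<epsilon> powr p)"
        proof (rule AE_circleI)
          fix \<zeta> :: complex assume "cmod \<zeta> = 1"
          then have "\<bar>Re (poly F \<zeta>)\<bar> powr p \<le> (\<bar>Re (poly H \<zeta>)\<bar> + 3 * \<epsilon>) powr p"
            using F(2)[of \<zeta>] p by (intro powr_mono2) auto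
          also have "\<dots> \<le> c * (\<bar>Re (poly H \<zeta>)\<bar> powr p + (3 * \<epsilon>) powr p)"
            unfolding c_def using \<epsilon> p by (intro powr_add_le) auto
          finally show "\<bar>Re (poly F \<zeta>)\<bar> powr p \<le> c * (\<bar>Re (poly H \<zeta>)\<bar> powr p + 3 powr p * \<epsilon> powr p)"
            using \<epsilon> by (simp add: powr_mult)
        qed
      qed (use p integrable_Re_poly_powr[of p] in auto)
      also have "\<dots> = c * (U + 3 powr p * \<epsilon> powr p)"
        using integrable_Re_poly_powr[of p H] p by (simp add: U_def)
      finally show ?thesis using A by (simp add: mult_left_mono)
    qed
    have b1: "pmass p (poly F1) \<le> A * (c * (U + 3 powr p * \<epsilon> powr p))"
    proof (rule bound[OF F1(1)])
      fix \<zeta> :: complex assume "cmod \<zeta> = 1"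
      from F1(2)[OF this] show "0 < Re (poly F1 \<zeta>) \<and> Re (poly F1 \<zeta>) \<le> \<bar>Re (poly H \<zeta>)\<bar> + 3 * \<epsilon>"
        using \<epsilon>(1) by (auto simp: max_def abs_if split: if_splits)
    qed
    have b2: "pmass p (poly F2) \<le> A * (c * (U + 3 powr p * \<epsilon> powr p))"
    proof (rule bound[OF F2(1)])
      fix \<zeta> :: complex assume "cmod \<zeta> = 1"
      from F2(2)[OF this] show "0 < Re (poly F2 \<zeta>) \<and> Re (poly F2 \<zeta>) \<le> \<bar>Re (poly H \<zeta>)\<bar> + 3 * \<epsilon>"
        using \<epsilon>(1) by (auto simp: max_def abs_if split: if_splits)
    qed
    define E where "E = H - F1 + F2"
    have ReE: "\<bar>Re (poly E \<zeta>)\<bar> \<le> 2 * \<epsilon>" if "cmod \<zeta> = 1" for \<zeta>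
      using F1(2)[OF that] F2(2)[OF that] by (auto simp: E_def max_def abs_if split: if_splits)
    have E0: "Im (poly E 0) = 0" using H0 F1 F2 by (simp add: E_def)
    have intE: "integrable \<mu> (\<lambda>\<zeta>. (Re (poly E \<zeta>))^2)" "integrable \<mu> (\<lambda>\<zeta>. (Im (poly E \<zeta>))^2)"
        "integrable \<mu> (\<lambda>\<zeta>. (cmod (poly E \<zeta>))^2)"
      by (intro continuous_imp_integrable_circle continuous_intros)+
    \<comment> \<open>E(0) is real, so the mean of Re (E^2) = (Re E)^2 - (Im E)^2 is nonnegative,
      and in L^2 the imaginary part is dominated by the real part.\<close>
    have "0 \<le> Re ((poly E 0)^2)" using E0 by (simp add: power2_eq_square)
    also have "\<dots> = Re (\<integral>\<zeta>. poly (E * E) \<zeta> \<partial>\<mu>)"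
      unfolding integral_poly_circle by (simp add: power2_eq_square)
    also have "\<dots> = (\<integral>\<zeta>. (Re (poly E \<zeta>))^2 - (Im (poly E \<zeta>))^2 \<partial>\<mu>)"
      by (subst integral_Re[symmetric]) (auto simp: power2_eq_square)
    finally have "(\<integral>\<zeta>. (Im (poly E \<zeta>))^2 \<partial>\<mu>) \<le> (\<integral>\<zeta>. (Re (poly E \<zeta>))^2 \<partial>\<mu>)"
      using intE by simp
    moreover have "(\<integral>\<zeta>. (Re (poly E \<zeta>))^2 \<partial>\<mu>) \<le> (\<integral>\<zeta>. (2*\<epsilon>)^2 \<partial>\<mu>)"
    proof (intro integral_mono_AE intE AE_circleI)
      fix \<zeta> :: complex assume "cmod \<zeta> = 1"
      then show "(Re (poly E \<zeta>))^2 \<le> (2*\<epsilon>)^2"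
        using power_mono[OF ReE, of \<zeta> 2] by simp
    qed simp
    moreover have "(\<integral>\<zeta>. (cmod (poly E \<zeta>))^2 \<partial>\<mu>) = (\<integral>\<zeta>. (Re (poly E \<zeta>))^2 \<partial>\<mu>) + (\<integral>\<zeta>. (Im (poly E \<zeta>))^2 \<partial>\<mu>)"
      unfolding cmod_power2 by (rule Bochner_Integration.integral_add[OF intE(1,2)])
    ultimately have E2: "(\<integral>\<zeta>. (cmod (poly E \<zeta>))^2 \<partial>\<mu>) \<le> 8 * \<epsilon>^2"
      by (simp add: power_mult_distrib)
    \<comment> \<open>Where |E| > \<epsilon>, the exponent p - 2 <= 0 gives |E|^(p-2) <=
      \<epsilon>^(p-2); this turns the L^2 bound into an L^p bound of the right order
      \<epsilon>^p.\<close>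
    have Epw: "cmod (poly E \<zeta>) powr p \<le> \<epsilon> powr p + \<epsilon> powr (p - 2) * (cmod (poly E \<zeta>))^2" for \<zeta>
    proof (cases "cmod (poly E \<zeta>) \<le> \<epsilon>")
      case True
      then have "cmod (poly E \<zeta>) powr p \<le> \<epsilon> powr p" using p by (intro powr_mono2) auto
      moreover have "0 \<le> \<epsilon> powr (p - 2) * (cmod (poly E \<zeta>))^2" by simp
      ultimately show ?thesis by linarith
    next
      case False
      define x where "x = cmod (poly E \<zeta>)"
      have x: "x > \<epsilon>" "x > 0" using False \<epsilon> by (auto simp: x_def)
      have "x powr p = x powr (p - 2) * x^2"
        using x by (simp add: powr_minus2_mult_square)
      also have "\<dots> \<le> \<epsilon> powr (p - 2) * x^2"
        using x p \<epsilon> by (intro mult_right_mono powr_mono2') auto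
      also have "\<dots> \<le> \<epsilon> powr p + \<epsilon> powr (p - 2) * x^2" by simp
      finally show ?thesis by (simp add: x_def)
    qed
    have "pmass p (poly E) \<le> (\<integral>\<zeta>. \<epsilon> powr p + \<epsilon> powr (p - 2) * (cmod (poly E \<zeta>))^2 \<partial>\<mu>)"
      unfolding pmass_def using pint_poly[of p E] p intE
      by (intro integral_mono Epw) (auto simp: pint_def)
    also have "\<dots> \<le> \<epsilon> powr p + \<epsilon> powr (p - 2) * (8 * \<epsilon>^2)"
      using intE E2 by (simp add: mult_left_mono)
    also have "\<dots> = 9 * \<epsilon> powr p"
      using powr_minus2_mult_square[OF \<epsilon>(1), of p] by simp
    finally have b3: "pmass p (poly E) \<le> 9 * \<epsilon> powr p" .
    have p0: "p \<ge> 0" using p by simp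
    have "pmass p (poly H) = pmass p (\<lambda>\<zeta>. (poly F1 \<zeta> - poly F2 \<zeta>) + poly E \<zeta>)"
      by (simp add: E_def)
    also have "\<dots> \<le> c * (pmass p (\<lambda>\<zeta>. poly F1 \<zeta> - poly F2 \<zeta>) + pmass p (poly E))"
      unfolding c_def by (intro pint_add pint_diff pint_poly p0)
    also have "\<dots> \<le> c * (c * (pmass p (poly F1) + pmass p (poly F2)) + pmass p (poly E))"
      using c0 unfolding c_def by (intro mult_left_mono add_right_mono pint_diff pint_poly p0) auto
    also have "\<dots> \<le> c * (c * (A * (c * (U + 3 powr p * \<epsilon> powr p)) + A * (c * (U + 3 powr p * \<epsilon> powr p))) + 9 * \<epsilon> powr p)"
      using c0 by (intro mult_left_mono add_mono b1 b2 b3) auto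
    also have "\<dots> = K1 * U + K2 * \<epsilon> powr p" by (simp add: K1_def K2_def algebra_simps)
    also have "\<dots> \<le> K1 * U + \<delta>" using \<epsilon> by simp
    finally show "pmass p (poly H) \<le> K1 * (\<integral>\<zeta>. \<bar>Re (poly H \<zeta>)\<bar> powr p \<partial>\<mu>) + \<delta>" by (simp add: U_def)
  qed
  with K(1) show ?thesis by blast
qed

section \<open>The analytic part of a trigonometric polynomial\<close>

lemma integral_cnj_poly: "(\<integral>\<zeta>. cnj (poly Q \<zeta>) \<partial>\<mu>) = cnj (poly Q 0)"
  by (simp add: integral_poly_circle)

lemma cnj_poly_integrable [simp]: "integrable \<mu> (\<lambda>\<zeta>. cnj (poly Q \<zeta>))"
  by simp

text \<open>With f = Q + conj R and a = Q(0), the polynomials Q + R and -i (Q - R) have real parts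
  Re f and Im f. Corrected by imaginary constants they become \<open>H1\<close> and
  \<open>H2\<close>, both controlled by f, and Q = (\<open>H1\<close> + i \<open>H2\<close> + a) /
  2, where a is the mean of f.\<close>

lemma riesz_trig_le2:
  fixes p :: real
  assumes p: "1 < p" "p \<le> 2"
  shows "\<exists>C\<ge>0. \<forall>Q R. poly R 0 = 0 \<longrightarrow> pmass p (poly Q) \<le> C * pmass p (\<lambda>\<zeta>. poly Q \<zeta> + cnj (poly R \<zeta>))"
proof -
  obtain K where K: "K \<ge> 0" "\<And>H. Im (poly H 0) = 0 \<Longrightarrow> pmass p (poly H) \<le> K * (\<integral>\<zeta>. \<bar>Re (poly H \<zeta>)\<bar> powr p \<partial>\<mu>)"
    using riesz_real_part[OF p] by blast
  have p0: "p \<ge> 0" using p by simp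
  define c where "c = 2 powr p"
  have c0: "c > 0" by (simp add: c_def)
  have main: "pmass p (poly Q) \<le> (c * (2 * K) + 1) * pmass p (\<lambda>\<zeta>. poly Q \<zeta> + cnj (poly R \<zeta>))" if R0: "poly R 0 = 0" for Q R
  proof -
    define f where "f \<zeta> = poly Q \<zeta> + cnj (poly R \<zeta>)" for \<zeta>
    have fp: "pint p f" unfolding f_def[abs_def] using p0 by (rule pint_trig)
    define a where "a = poly Q 0"
    define H1 where "H1 = Q + R - [:\<i> * of_real (Im a):]"
    define H2 where "H2 = smult (-\<i>) (Q - R) + [:\<i> * of_real (Re a):]"
    have bnd: "pmass p (poly H) \<le> K * pmass p f" if H: "Im (poly H 0) = 0" "\<And>\<zeta>. \<bar>Re (poly H \<zeta>)\<bar> \<le> cmod (f \<zeta>)" for H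
    proof -
      have "(\<integral>\<zeta>. \<bar>Re (poly H \<zeta>)\<bar> powr p \<partial>\<mu>) \<le> pmass p f"
        unfolding pmass_def using fp p integrable_Re_poly_powr[of p H]
        by (intro integral_mono powr_mono2 H) (auto simp: pint_def)
      then show ?thesis using K(2)[OF H(1)] K(1) mult_left_mono order_trans by blast
    qed
    have h1: "pmass p (poly H1) \<le> K * pmass p f"
    proof (rule bnd)
      show "Im (poly H1 0) = 0" using R0 by (simp add: H1_def a_def)
      fix \<zeta> show "\<bar>Re (poly H1 \<zeta>)\<bar> \<le> cmod (f \<zeta>)"
        using abs_Re_le_cmod[of "f \<zeta>"] by (simp add: H1_def f_def)
    qed
    have h2: "pmass p (poly H2) \<le> K * pmass p f"
    proof (rule bnd)
      show "Im (poly H2 0) = 0" using R0 by (simp add: H2_def a_def)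
      fix \<zeta> show "\<bar>Re (poly H2 \<zeta>)\<bar> \<le> cmod (f \<zeta>)"
        using abs_Im_le_cmod[of "f \<zeta>"] by (simp add: H2_def f_def)
    qed
    have "a = (\<integral>\<zeta>. f \<zeta> \<partial>\<mu>)"
      unfolding f_def using R0 by (subst Bochner_Integration.integral_add) (auto simp: integral_poly_circle a_def)
    then have "cmod a \<le> pmass 1 f"
      using integral_norm_bound[of \<mu> f] by (simp add: pmass_def)
    also have "\<dots> \<le> pmass p f powr (1/p)" using pint_mono_exponent(2)[OF fp, of 1] p by simp
    finally have "cmod a powr p \<le> (pmass p f powr (1/p)) powr p" using p by (intro powr_mono2) auto
    then have ha: "cmod a powr p \<le> pmass p f" using p by (simp add: powr_powr)
    have "poly Q = (\<lambda>\<zeta>. (1/2) * ((poly H1 \<zeta> + \<i> * poly H2 \<zeta>) + a))"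
      by (rule ext) (simp add: H1_def H2_def algebra_simps complex_eq_iff)
    then have "pmass p (poly Q) = pmass p (\<lambda>\<zeta>. (1/2) * ((poly H1 \<zeta> + \<i> * poly H2 \<zeta>) + a))" by simp
    also have "\<dots> = (1/2) powr p * pmass p (\<lambda>\<zeta>. (poly H1 \<zeta> + \<i> * poly H2 \<zeta>) + a)"
      by (subst pint_cmult) (auto intro!: pint_continuous continuous_intros p0 simp: norm_divide)
    also have "\<dots> \<le> (1/2) powr p * (2 powr p * (pmass p (\<lambda>\<zeta>. poly H1 \<zeta> + \<i> * poly H2 \<zeta>) + pmass p (\<lambda>_. a)))"
      by (intro mult_left_mono pint_add p0 pint_continuous continuous_intros) auto
    also have "\<dots> = pmass p (\<lambda>\<zeta>. poly H1 \<zeta> + \<i> * poly H2 \<zeta>) + cmod a powr p"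
      by (simp add: pmass_def powr_divide)
    also have "pmass p (\<lambda>\<zeta>. poly H1 \<zeta> + \<i> * poly H2 \<zeta>) \<le> c * (pmass p (poly H1) + pmass p (\<lambda>\<zeta>. \<i> * poly H2 \<zeta>))"
      unfolding c_def by (intro pint_add p0 pint_continuous continuous_intros)
    also have "pmass p (\<lambda>\<zeta>. \<i> * poly H2 \<zeta>) = pmass p (poly H2)" by (simp add: pmass_def norm_mult)
    also have "c * (pmass p (poly H1) + pmass p (poly H2)) + cmod a powr p \<le> c * (K * pmass p f + K * pmass p f) + pmass p f"
      using c0 h1 h2 ha by (intro add_mono mult_left_mono) auto
    also have "\<dots> = (c * (2 * K) + 1) * pmass p f" by (simp add: algebra_simps)
    finally show ?thesis by (simp add: f_def[abs_def])
  qed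
  have "c * (2 * K) + 1 \<ge> 0" using c0 K by (simp add: add_nonneg_nonneg)
  with main show ?thesis by blast
qed

text \<open>Duality with the conjugate exponent q < 2: the L^p norm of Q is tested against G = Q
  |Q|^(p-2), and the inequality in L^q is applied to the analytic part of a uniform trigonometric
  approximation g of G.\<close>

lemma riesz_trig_ge2:
  fixes p :: real
  assumes p: "2 < p"
  shows "\<exists>C\<ge>0. \<forall>Q R. poly R 0 = 0 \<longrightarrow> pmass p (poly Q) \<le> C * pmass p (\<lambda>\<zeta>. poly Q \<zeta> + cnj (poly R \<zeta>))"
proof -
  define q where "q = p / (p - 1)"
  have q: "1 < q" "q \<le> 2" using p by (auto simp: q_def field_simps)
  have pq: "1/p + 1/q = 1" "(p - 1) * q = p" using p by (auto simp: q_def field_simps)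
  have pq0: "p \<ge> 0" "q \<ge> 0" "p > 1" using p q by auto
  obtain K where K: "K \<ge> 0" "\<And>Q R. poly R 0 = 0 \<Longrightarrow> pmass q (poly Q) \<le> K * pmass q (\<lambda>\<zeta>. poly Q \<zeta> + cnj (poly R \<zeta>))"
    using riesz_trig_le2[OF q] by blast
  define D where "D = K * 2 powr q"
  have D: "D \<ge> 0" using K by (simp add: D_def)
  have main: "pmass p (poly Q) \<le> (D powr (1/q)) powr p * pmass p (\<lambda>\<zeta>. poly Q \<zeta> + cnj (poly R \<zeta>))" if R0: "poly R 0 = 0" for Q R
  proof -
    define f where "f \<zeta> = poly Q \<zeta> + cnj (poly R \<zeta>)" for \<zeta>
    have fp: "pint p f" unfolding f_def[abs_def] using pq0(1) by (rule pint_trig)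
    \<comment> \<open>The extremal function for Hoelder: Q conj G = |Q|^p = |G|^q.\<close>
    define G where "G \<zeta> = poly Q \<zeta> * of_real (cmod (poly Q \<zeta>) powr (p - 2))" for \<zeta>
    have contG: "continuous_on UNIV G" unfolding G_def
      using p by (intro continuous_intros continuous_on_powr') auto
    have Gq: "pint q G" by (rule pint_continuous[OF contG pq0(2)])
    define X where "X = pmass p (poly Q)"
    define N where "N = pmass p f powr (1/p)"
    define M where "M = (\<integral>\<zeta>. cmod (poly Q \<zeta>) \<partial>\<mu>)"
    have normG: "cmod (G \<zeta>) = cmod (poly Q \<zeta>) powr (p - 1)" for \<zeta>
    proof (cases "poly Q \<zeta> = 0")
      case False
      then have "cmod (G \<zeta>) = cmod (poly Q \<zeta>) powr 1 * cmod (poly Q \<zeta>) powr (p - 2)" by (simp add: G_def norm_mult)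
      also have "\<dots> = cmod (poly Q \<zeta>) powr (p - 1)" by (subst powr_add[symmetric]) simp
      finally show ?thesis .
    qed (use p in \<open>simp add: G_def\<close>)
    have XG: "pmass q G = X" using pq by (simp add: pmass_def normG powr_powr X_def)
    have QG: "poly Q \<zeta> * cnj (G \<zeta>) = of_real (cmod (poly Q \<zeta>) powr p)" for \<zeta>
    proof (cases "poly Q \<zeta> = 0")
      case False
      have "poly Q \<zeta> * cnj (G \<zeta>) = (poly Q \<zeta> * cnj (poly Q \<zeta>)) * of_real (cmod (poly Q \<zeta>) powr (p - 2))"
        by (simp add: G_def)
      also have "\<dots> = of_real (cmod (poly Q \<zeta>) powr (p - 2) * (cmod (poly Q \<zeta>))^2)"
        by (simp only: complex_norm_square[symmetric] of_real_mult of_real_power mult.commute)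
      also have "\<dots> = of_real (cmod (poly Q \<zeta>) powr p)"
        using False by (simp add: powr_minus2_mult_square)
      finally show ?thesis .
    qed (use p in simp)
    have est: "X \<le> N * (D * (X + \<epsilon> powr q)) powr (1/q) + \<epsilon> * M" if \<epsilon>: "\<epsilon> > 0" for \<epsilon>
    proof -
      obtain Q' R' where QR': "poly R' 0 = 0" "\<And>\<zeta>. cmod \<zeta> = 1 \<Longrightarrow> cmod (G \<zeta> - (poly Q' \<zeta> + cnj (poly R' \<zeta>))) < \<epsilon>"
        using continuous_approx_trig[OF continuous_on_subset[OF contG] \<epsilon>] by blast
      define g where "g \<zeta> = poly Q' \<zeta> + cnj (poly R' \<zeta>)" for \<zeta>
      have gq: "pint q g" unfolding g_def[abs_def] using pq0(2) by (rule pint_trig)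
      have contg: "continuous_on UNIV g" unfolding g_def[abs_def] by (intro continuous_intros)
      have int1: "integrable \<mu> (\<lambda>\<zeta>. poly Q \<zeta> * cnj (g \<zeta>))" "integrable \<mu> (\<lambda>\<zeta>. poly Q \<zeta> * cnj (G \<zeta> - g \<zeta>))"
        by (intro continuous_imp_integrable_circle continuous_intros contg contG)+
      have int2: "integrable \<mu> (\<lambda>\<zeta>. poly Q \<zeta> * cnj (poly Q' \<zeta>))" by (intro continuous_imp_integrable_circle continuous_intros)
      \<comment> \<open>Self-adjointness of taking analytic parts: Q R' and conj (R Q') have mean 0
        because R' and R vanish at 0, so g may be replaced by Q' and then Q by f.\<close>
      have "(\<integral>\<zeta>. poly Q \<zeta> * cnj (g \<zeta>) \<partial>\<mu>) = (\<integral>\<zeta>. poly Q \<zeta> * cnj (poly Q' \<zeta>) + poly (Q * R') \<zeta> \<partial>\<mu>)"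
        by (simp add: g_def algebra_simps)
      also have "\<dots> = (\<integral>\<zeta>. poly Q \<zeta> * cnj (poly Q' \<zeta>) \<partial>\<mu>)"
        using int2 QR'(1) by (subst Bochner_Integration.integral_add) (auto simp: integral_poly_circle)
      also have "\<dots> = (\<integral>\<zeta>. poly Q \<zeta> * cnj (poly Q' \<zeta>) \<partial>\<mu>) + (\<integral>\<zeta>. cnj (poly (R * Q') \<zeta>) \<partial>\<mu>)"
        unfolding integral_cnj_poly using R0 by simp
      also have "\<dots> = (\<integral>\<zeta>. poly Q \<zeta> * cnj (poly Q' \<zeta>) + cnj (poly (R * Q') \<zeta>) \<partial>\<mu>)"
        by (rule Bochner_Integration.integral_add[OF int2 cnj_poly_integrable, symmetric])
      also have "\<dots> = (\<integral>\<zeta>. f \<zeta> * cnj (poly Q' \<zeta>) \<partial>\<mu>)"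
        by (simp add: f_def algebra_simps)
      finally have eq: "(\<integral>\<zeta>. poly Q \<zeta> * cnj (g \<zeta>) \<partial>\<mu>) = (\<integral>\<zeta>. f \<zeta> * cnj (poly Q' \<zeta>) \<partial>\<mu>)" .
      have "pmass q (poly Q') \<le> K * pmass q g" using K(2)[OF QR'(1)] by (simp add: g_def[abs_def])
      moreover have "pmass q g \<le> 2 powr q * (X + \<epsilon> powr q)"
      proof -
        have "pmass q g = pmass q (\<lambda>\<zeta>. G \<zeta> + (g \<zeta> - G \<zeta>))" by simp
        also have "\<dots> \<le> 2 powr q * (pmass q G + pmass q (\<lambda>\<zeta>. g \<zeta> - G \<zeta>))"
          by (intro pint_add pint_diff Gq gq pq0)
        also have "pmass q (\<lambda>\<zeta>. g \<zeta> - G \<zeta>) \<le> \<epsilon> powr q"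
        proof (rule pmass_bounded)
          show "AE \<zeta> in \<mu>. cmod (g \<zeta> - G \<zeta>) \<le> \<epsilon>"
            by (rule AE_circleI) (use QR'(2) in \<open>auto simp: g_def norm_minus_commute less_imp_le\<close>)
        qed (use Gq gq pq0 in auto)
        finally show ?thesis by (simp add: XG)
      qed
      ultimately have Q'b: "pmass q (poly Q') \<le> D * (X + \<epsilon> powr q)"
        unfolding D_def mult.assoc using mult_left_mono[OF _ K(1)] order_trans by blast
      have "cmod (\<integral>\<zeta>. f \<zeta> * cnj (poly Q' \<zeta>) \<partial>\<mu>) \<le> N * pmass q (\<lambda>\<zeta>. cnj (poly Q' \<zeta>)) powr (1/q)"
        unfolding N_def using pq q pq0 by (intro pint_Holder pint_cnj fp pint_poly) auto
      also have "pmass q (\<lambda>\<zeta>. cnj (poly Q' \<zeta>)) = pmass q (poly Q')" by (simp add: pmass_def)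
      also have "N * pmass q (poly Q') powr (1/q) \<le> N * (D * (X + \<epsilon> powr q)) powr (1/q)"
        using Q'b pq0 by (intro mult_left_mono powr_mono2) (auto simp: N_def)
      finally have 1: "cmod (\<integral>\<zeta>. poly Q \<zeta> * cnj (g \<zeta>) \<partial>\<mu>) \<le> N * (D * (X + \<epsilon> powr q)) powr (1/q)"
        by (simp add: eq)
      have "cmod (\<integral>\<zeta>. poly Q \<zeta> * cnj (G \<zeta> - g \<zeta>) \<partial>\<mu>) \<le> (\<integral>\<zeta>. cmod (poly Q \<zeta> * cnj (G \<zeta> - g \<zeta>)) \<partial>\<mu>)"
        by (rule integral_norm_bound)
      also have "\<dots> \<le> (\<integral>\<zeta>. \<epsilon> * cmod (poly Q \<zeta>) \<partial>\<mu>)"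
      proof (rule integral_mono_AE)
        show "AE \<zeta> in \<mu>. cmod (poly Q \<zeta> * cnj (G \<zeta> - g \<zeta>)) \<le> \<epsilon> * cmod (poly Q \<zeta>)"
        proof (rule AE_circleI)
          fix \<zeta> :: complex assume "cmod \<zeta> = 1"
          then have "cmod (G \<zeta> - g \<zeta>) \<le> \<epsilon>" using QR'(2)[of \<zeta>] by (simp add: g_def)
          then show "cmod (poly Q \<zeta> * cnj (G \<zeta> - g \<zeta>)) \<le> \<epsilon> * cmod (poly Q \<zeta>)"
            unfolding norm_mult complex_mod_cnj by (metis mult.commute mult_left_mono norm_ge_zero)
        qed
      qed (use int1 integrable_norm in auto)
      finally have 2: "cmod (\<integral>\<zeta>. poly Q \<zeta> * cnj (G \<zeta> - g \<zeta>) \<partial>\<mu>) \<le> \<epsilon> * M" by (simp add: M_def)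
      have "of_real X = (\<integral>\<zeta>. poly Q \<zeta> * cnj (G \<zeta>) \<partial>\<mu>)" by (simp add: QG X_def pmass_def)
      also have "\<dots> = (\<integral>\<zeta>. poly Q \<zeta> * cnj (g \<zeta>) + poly Q \<zeta> * cnj (G \<zeta> - g \<zeta>) \<partial>\<mu>)" by (simp add: algebra_simps)
      also have "\<dots> = (\<integral>\<zeta>. poly Q \<zeta> * cnj (g \<zeta>) \<partial>\<mu>) + (\<integral>\<zeta>. poly Q \<zeta> * cnj (G \<zeta> - g \<zeta>) \<partial>\<mu>)"
        by (rule Bochner_Integration.integral_add[OF int1])
      finally have "cmod (complex_of_real X) \<le> cmod (\<integral>\<zeta>. poly Q \<zeta> * cnj (g \<zeta>) \<partial>\<mu>) + cmod (\<integral>\<zeta>. poly Q \<zeta> * cnj (G \<zeta> - g \<zeta>) \<partial>\<mu>)"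
        by (simp only: norm_triangle_ineq)
      moreover have "cmod (complex_of_real X) = X" by (simp add: X_def)
      ultimately show ?thesis using 1 2 by linarith
    qed
    \<comment> \<open>Letting \<epsilon> tend to 0 gives X <= N D^(1/q) X^(1/q), and division by
      X^(1/q) leaves X^(1/p) on the left.\<close>
    have "((\<lambda>\<epsilon>. N * (D * (X + \<epsilon> powr q)) powr (1/q) + \<epsilon> * M) \<longlongrightarrow> N * (D * (X + 0 powr q)) powr (1/q) + 0 * M) (at_right 0)"
      using q by (intro tendsto_intros tendsto_powr'[where b = "1/q"] tendsto_powr'[where b = q]) (auto simp: eventually_at_filter D X_def)
    then have "X \<le> N * (D * (X + 0 powr q)) powr (1/q) + 0 * M"
      by (rule tendsto_lowerbound) (auto simp: eventually_at_filter intro!: est always_eventually)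
    then have X1: "X \<le> N * (D powr (1/q) * X powr (1/q))" using D q by (simp add: powr_mult X_def)
    have X0: "X \<ge> 0" by (simp add: X_def)
    have "X \<le> (D powr (1/q)) powr p * pmass p f"
    proof (cases "X = 0")
      case False
      with X0 have Xp: "X > 0" by simp
      have "X powr (1/p) * X powr (1/q) = X" using Xp pq by (simp add: powr_add[symmetric])
      then have "X powr (1/p) * X powr (1/q) \<le> (N * D powr (1/q)) * X powr (1/q)" using X1 by (simp add: mult_ac)
      then have "X powr (1/p) \<le> N * D powr (1/q)" using Xp by simp
      then have "(X powr (1/p)) powr p \<le> (N * D powr (1/q)) powr p" using p by (intro powr_mono2) auto
      then show ?thesis using p Xp by (simp add: powr_powr powr_mult N_def mult.commute)
    qed simp
    then show ?thesis by (simp add: X_def f_def[abs_def])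
  qed
  have "(D powr (1/q)) powr p \<ge> 0" by simp
  with main show ?thesis by blast
qed

lemma riesz_trig:
  fixes p :: real
  assumes p: "1 < p"
  shows "\<exists>C\<ge>0. \<forall>Q R. poly R 0 = 0 \<longrightarrow> pmass p (poly Q) \<le> C * pmass p (\<lambda>\<zeta>. poly Q \<zeta> + cnj (poly R \<zeta>))"
  using riesz_trig_le2[of p] riesz_trig_ge2[of p] p by (cases "p \<le> 2") auto

section \<open>Completeness and uniqueness of Fourier coefficients\<close>

lemma geometric_Cauchy_limit:
  fixes g :: "nat \<Rightarrow> 'a::banach"
  assumes "\<And>n. norm (g (Suc n) - g n) \<le> c * (1/2)^n"
  shows "g \<longlonglongrightarrow> lim g" "norm (lim g - g n) \<le> 2 * c * (1/2)^n"
proof -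
  have sm: "summable (\<lambda>n. a * (1/2::real)^n)" for a by (intro summable_mult summable_geometric) simp
  have su: "summable (\<lambda>n. g (Suc n) - g n)"
    by (rule summable_comparison_test'[OF sm, of 0]) (use assms in auto)
  have g: "g n = g 0 + (\<Sum>k<n. g (Suc k) - g k)" for n by (simp add: sum_lessThan_telescope)
  have "(\<lambda>n. g 0 + (\<Sum>k<n. g (Suc k) - g k)) \<longlonglongrightarrow> g 0 + (\<Sum>k. g (Suc k) - g k)"
    by (intro tendsto_intros summable_LIMSEQ su)
  moreover have "(\<lambda>n. g 0 + (\<Sum>k<n. g (Suc k) - g k)) = g" by (rule ext) (rule g[symmetric])
  ultimately have l: "g \<longlonglongrightarrow> g 0 + (\<Sum>k. g (Suc k) - g k)" by metis
  then have liml: "lim g = g 0 + (\<Sum>k. g (Suc k) - g k)" by (rule limI)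
  then show "g \<longlonglongrightarrow> lim g" using l by simp
  note liml
  also have "(\<Sum>k. g (Suc k) - g k) = (\<Sum>k. g (Suc (k + n)) - g (k + n)) + (\<Sum>k<n. g (Suc k) - g k)"
    using suminf_split_initial_segment[OF su, of n] by simp
  finally have "lim g - g n = (\<Sum>k. g (Suc (k + n)) - g (k + n))" using g[of n] by simp
  also have "norm \<dots> \<le> (\<Sum>k. (c * (1/2)^n) * (1/2)^k)"
  proof (rule norm_suminf_le[OF _ sm])
    fix k show "norm (g (Suc (k + n)) - g (k + n)) \<le> (c * (1/2)^n) * (1/2)^k"
      using assms[of "k + n"] by (simp add: power_add mult_ac)
  qed
  also have "\<dots> = (c * (1/2)^n) * 2" by (subst suminf_mult) (auto simp: suminf_geometric summable_geometric)
  finally show "norm (lim g - g n) \<le> 2 * c * (1/2)^n" by (simp add: mult_ac)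
qed

text \<open>By monotone convergence the sum has finite integral, hence is finite almost
  everywhere.\<close>

lemma AE_summable_of_integrals:
  fixes f :: "nat \<Rightarrow> 'a \<Rightarrow> real"
  assumes int: "\<And>n. integrable M (f n)" and nonneg: "\<And>n x. f n x \<ge> 0"
    and sm: "summable (\<lambda>n. \<integral>x. f n x \<partial>M)"
  shows "AE x in M. summable (\<lambda>n. f n x)"
proof -
  have [measurable]: "f n \<in> borel_measurable M" for n using int by auto
  have "(\<integral>\<^sup>+x. (\<Sum>n. ennreal (f n x)) \<partial>M) = (\<Sum>n. \<integral>\<^sup>+x. ennreal (f n x) \<partial>M)"
    by (rule nn_integral_suminf) auto
  also have "\<dots> = (\<Sum>n. ennreal (\<integral>x. f n x \<partial>M))"
    using int nonneg by (simp add: nn_integral_eq_integral)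
  also have "\<dots> \<noteq> \<infinity>"
    unfolding infinity_ennreal_def by (rule ennreal_suminf_neq_top[OF sm]) (simp add: nonneg)
  finally have "AE x in M. (\<Sum>n. ennreal (f n x)) \<noteq> \<infinity>" by (intro nn_integral_PInf_AE) auto
  then show ?thesis by eventually_elim (use nonneg in \<open>auto intro: summable_suminf_not_top\<close>)
qed

lemma powr_neg_summable:
  fixes p :: real assumes p: "p > 0"
  shows "summable (\<lambda>n. 2 powr (- (p * real n)))" "(\<lambda>n. 2 powr (- (p * real n))) \<longlonglongrightarrow> 0"
proof -
  have eq: "2 powr (- (p * real n)) = (2 powr (-p)) ^ n" for n
    by (simp add: powr_realpow[of "2 powr (-p)" n, symmetric] powr_powr)
  have "2 powr (-p) < 1" using p by (simp add: powr_minus field_simps gr_one_powr)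
  then show 1: "summable (\<lambda>n. 2 powr (- (p * real n)))" unfolding eq by (intro summable_geometric) simp
  show "(\<lambda>n. 2 powr (- (p * real n))) \<longlonglongrightarrow> 0" by (rule summable_LIMSEQ_zero[OF 1])
qed

text \<open>The weight 2^(p n) in \<open>w\<close> still leaves integrals of at most 2^(-p n), so
  the sum \<open>D\<close> is integrable, and almost everywhere each increment is at most D^(1/p)
  2^(-n). This is a geometric Cauchy condition, and \<open>D\<close> also dominates the p-th powers
  of the tails.\<close>

lemma Lp_complete:
  fixes p :: real
  assumes p: "p > 0" and g: "\<And>n. pint p (g n)"
    and d: "\<And>n. pmass p (\<lambda>\<zeta>. g (Suc n) \<zeta> - g n \<zeta>) \<le> 4 powr (- (p * real n))"
  shows "\<exists>h. pint p h \<and> (\<lambda>n. pmass p (\<lambda>\<zeta>. h \<zeta> - g n \<zeta>)) \<longlonglongrightarrow> 0"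
proof -
  have [measurable]: "g n \<in> borel_measurable borel" for n using g by (rule pint_measurable)
  have p0: "p \<ge> 0" using p by simp
  define w where "w n \<zeta> = 2 powr (p * real n) * cmod (g (Suc n) \<zeta> - g n \<zeta>) powr p" for n \<zeta>
  have [measurable]: "w n \<in> borel_measurable borel" for n unfolding w_def by measurable
  have wi: "integrable \<mu> (w n)" for n
    using pint_diff(1)[OF g g p0] unfolding w_def by (simp add: pint_def)
  have w0: "w n \<zeta> \<ge> 0" for n \<zeta> by (simp add: w_def)
  have wint: "(\<integral>\<zeta>. w n \<zeta> \<partial>\<mu>) \<le> 2 powr (- (p * real n))" for n
  proof -
    have "(\<integral>\<zeta>. w n \<zeta> \<partial>\<mu>) = 2 powr (p * real n) * pmass p (\<lambda>\<zeta>. g (Suc n) \<zeta> - g n \<zeta>)"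
      by (simp add: w_def pmass_def)
    also have "\<dots> \<le> 2 powr (p * real n) * 4 powr (- (p * real n))" using d by (intro mult_left_mono) auto
    also have "(4::real) powr (- (p * real n)) = 2 powr (- (2 * (p * real n)))"
      using powr_powr[of 2 2 "- (p * real n)"] by simp
    also have "2 powr (p * real n) * 2 powr (- (2 * (p * real n))) = 2 powr (- (p * real n))"
      by (subst powr_add[symmetric]) simp
    finally show ?thesis .
  qed
  have sm: "summable (\<lambda>n. \<integral>\<zeta>. w n \<zeta> \<partial>\<mu>)"
    by (rule summable_comparison_test'[OF powr_neg_summable(1)[OF p], of 0])
       (use wint w0 in \<open>auto simp: integral_nonneg_AE\<close>)
  have AEs: "AE \<zeta> in \<mu>. summable (\<lambda>n. w n \<zeta>)" by (rule AE_summable_of_integrals[OF wi w0 sm])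
  define D where "D \<zeta> = (\<Sum>n. w n \<zeta>)" for \<zeta>
  have Dint: "integrable \<mu> D" unfolding D_def
    by (rule integrable_suminf[OF wi]) (use AEs sm w0 in auto)
  define h where "h \<zeta> = lim (\<lambda>n. g n \<zeta>)" for \<zeta>
  have [measurable]: "h \<in> borel_measurable borel" unfolding h_def by measurable
  have bound: "AE \<zeta> in \<mu>. \<forall>n. cmod (h \<zeta> - g n \<zeta>) powr p \<le> 2 powr p * 2 powr (- (p * real n)) * D \<zeta>"
    using AEs
  proof eventually_elim
    case (elim \<zeta>)
    have wD: "w n \<zeta> \<le> D \<zeta>" for n unfolding D_def using sum_le_suminf[OF elim, of "{n}"] w0 by simp
    have D0: "D \<zeta> \<ge> 0" using wD[of 0] w0[of 0 \<zeta>] by linarith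
    have st: "cmod (g (Suc n) \<zeta> - g n \<zeta>) \<le> (D \<zeta>) powr (1/p) * (1/2)^n" for n
    proof -
      have "(w n \<zeta>) powr (1/p) \<le> (D \<zeta>) powr (1/p)" using wD w0 p by (intro powr_mono2) auto
      moreover have "(w n \<zeta>) powr (1/p) = 2^n * cmod (g (Suc n) \<zeta> - g n \<zeta>)"
        using p by (simp add: w_def powr_mult powr_powr powr_realpow)
      ultimately show ?thesis by (simp add: field_simps)
    qed
    show ?case
    proof
      fix n
      have "cmod (h \<zeta> - g n \<zeta>) \<le> 2 * (D \<zeta>) powr (1/p) * (1/2)^n"
        unfolding h_def by (rule geometric_Cauchy_limit(2)[OF st])
      then have "cmod (h \<zeta> - g n \<zeta>) powr p \<le> (2 * (D \<zeta>) powr (1/p) * (1/2)^n) powr p"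
        using p by (intro powr_mono2) auto
      also have "\<dots> = 2 powr p * D \<zeta> * ((1/2)^n) powr p" using p D0 by (simp add: powr_mult powr_powr)
      also have "(1/2::real)^n = 2 powr (- real n)"
        by (simp add: powr_minus powr_realpow power_one_over inverse_eq_divide)
      also have "(2 powr (- real n)) powr p = 2 powr (- (p * real n))"
        by (simp add: powr_powr mult.commute)
      finally show "cmod (h \<zeta> - g n \<zeta>) powr p \<le> 2 powr p * 2 powr (- (p * real n)) * D \<zeta>" by (simp add: mult_ac)
    qed
  qed
  have hg: "pint p (\<lambda>\<zeta>. h \<zeta> - g n \<zeta>)" for n
    unfolding pint_def
  proof (intro conjI)
    show "integrable \<mu> (\<lambda>\<zeta>. cmod (h \<zeta> - g n \<zeta>) powr p)"
      by (rule Bochner_Integration.integrable_bound[of _ "\<lambda>\<zeta>. 2 powr p * 2 powr (- (p * real n)) * D \<zeta>"])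
         (use bound Dint in \<open>auto elim!: eventually_mono intro: order_trans[OF _ abs_ge_self]\<close>)
  qed measurable
  have "pint p (\<lambda>\<zeta>. (h \<zeta> - g 0 \<zeta>) + g 0 \<zeta>)" using hg g p0 by (rule pint_add)
  then have hp: "pint p h" by simp
  have le: "pmass p (\<lambda>\<zeta>. h \<zeta> - g n \<zeta>) \<le> 2 powr (- (p * real n)) * (2 powr p * (\<integral>\<zeta>. D \<zeta> \<partial>\<mu>))" for n
  proof -
    have "pmass p (\<lambda>\<zeta>. h \<zeta> - g n \<zeta>) \<le> (\<integral>\<zeta>. 2 powr p * 2 powr (- (p * real n)) * D \<zeta> \<partial>\<mu>)"
      unfolding pmass_def by (intro integral_mono_AE) (use bound Dint hg[of n] in \<open>auto simp: pint_def elim!: eventually_mono\<close>)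
    then show ?thesis by (simp add: mult_ac)
  qed
  have "(\<lambda>n. pmass p (\<lambda>\<zeta>. h \<zeta> - g n \<zeta>)) \<longlonglongrightarrow> 0"
  proof (rule tendsto_sandwich[OF _ _ tendsto_const])
    show "(\<lambda>n. 2 powr (- (p * real n)) * (2 powr p * (\<integral>\<zeta>. D \<zeta> \<partial>\<mu>))) \<longlonglongrightarrow> 0"
      by (rule tendsto_mult_left_zero[OF powr_neg_summable(2)[OF p]])
  qed (use le in auto)
  with hp show ?thesis by blast
qed

text \<open>Trigonometric approximations of f are chosen to converge so fast that the Riesz
  inequality, applied to their differences, makes the analytic parts Q n a fast Cauchy sequence. The
  sequences Q and R are returned because the Fourier coefficients of the limit are read off from
  them.\<close>

lemma riesz_exists:
  fixes p :: real
  assumes p: "p > 1"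
  shows "\<exists>C\<ge>0. \<forall>f. pint p f \<longrightarrow> (\<exists>g Q R. (\<forall>n. poly (R n) 0 = 0) \<and> pint p g \<and> pmass p g \<le> C * pmass p f \<and>
     (\<lambda>n. pmass p (\<lambda>\<zeta>. f \<zeta> - (poly (Q n) \<zeta> + cnj (poly (R n) \<zeta>)))) \<longlonglongrightarrow> 0 \<and>
     (\<lambda>n. pmass p (\<lambda>\<zeta>. g \<zeta> - poly (Q n) \<zeta>)) \<longlonglongrightarrow> 0)"
proof -
  obtain K where K: "K \<ge> 0" "\<And>Q R. poly R 0 = 0 \<Longrightarrow> pmass p (poly Q) \<le> K * pmass p (\<lambda>\<zeta>. poly Q \<zeta> + cnj (poly R \<zeta>))"
    using riesz_trig[OF p] by blast
  have p0: "p \<ge> 0" "p > 0" using p by auto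
  define c where "c = 2 powr p"
  have c: "c > 0" by (simp add: c_def)
  have main: "\<exists>g Q R. (\<forall>n. poly (R n) 0 = 0) \<and> pint p g \<and> pmass p g \<le> (c * K * c) * pmass p f \<and>
     (\<lambda>n. pmass p (\<lambda>\<zeta>. f \<zeta> - (poly (Q n) \<zeta> + cnj (poly (R n) \<zeta>)))) \<longlonglongrightarrow> 0 \<and>
     (\<lambda>n. pmass p (\<lambda>\<zeta>. g \<zeta> - poly (Q n) \<zeta>)) \<longlonglongrightarrow> 0" if f: "pint p f" for f
  proof -
    \<comment> \<open>The difference of consecutive analytic parts costs at most K c (2 \<delta> n),
      which must not exceed the 4^(-p n) asked for by \<open>Lp_complete\<close>; K + 1 avoids a
      zero denominator.\<close>
    define \<delta> where "\<delta> n = 4 powr (- (p * real n)) / (2 * c * (K + 1))" for n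
    have \<delta>: "\<delta> n > 0" for n using c K by (simp add: \<delta>_def)
    have "\<exists>Q R. poly R 0 = 0 \<and> pmass p (\<lambda>\<zeta>. f \<zeta> - (poly Q \<zeta> + cnj (poly R \<zeta>))) < \<delta> n" for n
      using trig_dense_Lp[OF f p0(2) \<delta>] by metis
    then obtain Q R where QR: "\<And>n. poly (R n) 0 = 0" "\<And>n. pmass p (\<lambda>\<zeta>. f \<zeta> - (poly (Q n) \<zeta> + cnj (poly (R n) \<zeta>))) < \<delta> n"
      by metis
    define t where "t n \<zeta> = poly (Q n) \<zeta> + cnj (poly (R n) \<zeta>)" for n \<zeta>
    have tp: "pint p (t n)" for n unfolding t_def[abs_def] using p0(1) by (rule pint_trig)
    have ft: "pmass p (\<lambda>\<zeta>. f \<zeta> - t n \<zeta>) < \<delta> n" for n using QR(2) by (simp add: t_def)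
    have "\<delta> (Suc n) \<le> \<delta> n" for n
      unfolding \<delta>_def using c K p by (intro divide_right_mono powr_mono) (auto simp: algebra_simps)
    have dQ: "pmass p (\<lambda>\<zeta>. poly (Q (Suc n)) \<zeta> - poly (Q n) \<zeta>) \<le> 4 powr (- (p * real n))" for n
    proof -
      have "pmass p (poly (Q (Suc n) - Q n)) \<le> K * pmass p (\<lambda>\<zeta>. poly (Q (Suc n) - Q n) \<zeta> + cnj (poly (R (Suc n) - R n) \<zeta>))"
        by (rule K(2)) (simp add: QR)
      also have "(\<lambda>\<zeta>. poly (Q (Suc n) - Q n) \<zeta> + cnj (poly (R (Suc n) - R n) \<zeta>)) = (\<lambda>\<zeta>. (f \<zeta> - t n \<zeta>) - (f \<zeta> - t (Suc n) \<zeta>))"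
        by (simp add: t_def algebra_simps)
      also have "pmass p \<dots> \<le> c * (pmass p (\<lambda>\<zeta>. f \<zeta> - t n \<zeta>) + pmass p (\<lambda>\<zeta>. f \<zeta> - t (Suc n) \<zeta>))"
        unfolding c_def by (intro pint_diff f tp p0)
      also have "\<dots> \<le> c * (\<delta> n + \<delta> n)"
        using ft[of n] ft[of "Suc n"] \<open>\<delta> (Suc n) \<le> \<delta> n\<close> c by (intro mult_left_mono) auto
      also have "K * (c * (\<delta> n + \<delta> n)) \<le> (K + 1) * (c * (\<delta> n + \<delta> n))"
        using c \<delta>[of n] by (intro mult_right_mono) auto
      also have "\<dots> = 4 powr (- (p * real n))"
      proof -
        have "k * (c * (x / (2 * c * k) + x / (2 * c * k))) = x" if "k > 0" for k x
          using c that by (simp add: field_simps)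
        then show ?thesis using K by (simp add: \<delta>_def)
      qed
      finally show ?thesis using K by (simp add: mult_left_mono)
    qed
    obtain g where g: "pint p g" "(\<lambda>n. pmass p (\<lambda>\<zeta>. g \<zeta> - poly (Q n) \<zeta>)) \<longlonglongrightarrow> 0"
      using Lp_complete[OF p0(2), of "\<lambda>n. poly (Q n)"] dQ pint_poly[OF p0(1)] by blast
    have \<delta>0: "\<delta> \<longlonglongrightarrow> 0"
    proof -
      have "(4::real) powr (- (p * real n)) = 2 powr (- ((2 * p) * real n))" for n
        using powr_powr[of 2 2 "- (p * real n)"] by (simp add: mult.assoc)
      then have "(\<lambda>n. (4::real) powr (- (p * real n))) \<longlonglongrightarrow> 0"
        using powr_neg_summable(2)[of "2 * p"] p0 by simp
      then show ?thesis unfolding \<delta>_def by (rule tendsto_divide_zero)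
    qed
    have lim1: "(\<lambda>n. pmass p (\<lambda>\<zeta>. f \<zeta> - t n \<zeta>)) \<longlonglongrightarrow> 0"
      by (rule tendsto_sandwich[OF _ _ tendsto_const \<delta>0]) (use ft in \<open>auto simp: less_imp_le\<close>)
    have est: "pmass p g \<le> c * (pmass p (\<lambda>\<zeta>. g \<zeta> - poly (Q n) \<zeta>) + K * (c * (pmass p (\<lambda>\<zeta>. f \<zeta> - t n \<zeta>) + pmass p f)))" for n
    proof -
      have "pmass p g = pmass p (\<lambda>\<zeta>. (g \<zeta> - poly (Q n) \<zeta>) + poly (Q n) \<zeta>)" by simp
      also have "\<dots> \<le> c * (pmass p (\<lambda>\<zeta>. g \<zeta> - poly (Q n) \<zeta>) + pmass p (poly (Q n)))"
        unfolding c_def by (intro pint_add pint_diff g pint_poly p0)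
      also have "pmass p (poly (Q n)) \<le> K * pmass p (t n)"
        unfolding t_def by (rule K(2)[OF QR(1)])
      also have "pmass p (t n) = pmass p (\<lambda>\<zeta>. f \<zeta> - (f \<zeta> - t n \<zeta>))" by simp
      also have "\<dots> \<le> c * (pmass p f + pmass p (\<lambda>\<zeta>. f \<zeta> - t n \<zeta>))"
        unfolding c_def by (intro pint_diff f tp p0)
      finally show ?thesis using c K by (simp add: mult_left_mono add.commute)
    qed
    have "(\<lambda>n. c * (pmass p (\<lambda>\<zeta>. g \<zeta> - poly (Q n) \<zeta>) + K * (c * (pmass p (\<lambda>\<zeta>. f \<zeta> - t n \<zeta>) + pmass p f)))) \<longlonglongrightarrow>
       c * (0 + K * (c * (0 + pmass p f)))"
      by (intro tendsto_intros g lim1)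
    then have "pmass p g \<le> c * (0 + K * (c * (0 + pmass p f)))"
      by (rule LIMSEQ_le_const) (use est in auto)
    then have "pmass p g \<le> (c * K * c) * pmass p f" by (simp add: mult_ac)
    with g lim1 QR(1) show ?thesis unfolding t_def by blast
  qed
  have "c * K * c \<ge> 0" using c K by simp
  with main show ?thesis by blast
qed

lemma Lp_tendsto_integral:
  assumes pq: "p > 1" "q > 1" "1/p + 1/q = 1" and f: "pint p f" "\<And>n. pint p (F n)" and g: "pint q g"
    and lim: "(\<lambda>n. pmass p (\<lambda>\<zeta>. f \<zeta> - F n \<zeta>)) \<longlonglongrightarrow> 0"
  shows "(\<lambda>n. \<integral>\<zeta>. F n \<zeta> * g \<zeta> \<partial>\<mu>) \<longlonglongrightarrow> (\<integral>\<zeta>. f \<zeta> * g \<zeta> \<partial>\<mu>)"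
proof (rule LIM_zero_cancel, rule tendsto_norm_zero_cancel)
  have le: "cmod ((\<integral>\<zeta>. F n \<zeta> * g \<zeta> \<partial>\<mu>) - (\<integral>\<zeta>. f \<zeta> * g \<zeta> \<partial>\<mu>)) \<le>
     pmass p (\<lambda>\<zeta>. f \<zeta> - F n \<zeta>) powr (1/p) * pmass q g powr (1/q)" for n
  proof -
    have "(\<integral>\<zeta>. F n \<zeta> * g \<zeta> \<partial>\<mu>) - (\<integral>\<zeta>. f \<zeta> * g \<zeta> \<partial>\<mu>) = - (\<integral>\<zeta>. (f \<zeta> - F n \<zeta>) * g \<zeta> \<partial>\<mu>)"
      using pint_Holder(1)[OF pq f(1) g] pint_Holder(1)[OF pq f(2) g] by (simp add: left_diff_distrib)
    then show ?thesis
      using pint_Holder(3)[OF pq pint_diff(1)[OF f(1) f(2)] g, of n] pq by (simp add: norm_minus_commute)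
  qed
  have "(\<lambda>n. pmass p (\<lambda>\<zeta>. f \<zeta> - F n \<zeta>) powr (1/p) * pmass q g powr (1/q)) \<longlonglongrightarrow> 0 powr (1/p) * pmass q g powr (1/q)"
    using pq by (intro tendsto_intros tendsto_powr' lim) auto
  then have "(\<lambda>n. pmass p (\<lambda>\<zeta>. f \<zeta> - F n \<zeta>) powr (1/p) * pmass q g powr (1/q)) \<longlonglongrightarrow> 0" by simp
  then show "(\<lambda>n. cmod ((\<integral>\<zeta>. F n \<zeta> * g \<zeta> \<partial>\<mu>) - (\<integral>\<zeta>. f \<zeta> * g \<zeta> \<partial>\<mu>))) \<longlonglongrightarrow> 0"
    by (rule tendsto_sandwich[OF _ _ tendsto_const, rotated 2]) (use le in auto)
qed

text \<open>Vanishing coefficients mean that f annihilates all trigonometric polynomials, and these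
  approximate the bounded function s = conj (sgn f) in L^q. Since s f = |f|, the limit says that the
  integral of |f| is 0.\<close>

lemma fourier_unique_AE:
  assumes p: "p > 1" and f: "pint p f"
    and z: "\<And>n. (\<integral>\<zeta>. f \<zeta> * \<zeta> ^ n \<partial>\<mu>) = 0" "\<And>n. (\<integral>\<zeta>. f \<zeta> * cnj \<zeta> ^ n \<partial>\<mu>) = 0"
  shows "AE \<zeta> in \<mu>. f \<zeta> = 0"
proof -
  define q where "q = p / (p - 1)"
  have q: "1 < q" and pq: "1/q + 1/p = 1" using p by (auto simp: q_def field_simps)
  have [measurable]: "f \<in> borel_measurable borel" using f by (rule pint_measurable)
  have f1: "pint 1 f" using pint_mono_exponent(1)[OF f, of 1] p by simp
  then have fint: "integrable \<mu> f" unfolding pint_def by (subst integrable_norm_iff[symmetric]) auto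
  have fb: "integrable \<mu> (\<lambda>\<zeta>. c * (f \<zeta> * h \<zeta>))" if h: "continuous_on UNIV h" for h c
  proof -
    have "pint q h" using q by (intro pint_continuous h) auto
    then have "integrable \<mu> (\<lambda>\<zeta>. f \<zeta> * h \<zeta>)" using pint_Holder(1)[OF p q _ f] pq by (simp add: add.commute)
    then show ?thesis by simp
  qed
  have zQ: "(\<integral>\<zeta>. f \<zeta> * poly Q \<zeta> \<partial>\<mu>) = 0" for Q
  proof -
    have "(\<integral>\<zeta>. f \<zeta> * poly Q \<zeta> \<partial>\<mu>) = (\<integral>\<zeta>. (\<Sum>i\<le>degree Q. coeff Q i * (f \<zeta> * \<zeta> ^ i)) \<partial>\<mu>)"
      by (simp add: poly_altdef sum_distrib_left mult_ac)
    also have "\<dots> = (\<Sum>i\<le>degree Q. (\<integral>\<zeta>. coeff Q i * (f \<zeta> * \<zeta> ^ i) \<partial>\<mu>))"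
      by (intro Bochner_Integration.integral_sum fb continuous_intros)
    finally show ?thesis by (simp add: z)
  qed
  have zR: "(\<integral>\<zeta>. f \<zeta> * cnj (poly Q \<zeta>) \<partial>\<mu>) = 0" for Q
  proof -
    have "(\<integral>\<zeta>. f \<zeta> * cnj (poly Q \<zeta>) \<partial>\<mu>) = (\<integral>\<zeta>. (\<Sum>i\<le>degree Q. cnj (coeff Q i) * (f \<zeta> * cnj \<zeta> ^ i)) \<partial>\<mu>)"
      by (simp add: poly_altdef sum_distrib_left mult_ac)
    also have "\<dots> = (\<Sum>i\<le>degree Q. (\<integral>\<zeta>. cnj (coeff Q i) * (f \<zeta> * cnj \<zeta> ^ i) \<partial>\<mu>))"
      by (intro Bochner_Integration.integral_sum fb continuous_intros)
    finally show ?thesis by (simp add: z)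
  qed
  define s where "s \<zeta> = cnj (sgn (f \<zeta>))" for \<zeta>
  have [measurable]: "s \<in> borel_measurable borel" unfolding s_def sgn_div_norm by measurable
  have sq: "pint q s"
    by (rule pint_bounded[where B = 1]) (use q in \<open>auto simp: s_def norm_sgn\<close>)
  have "\<exists>Q R. poly R 0 = 0 \<and> pmass q (\<lambda>\<zeta>. s \<zeta> - (poly Q \<zeta> + cnj (poly R \<zeta>))) < 1 / real (Suc n)" for n
    by (rule trig_dense_Lp[OF sq, of "1 / real (Suc n)"]) (use q in auto)
  then obtain Q R where QR: "\<And>n. pmass q (\<lambda>\<zeta>. s \<zeta> - (poly (Q n) \<zeta> + cnj (poly (R n) \<zeta>))) < 1 / real (Suc n)"
    by metis
  have "(\<lambda>n. \<integral>\<zeta>. (poly (Q n) \<zeta> + cnj (poly (R n) \<zeta>)) * f \<zeta> \<partial>\<mu>) \<longlonglongrightarrow> (\<integral>\<zeta>. s \<zeta> * f \<zeta> \<partial>\<mu>)"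
  proof (rule Lp_tendsto_integral[OF q p pq sq _ f])
    show "(\<lambda>n. pmass q (\<lambda>\<zeta>. s \<zeta> - (poly (Q n) \<zeta> + cnj (poly (R n) \<zeta>)))) \<longlonglongrightarrow> 0"
      by (rule tendsto_sandwich[OF _ _ tendsto_const LIMSEQ_Suc[OF lim_1_over_n]])
         (use QR in \<open>auto simp: less_imp_le\<close>)
  qed (use q in \<open>auto intro: pint_trig\<close>)
  moreover have "(\<integral>\<zeta>. (poly (Q n) \<zeta> + cnj (poly (R n) \<zeta>)) * f \<zeta> \<partial>\<mu>) = 0" for n
  proof -
    have i: "integrable \<mu> (\<lambda>\<zeta>. f \<zeta> * poly (Q n) \<zeta>)" "integrable \<mu> (\<lambda>\<zeta>. f \<zeta> * cnj (poly (R n) \<zeta>))"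
      using fb[of "poly (Q n)" 1, OF continuous_on_poly[OF continuous_on_id]]
        fb[of "\<lambda>\<zeta>. cnj (poly (R n) \<zeta>)" 1, OF continuous_on_cnj[OF continuous_on_poly[OF continuous_on_id]]]
      by simp_all
    have "(\<integral>\<zeta>. (poly (Q n) \<zeta> + cnj (poly (R n) \<zeta>)) * f \<zeta> \<partial>\<mu>) = (\<integral>\<zeta>. f \<zeta> * poly (Q n) \<zeta> + f \<zeta> * cnj (poly (R n) \<zeta>) \<partial>\<mu>)"
      by (simp add: algebra_simps)
    then show ?thesis by (simp add: Bochner_Integration.integral_add[OF i] zQ zR)
  qed
  ultimately have "(\<integral>\<zeta>. s \<zeta> * f \<zeta> \<partial>\<mu>) = 0" by (simp add: LIMSEQ_const_iff)
  moreover have "s \<zeta> * f \<zeta> = of_real (cmod (f \<zeta>))" for \<zeta>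
  proof -
    have "s \<zeta> * f \<zeta> = f \<zeta> * cnj (f \<zeta>) / of_real (cmod (f \<zeta>))" by (simp add: s_def sgn_eq)
    also have "\<dots> = of_real ((cmod (f \<zeta>))^2 / cmod (f \<zeta>))"
      by (simp only: complex_norm_square[symmetric] of_real_power of_real_divide)
    finally show ?thesis by (simp add: power2_eq_square)
  qed
  ultimately have "(\<integral>\<zeta>. cmod (f \<zeta>) \<partial>\<mu>) = 0" by simp
  then have "AE \<zeta> in \<mu>. cmod (f \<zeta>) = 0"
    using integral_nonneg_eq_0_iff_AE[of \<mu> "\<lambda>\<zeta>. cmod (f \<zeta>)"] fint by auto
  then show ?thesis by eventually_elim simp
qed

section \<open>Function classes on the circle\<close>

lemma circle_eq_refl_iff [simp]: "circle_eq f f \<longleftrightarrow> f \<in> borel_measurable borel"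
  by (simp add: circle_eq_def)

lemma circle_fun_obtain:
  obtains f where "f \<in> borel_measurable borel" "F = abs_circle_fun f"
  using Quotient3_abs_rep[OF Quotient3_circle_fun, of F] Quotient3_rep_reflp[OF Quotient3_circle_fun, of F]
  by (metis circle_eq_refl_iff)

lemma abs_circle_fun_eq_iff:
  assumes "f \<in> borel_measurable borel" "g \<in> borel_measurable borel"
  shows "abs_circle_fun f = abs_circle_fun g \<longleftrightarrow> (AE \<zeta> in \<mu>. f \<zeta> = g \<zeta>)"
  using Quotient3_rel[OF Quotient3_circle_fun, of f g] assms by (simp add: circle_eq_def)

section \<open>Operations on classes, computed on Borel representatives\<close>

context
  fixes f g :: "complex \<Rightarrow> complex"
  assumes f: "f \<in> borel_measurable borel" and g: "g \<in> borel_measurable borel"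
begin
lemma abs_circle_plus: "abs_circle_fun f + abs_circle_fun g = abs_circle_fun (\<lambda>\<zeta>. f \<zeta> + g \<zeta>)"
  using f g by (simp add: plus_circle_fun.abs_eq)
lemma abs_circle_minus: "abs_circle_fun f - abs_circle_fun g = abs_circle_fun (\<lambda>\<zeta>. f \<zeta> - g \<zeta>)"
  using f g by (simp add: minus_circle_fun.abs_eq)
lemma abs_circle_times: "abs_circle_fun f * abs_circle_fun g = abs_circle_fun (\<lambda>\<zeta>. f \<zeta> * g \<zeta>)"
  using f g by (simp add: times_circle_fun.abs_eq)
end

context
  fixes f :: "complex \<Rightarrow> complex"
  assumes f: "f \<in> borel_measurable borel"
begin
lemma abs_circle_cnj: "circle_cnj (abs_circle_fun f) = abs_circle_fun (\<lambda>\<zeta>. cnj (f \<zeta>))"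
  using f by (simp add: circle_cnj.abs_eq)
lemma abs_circle_power_integrable: "power_integrable p (abs_circle_fun f) \<longleftrightarrow> pint p f"
  using f by (simp add: power_integrable.abs_eq pint_def)
lemma abs_circle_lp_norm: "lp_norm p (abs_circle_fun f) = pmass p f powr (1/p)"
  using f by (simp add: lp_norm.abs_eq pmass_def)
lemma abs_circle_fourier: "fourier_coeff (abs_circle_fun f) n = (\<integral>\<zeta>. f \<zeta> * cnj \<zeta> powi n \<partial>\<mu>)"
  using f by (simp add: fourier_coeff.abs_eq)
lemma abs_circle_unimodular: "unimodular (abs_circle_fun f) \<longleftrightarrow> (AE \<zeta> in \<mu>. cmod (f \<zeta>) = 1)"
  using f by (simp add: unimodular.abs_eq)
lemma abs_circle_radial: "has_radial_limits F (abs_circle_fun f) \<longleftrightarrow>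
    (AE \<zeta> in \<mu>. ((\<lambda>r. F (complex_of_real r * \<zeta>)) \<longlongrightarrow> f \<zeta>) (at_left 1))"
  using f by (simp add: has_radial_limits.abs_eq)
end

lemma circle_const_abs: "circle_const c = abs_circle_fun (\<lambda>_. c)"
  by (simp add: circle_const.abs_eq)

lemma circle_zero_abs: "0 = abs_circle_fun (\<lambda>_. 0)"
  by (simp add: zero_circle_fun.abs_eq)

lemma circle_one_abs: "1 = abs_circle_fun (\<lambda>_. 1)"
  by (simp add: one_circle_fun.abs_eq)

lemma circle_cnj_add [simp]: "circle_cnj (f + g) = circle_cnj f + circle_cnj g"
  by transfer (auto simp: circle_eq_def intro: measurable_compose[OF _ measurable_cnj])
lemma circle_cnj_diff [simp]: "circle_cnj (f - g) = circle_cnj f - circle_cnj g"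
  by transfer (auto simp: circle_eq_def intro: measurable_compose[OF _ measurable_cnj])
lemma circle_cnj_mult [simp]: "circle_cnj (f * g) = circle_cnj f * circle_cnj g"
  by transfer (auto simp: circle_eq_def intro: measurable_compose[OF _ measurable_cnj])
lemma circle_cnj_cnj [simp]: "circle_cnj (circle_cnj f) = f"
  by transfer (auto simp: circle_eq_def)
lemma circle_cnj_const [simp]: "circle_cnj (circle_const c) = circle_const (cnj c)"
  by transfer (auto simp: circle_eq_def)
lemma circle_cnj_zero [simp]: "circle_cnj 0 = 0"
  by transfer (auto simp: circle_eq_def)
lemma circle_cnj_one [simp]: "circle_cnj 1 = 1"
  by transfer (auto simp: circle_eq_def)
lemma circle_cnj_power [simp]: "circle_cnj (f ^ n) = circle_cnj f ^ n"
  by (induction n) auto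

lemma circle_const_add: "circle_const (a + b) = circle_const a + circle_const b"
  by transfer (auto simp: circle_eq_def)
lemma circle_const_mult: "circle_const (a * b) = circle_const a * circle_const b"
  by transfer (auto simp: circle_eq_def)
lemma circle_const_zero [simp]: "circle_const 0 = 0"
  by transfer (auto simp: circle_eq_def)
lemma circle_const_one [simp]: "circle_const 1 = 1"
  by transfer (auto simp: circle_eq_def)
text \<open>The boundary function of z; multiplication by \<open>circle_cnj cZ\<close> shifts
  Fourier coefficients down by one.\<close>

definition cZ :: circle_fun where "cZ = abs_circle_fun (\<lambda>\<zeta>. \<zeta>)"

definition cpoly :: "complex poly \<Rightarrow> circle_fun" where "cpoly Q = abs_circle_fun (poly Q)"

lemma cZ_cnj [simp]: "cZ * circle_cnj cZ = 1" "circle_cnj cZ * cZ = 1"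
  unfolding cZ_def circle_one_abs
  by (auto simp: abs_circle_cnj abs_circle_times abs_circle_fun_eq_iff circle_mult_cnj mult.commute intro!: AE_circleI)

lemma cZ_power: "cZ ^ n = abs_circle_fun (\<lambda>\<zeta>. \<zeta> ^ n)"
  by (induction n) (auto simp: circle_one_abs cZ_def abs_circle_times)

lemma cZ_cnj_power: "circle_cnj cZ ^ n = abs_circle_fun (\<lambda>\<zeta>. cnj \<zeta> ^ n)"
  by (induction n) (auto simp: circle_one_abs cZ_def abs_circle_times abs_circle_cnj)

lemma cpoly_0 [simp]: "cpoly 0 = 0"
  by (simp add: cpoly_def circle_zero_abs poly_0[abs_def] flip: poly_0)

lemma cpoly_pCons [simp]: "cpoly (pCons a Q) = circle_const a + cZ * cpoly Q"
  by (simp add: cpoly_def circle_const_abs cZ_def abs_circle_times abs_circle_plus poly_pCons[abs_def])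

lemma cpoly_add: "cpoly (P + Q) = cpoly P + cpoly Q"
  by (simp add: cpoly_def abs_circle_plus poly_add[abs_def])

lemma cpoly_smult: "cpoly (smult c P) = circle_const c * cpoly P"
  by (simp add: cpoly_def abs_circle_times circle_const_abs poly_smult[abs_def])

text \<open>The mean, which for a function in \<open>Hp p\<close> is its value at 0. All Fourier
  coefficients are rewritten as means of products with natural powers of \<open>cZ\<close> or its
  conjugate, so that integer powers disappear from later arguments.\<close>

definition cint :: "circle_fun \<Rightarrow> complex" where "cint f = fourier_coeff f 0"

lemma abs_circle_cint: "f \<in> borel_measurable borel \<Longrightarrow> cint (abs_circle_fun f) = (\<integral>\<zeta>. f \<zeta> \<partial>\<mu>)"
  by (simp add: cint_def abs_circle_fourier)

lemma fourier_coeff_nonneg: "fourier_coeff f (int n) = cint (f * circle_cnj cZ ^ n)"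
proof -
  obtain g where g [measurable]: "g \<in> borel_measurable borel" and f: "f = abs_circle_fun g" by (rule circle_fun_obtain)
  show ?thesis unfolding f cZ_cnj_power by (simp add: abs_circle_times abs_circle_fourier abs_circle_cint g)
qed

lemma fourier_coeff_neg: "fourier_coeff f (- int n) = cint (f * cZ ^ n)"
proof -
  obtain g where g [measurable]: "g \<in> borel_measurable borel" and f: "f = abs_circle_fun g" by (rule circle_fun_obtain)
  have "(\<integral>\<zeta>. g \<zeta> * cnj \<zeta> powi (- int n) \<partial>\<mu>) = (\<integral>\<zeta>. g \<zeta> * \<zeta> ^ n \<partial>\<mu>)"
  proof (rule integral_cong_AE)
    show "AE \<zeta> in \<mu>. g \<zeta> * cnj \<zeta> powi (- int n) = g \<zeta> * \<zeta> ^ n"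
    proof (rule AE_circleI)
      fix \<zeta> :: complex assume \<zeta>: "cmod \<zeta> = 1"
      \<comment> \<open>A negative power of conj \<zeta> turns into a power of \<zeta> on the circle
        itself, hence almost everywhere.\<close>
      then have "inverse (cnj \<zeta>) = \<zeta>" using circle_mult_cnj[OF \<zeta>] by (metis inverse_unique mult.commute)
      then show "g \<zeta> * cnj \<zeta> powi (- int n) = g \<zeta> * \<zeta> ^ n" by (simp add: power_int_minus power_inverse[symmetric])
    qed
  qed (auto simp: power_int_minus)
  then show ?thesis unfolding f cZ_power by (simp add: abs_circle_times abs_circle_fourier abs_circle_cint g)
qed

lemma Lp_abs: "f \<in> borel_measurable borel \<Longrightarrow> abs_circle_fun f \<in> Lp p \<longleftrightarrow> pint p f"
  by (simp add: Lp_def abs_circle_power_integrable)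

lemma Lp_obtain:
  assumes "F \<in> Lp p" obtains f where "f \<in> borel_measurable borel" "pint p f" "F = abs_circle_fun f"
  using assms Lp_abs circle_fun_obtain by metis

lemma Hp_iff: "f \<in> Hp p \<longleftrightarrow> f \<in> Lp p \<and> (\<forall>n\<ge>1. cint (f * cZ ^ n) = 0)"
proof -
  have "(\<forall>n<0. fourier_coeff f n = 0) \<longleftrightarrow> (\<forall>n\<ge>1. cint (f * cZ ^ n) = 0)"
  proof safe
    fix n :: nat assume "\<forall>n<0. fourier_coeff f n = 0" "1 \<le> n"
    then show "cint (f * cZ ^ n) = 0" using fourier_coeff_neg[of f n] by auto
  next
    fix n :: int assume *: "\<forall>n\<ge>1. cint (f * cZ ^ n) = 0" "n < 0"
    then show "fourier_coeff f n = 0" using fourier_coeff_neg[of f "nat (- n)"] by auto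
  qed
  then show ?thesis by (auto simp: Hp_def)
qed

lemma disc_ext_0: "disc_ext f 0 = cint f"
proof -
  have "(\<lambda>n. fourier_coeff f (int n) * 0 ^ n) sums fourier_coeff f (int 0)"
    using powser_sums_zero[of "\<lambda>n. fourier_coeff f (int n)"] by simp
  then show ?thesis by (simp add: disc_ext_def cint_def sums_iff)
qed

text \<open>The value of the extension at 0 is the mean, so vanishing at 0 is the condition with
  exponent n = 0.\<close>

lemma Hp0_iff: "f \<in> Hp0 p \<longleftrightarrow> f \<in> Lp p \<and> (\<forall>n. cint (f * cZ ^ n) = 0)"
proof -
  have "(\<forall>n. cint (f * cZ ^ n) = 0) \<longleftrightarrow> (\<forall>n\<ge>1. cint (f * cZ ^ n) = 0) \<and> cint f = 0"
    by (metis less_one mult.right_neutral not_le power_0)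
  then show ?thesis by (auto simp: Hp0_def Hp_iff disc_ext_0)
qed

lemma Hp_Lp: "f \<in> Hp p \<Longrightarrow> f \<in> Lp p" by (simp add: Hp_def)
lemma Hp0_Hp: "f \<in> Hp0 p \<Longrightarrow> f \<in> Hp p" by (simp add: Hp0_def)

section \<open>Essentially bounded classes and the norms on L^p\<close>

definition Linf :: "circle_fun set" where
  "Linf = {abs_circle_fun f |f. f \<in> borel_measurable borel \<and> (\<exists>B. AE \<zeta> in \<mu>. cmod (f \<zeta>) \<le> B)}"

lemma Linf_obtain:
  assumes "F \<in> Linf" obtains f B where "f \<in> borel_measurable borel" "AE \<zeta> in \<mu>. cmod (f \<zeta>) \<le> B" "B \<ge> 0" "F = abs_circle_fun f"
proof -
  obtain f B where f: "f \<in> borel_measurable borel" "AE \<zeta> in \<mu>. cmod (f \<zeta>) \<le> B" "F = abs_circle_fun f"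
    using assms by (auto simp: Linf_def)
  have "AE \<zeta> in \<mu>. cmod (f \<zeta>) \<le> max B 0" using f(2) by eventually_elim auto
  then show thesis using f that by force
qed

lemma LinfI: "f \<in> borel_measurable borel \<Longrightarrow> AE \<zeta> in \<mu>. cmod (f \<zeta>) \<le> B \<Longrightarrow> abs_circle_fun f \<in> Linf"
  by (auto simp: Linf_def)

lemma Linf_mult: "f \<in> Linf \<Longrightarrow> g \<in> Linf \<Longrightarrow> f * g \<in> Linf"
proof -
  assume "f \<in> Linf" "g \<in> Linf"
  then obtain f' A g' B where f: "f' \<in> borel_measurable borel" "AE \<zeta> in \<mu>. cmod (f' \<zeta>) \<le> A" "A \<ge> 0" "f = abs_circle_fun f'"
    and g: "g' \<in> borel_measurable borel" "AE \<zeta> in \<mu>. cmod (g' \<zeta>) \<le> B" "B \<ge> 0" "g = abs_circle_fun g'"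
    by (metis Linf_obtain)
  have "AE \<zeta> in \<mu>. cmod (f' \<zeta> * g' \<zeta>) \<le> A * B"
    using f(2) g(2) by eventually_elim (use f g in \<open>auto simp: norm_mult intro: mult_mono\<close>)
  then show ?thesis using f g by (auto simp: abs_circle_times intro!: LinfI)
qed

lemma Linf_cnj: "f \<in> Linf \<Longrightarrow> circle_cnj f \<in> Linf"
  by (erule Linf_obtain) (auto simp: abs_circle_cnj intro!: LinfI)

lemma Linf_const [simp]: "circle_const c \<in> Linf"
  by (auto simp: circle_const_abs intro!: LinfI[where B = "cmod c"])

lemma Linf_cpoly [simp]: "cpoly Q \<in> Linf"
proof -
  obtain B where "\<And>\<zeta>. cmod \<zeta> = 1 \<Longrightarrow> cmod (poly Q \<zeta>) \<le> B"
    using continuous_circle_bounded[OF continuous_on_poly[OF continuous_on_id]] by blast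
  then show ?thesis unfolding cpoly_def by (intro LinfI[where B = B] AE_circleI) auto
qed

lemma Linf_cZ [simp]: "cZ \<in> Linf"
  unfolding cZ_def by (intro LinfI[where B = 1] AE_circleI) auto

lemma Linf_one [simp]: "1 \<in> Linf" using Linf_const[of 1] by simp

lemma Linf_power: "f \<in> Linf \<Longrightarrow> f ^ n \<in> Linf"
  by (induction n) (auto intro: Linf_mult)

lemma unimodular_cnj_mult: "unimodular f \<Longrightarrow> f * circle_cnj f = 1"
proof -
  assume u: "unimodular f"
  obtain g where g: "g \<in> borel_measurable borel" and f: "f = abs_circle_fun g" by (rule circle_fun_obtain)
  then have "AE \<zeta> in \<mu>. cmod (g \<zeta>) = 1" using u by (auto simp: abs_circle_unimodular)
  then show ?thesis unfolding f circle_one_abs using g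
    by (auto simp: abs_circle_cnj abs_circle_times abs_circle_fun_eq_iff elim!: eventually_mono intro: circle_mult_cnj)
qed

lemma Lp_zero [simp]: "0 \<in> Lp p"
  by (simp add: circle_zero_abs Lp_abs pint_def)

lemma Lp_add: "p \<ge> 0 \<Longrightarrow> f \<in> Lp p \<Longrightarrow> g \<in> Lp p \<Longrightarrow> f + g \<in> Lp p"
  by (elim Lp_obtain) (auto simp: abs_circle_plus Lp_abs intro: pint_add)

lemma Lp_diff: "p \<ge> 0 \<Longrightarrow> f \<in> Lp p \<Longrightarrow> g \<in> Lp p \<Longrightarrow> f - g \<in> Lp p"
  by (elim Lp_obtain) (auto simp: abs_circle_minus Lp_abs intro: pint_diff)

lemma Lp_Linf_mult:
  assumes p: "p > 0" and b: "b \<in> Linf"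
  shows "\<exists>B\<ge>0. \<forall>f\<in>Lp p. b * f \<in> Lp p \<and> lp_norm p (b * f) \<le> B * lp_norm p f"
proof -
  obtain h B where h: "h \<in> borel_measurable borel" "AE \<zeta> in \<mu>. cmod (h \<zeta>) \<le> B" "B \<ge> 0" "b = abs_circle_fun h"
    using b by (rule Linf_obtain)
  show ?thesis
  proof (intro exI[of _ B] conjI ballI)
    fix f assume "f \<in> Lp p"
    then obtain f' where f': "f' \<in> borel_measurable borel" "pint p f'" "f = abs_circle_fun f'" by (rule Lp_obtain)
    have m: "(\<lambda>\<zeta>. h \<zeta> * f' \<zeta>) \<in> borel_measurable borel" using h f' by measurable
    have *: "pint p (\<lambda>\<zeta>. h \<zeta> * f' \<zeta>)" "pmass p (\<lambda>\<zeta>. h \<zeta> * f' \<zeta>) \<le> B powr p * pmass p f'"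
      using pint_bounded_mult[OF f'(2) h(1,2)] p by auto
    show "b * f \<in> Lp p" using * m h f' by (simp add: abs_circle_times Lp_abs)
    have "pmass p (\<lambda>\<zeta>. h \<zeta> * f' \<zeta>) powr (1/p) \<le> (B powr p * pmass p f') powr (1/p)"
      using * p by (intro powr_mono2) auto
    also have "\<dots> = B * pmass p f' powr (1/p)" using h p by (simp add: powr_mult powr_powr)
    finally show "lp_norm p (b * f) \<le> B * lp_norm p f" using m h f' by (simp add: abs_circle_times abs_circle_lp_norm)
  qed (use h in auto)
qed

lemma Lp_mult: "p > 0 \<Longrightarrow> b \<in> Linf \<Longrightarrow> f \<in> Lp p \<Longrightarrow> b * f \<in> Lp p"
  using Lp_Linf_mult by blast

lemma Lp_cnj: "f \<in> Lp p \<Longrightarrow> circle_cnj f \<in> Lp p"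
  by (erule Lp_obtain) (auto simp: abs_circle_cnj Lp_abs intro: pint_cnj)

lemma lp_norm_cnj [simp]: "lp_norm p (circle_cnj f) = lp_norm p f"
proof -
  obtain g where g: "g \<in> borel_measurable borel" and f: "f = abs_circle_fun g" by (rule circle_fun_obtain)
  have m: "(\<lambda>\<zeta>. cnj (g \<zeta>)) \<in> borel_measurable borel" using g by measurable
  show ?thesis unfolding f abs_circle_cnj[OF g] abs_circle_lp_norm[OF g] abs_circle_lp_norm[OF m] by (simp add: pmass_def)
qed

lemma lp_norm_nonneg [simp]: "lp_norm p f \<ge> 0"
proof -
  obtain g where g: "g \<in> borel_measurable borel" and f: "f = abs_circle_fun g" by (rule circle_fun_obtain)
  show ?thesis unfolding f abs_circle_lp_norm[OF g] by simp
qed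

lemma lp_norm_const_mult: "p > 0 \<Longrightarrow> lp_norm p (circle_const c * f) = cmod c * lp_norm p f"
proof -
  assume p: "p > 0"
  obtain g where g: "g \<in> borel_measurable borel" and f: "f = abs_circle_fun g" by (rule circle_fun_obtain)
  have m: "(\<lambda>\<zeta>. c * g \<zeta>) \<in> borel_measurable borel" using g by measurable
  have "pmass p (\<lambda>\<zeta>. c * g \<zeta>) = cmod c powr p * pmass p g"
    by (simp add: pmass_def norm_mult powr_mult)
  then show ?thesis using g m p by (simp add: f circle_const_abs abs_circle_times abs_circle_lp_norm powr_mult powr_powr)
qed

text \<open>One factor 2 comes from the p-th powers, the other from the root, since 2^(1/p) <=
  2.\<close>

lemma lp_norm_add:
  assumes p: "p \<ge> 1" and "f \<in> Lp p" "g \<in> Lp p"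
  shows "lp_norm p (f + g) \<le> 4 * (lp_norm p f + lp_norm p g)"
proof -
  obtain f' where f: "f' \<in> borel_measurable borel" "pint p f'" "f = abs_circle_fun f'" using assms(2) by (rule Lp_obtain)
  obtain g' where g: "g' \<in> borel_measurable borel" "pint p g'" "g = abs_circle_fun g'" using assms(3) by (rule Lp_obtain)
  have m: "(\<lambda>\<zeta>. f' \<zeta> + g' \<zeta>) \<in> borel_measurable borel" using f g by measurable
  have "pmass p (\<lambda>\<zeta>. f' \<zeta> + g' \<zeta>) powr (1/p) \<le> (2 powr p * (pmass p f' + pmass p g')) powr (1/p)"
    using pint_add(2)[OF f(2) g(2)] p by (intro powr_mono2) auto
  also have "\<dots> = 2 * (pmass p f' + pmass p g') powr (1/p)" using p by (simp add: powr_mult powr_powr)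
  also have "\<dots> \<le> 2 * (2 powr (1/p) * (pmass p f' powr (1/p) + pmass p g' powr (1/p)))"
    using p by (intro mult_left_mono powr_add_le) auto
  also have "2 powr (1/p) \<le> 2 powr (1::real)" using p by (intro powr_mono) auto
  finally show ?thesis using f g m by (simp add: abs_circle_plus abs_circle_lp_norm mult_right_mono)
qed

lemma lp_norm_1_eq: "f \<in> borel_measurable borel \<Longrightarrow> lp_norm 1 (abs_circle_fun f) = (\<integral>\<zeta>. cmod (f \<zeta>) \<partial>\<mu>)"
  by (simp add: abs_circle_lp_norm pmass_def)

lemma Lp1_iff: "f \<in> borel_measurable borel \<Longrightarrow> abs_circle_fun f \<in> Lp 1 \<longleftrightarrow> integrable \<mu> f"
  by (simp add: Lp_abs pint_def integrable_norm_iff)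

text \<open>The constant 1 matters here: the dominating functional of the Hahn-Banach extension must
  be subadditive.\<close>

lemma lp_norm_1_triangle: "f \<in> Lp 1 \<Longrightarrow> g \<in> Lp 1 \<Longrightarrow> lp_norm 1 (f + g) \<le> lp_norm 1 f + lp_norm 1 g"
proof -
  assume "f \<in> Lp 1" "g \<in> Lp 1"
  then obtain f' g' where f: "f' \<in> borel_measurable borel" "f = abs_circle_fun f'" and g: "g' \<in> borel_measurable borel" "g = abs_circle_fun g'"
    and i: "integrable \<mu> f'" "integrable \<mu> g'" by (metis Lp1_iff Lp_obtain)
  have m: "(\<lambda>\<zeta>. f' \<zeta> + g' \<zeta>) \<in> borel_measurable borel" using f g by measurable
  have "(\<integral>\<zeta>. cmod (f' \<zeta> + g' \<zeta>) \<partial>\<mu>) \<le> (\<integral>\<zeta>. cmod (f' \<zeta>) + cmod (g' \<zeta>) \<partial>\<mu>)"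
    using i by (intro integral_mono norm_triangle_ineq) auto
  then show ?thesis using f g m i by (simp add: abs_circle_plus lp_norm_1_eq)
qed

lemma Lp_mono:
  assumes "f \<in> Lp s" "0 < p" "p \<le> s"
  shows "f \<in> Lp p" "lp_norm p f \<le> lp_norm s f"
proof -
  obtain f' where f: "f' \<in> borel_measurable borel" "pint s f'" "f = abs_circle_fun f'" using assms(1) by (rule Lp_obtain)
  note * = pint_mono_exponent[OF f(2) assms(2,3)]
  show "f \<in> Lp p" using * f by (simp add: Lp_abs)
  have "pmass p f' powr (1/p) \<le> (pmass s f' powr (p/s)) powr (1/p)" using * assms by (intro powr_mono2) auto
  also have "\<dots> = pmass s f' powr (1/s)" using assms by (simp add: powr_powr)
  finally show "lp_norm p f \<le> lp_norm s f" using f by (simp add: abs_circle_lp_norm)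
qed

lemma Linf_Lp: "f \<in> Linf \<Longrightarrow> p > 0 \<Longrightarrow> f \<in> Lp p"
  by (erule Linf_obtain) (auto simp: Lp_abs intro: pint_bounded)

lemma cint_add: "f \<in> Lp 1 \<Longrightarrow> g \<in> Lp 1 \<Longrightarrow> cint (f + g) = cint f + cint g"
  by (elim Lp_obtain) (auto simp: abs_circle_plus abs_circle_cint Lp1_iff[symmetric] Lp_abs)

lemma cint_diff: "f \<in> Lp 1 \<Longrightarrow> g \<in> Lp 1 \<Longrightarrow> cint (f - g) = cint f - cint g"
  by (elim Lp_obtain) (auto simp: abs_circle_minus abs_circle_cint Lp1_iff[symmetric] Lp_abs)

lemma cint_const_mult: "cint (circle_const c * f) = c * cint f"
proof -
  obtain g where g: "g \<in> borel_measurable borel" and f: "f = abs_circle_fun g" by (rule circle_fun_obtain)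
  have m: "(\<lambda>\<zeta>. c * g \<zeta>) \<in> borel_measurable borel" using g by measurable
  show ?thesis using g m by (simp add: f circle_const_abs abs_circle_times abs_circle_cint)
qed

lemma cint_cnj: "cint (circle_cnj f) = cnj (cint f)"
proof -
  obtain g where g: "g \<in> borel_measurable borel" and f: "f = abs_circle_fun g" by (rule circle_fun_obtain)
  have m: "(\<lambda>\<zeta>. cnj (g \<zeta>)) \<in> borel_measurable borel" using g by measurable
  show ?thesis using g m by (simp add: f abs_circle_cnj abs_circle_cint)
qed

lemma cint_zero [simp]: "cint 0 = 0"
  by (simp add: circle_zero_abs abs_circle_cint)

lemma cint_norm_le: "f \<in> Lp p \<Longrightarrow> p \<ge> 1 \<Longrightarrow> cmod (cint f) \<le> lp_norm p f"
proof -
  assume f: "f \<in> Lp p" and p: "p \<ge> 1"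
  have f1: "f \<in> Lp 1" "lp_norm 1 f \<le> lp_norm p f" using Lp_mono[OF f, of 1] p by auto
  then obtain f' where f': "f' \<in> borel_measurable borel" "f = abs_circle_fun f'" by (metis Lp_obtain)
  have "cmod (cint f) \<le> lp_norm 1 f" using f' integral_norm_bound[of \<mu> f'] by (simp add: abs_circle_cint lp_norm_1_eq)
  with f1 show ?thesis by simp
qed

lemma Lp_Holder:
  assumes pq: "p > 1" "q > 1" "1/p + 1/q = 1" and f: "f \<in> Lp p" and g: "g \<in> Lp q"
  shows "f * g \<in> Lp 1" "cmod (cint (f * g)) \<le> lp_norm p f * lp_norm q g"
proof -
  obtain f' where f': "f' \<in> borel_measurable borel" "pint p f'" "f = abs_circle_fun f'" using f by (rule Lp_obtain)
  obtain g' where g': "g' \<in> borel_measurable borel" "pint q g'" "g = abs_circle_fun g'" using g by (rule Lp_obtain)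
  have m: "(\<lambda>\<zeta>. f' \<zeta> * g' \<zeta>) \<in> borel_measurable borel" using f' g' by measurable
  note H = pint_Holder[OF pq f'(2) g'(2)]
  show "f * g \<in> Lp 1" "cmod (cint (f * g)) \<le> lp_norm p f * lp_norm q g"
    using H f' g' m by (simp_all add: abs_circle_times Lp1_iff abs_circle_cint abs_circle_lp_norm)
qed

lemma cint_cpoly: "cint (cpoly Q) = poly Q 0"
  by (simp add: cpoly_def abs_circle_cint integral_poly_circle)

lemma Lp_eqI:
  assumes p: "p > 1" and f: "f \<in> Lp p" and g: "g \<in> Lp p"
    and "\<And>n. cint (f * cZ ^ n) = cint (g * cZ ^ n)" "\<And>n. cint (f * circle_cnj cZ ^ n) = cint (g * circle_cnj cZ ^ n)"
  shows "f = g"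
proof -
  have L1: "u * b \<in> Lp 1" if "u \<in> Lp p" "b \<in> Linf" for u b
    using Lp_mult[of p b u] Lp_mono(1)[of "b * u" p 1] that p by (simp add: mult.commute)
  have d: "f - g \<in> Lp p" using f g p by (intro Lp_diff) auto
  then obtain h where h: "h \<in> borel_measurable borel" "pint p h" "f - g = abs_circle_fun h" by (rule Lp_obtain)
  have b: "cZ ^ n \<in> Linf" "circle_cnj cZ ^ n \<in> Linf" for n by (intro Linf_power Linf_cnj Linf_cZ)+
  have "cint ((f - g) * cZ ^ n) = 0" "cint ((f - g) * circle_cnj cZ ^ n) = 0" for n
    using assms(4,5)[of n] L1 f g b by (simp_all add: left_diff_distrib cint_diff)
  then have "(\<integral>\<zeta>. h \<zeta> * \<zeta> ^ n \<partial>\<mu>) = 0" "(\<integral>\<zeta>. h \<zeta> * cnj \<zeta> ^ n \<partial>\<mu>) = 0" for n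
    using h(1) by (auto simp: h(3) cZ_power cZ_cnj_power abs_circle_times abs_circle_cint)
  then have "AE \<zeta> in \<mu>. h \<zeta> = 0" by (rule fourier_unique_AE[OF p h(2)])
  then have "f - g = 0" using h(1) by (simp add: h(3) circle_zero_abs abs_circle_fun_eq_iff)
  then show ?thesis by simp
qed

section \<open>Density of polynomials and means of products in Hardy spaces\<close>

lemma cpoly_mult: "cpoly (P * Q) = cpoly P * cpoly Q"
  by (simp add: cpoly_def abs_circle_times poly_mult[abs_def])

lemma cZ_power_cpoly: "cZ ^ n = cpoly (monom 1 n)"
  by (simp add: cZ_power cpoly_def poly_monom[abs_def])

lemma Hp_conjugate_exponent:
  fixes p :: real
  assumes "p > 1"
  shows "p / (p - 1) > 1" "1 / p + 1 / (p / (p - 1)) = 1"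
  using assms by (auto simp: field_simps)

lemma Lp_cint_tendsto:
  assumes pq: "p > 1" "q > 1" "1/p + 1/q = 1" and f: "f \<in> Lp p" and F: "\<And>n. F n \<in> Lp p" and b: "b \<in> Lp q"
    and lim: "(\<lambda>n. lp_norm p (f - F n)) \<longlonglongrightarrow> 0"
  shows "(\<lambda>n. cint (F n * b)) \<longlonglongrightarrow> cint (f * b)"
proof (rule LIM_zero_cancel, rule tendsto_norm_zero_cancel)
  have le: "cmod (cint (F n * b) - cint (f * b)) \<le> lp_norm p (f - F n) * lp_norm q b" for n
  proof -
    have "cint (f * b) - cint (F n * b) = cint ((f - F n) * b)"
      using Lp_Holder(1)[OF pq f b] Lp_Holder(1)[OF pq F b] by (simp add: left_diff_distrib cint_diff)
    then show ?thesis
      using Lp_Holder(2)[OF pq _ b, of "f - F n"] Lp_diff[OF _ f F] pq by (simp add: norm_minus_commute)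
  qed
  show "(\<lambda>n. cmod (cint (F n * b) - cint (f * b))) \<longlonglongrightarrow> 0"
    by (rule tendsto_sandwich[OF _ _ tendsto_const tendsto_mult_left_zero[OF lim, of "lp_norm q b"]])
       (use le in auto)
qed

lemma Lp_Linf_L1: "p \<ge> 1 \<Longrightarrow> f \<in> Lp p \<Longrightarrow> b \<in> Linf \<Longrightarrow> f * b \<in> Lp 1"
  using Lp_mult[of p b f] Lp_mono(1)[of "b * f" p 1] by (simp add: mult.commute)

lemma cZ_power_Linf [simp]: "cZ ^ n \<in> Linf" "circle_cnj cZ ^ n \<in> Linf"
  by (intro Linf_power Linf_cnj Linf_cZ)+

lemma Hp_add: "p \<ge> 1 \<Longrightarrow> f \<in> Hp p \<Longrightarrow> g \<in> Hp p \<Longrightarrow> f + g \<in> Hp p"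
  unfolding Hp_iff by (auto simp: distrib_right cint_add Lp_Linf_L1 intro: Lp_add)

lemma Hp_const_mult: "p \<ge> 1 \<Longrightarrow> f \<in> Hp p \<Longrightarrow> circle_const c * f \<in> Hp p"
  unfolding Hp_iff by (auto simp: mult.assoc cint_const_mult intro: Lp_mult)

lemma Hp0_add: "p \<ge> 1 \<Longrightarrow> f \<in> Hp0 p \<Longrightarrow> g \<in> Hp0 p \<Longrightarrow> f + g \<in> Hp0 p"
  unfolding Hp0_iff by (auto simp: distrib_right cint_add Lp_Linf_L1 intro: Lp_add)

lemma Hp0_diff: "p \<ge> 1 \<Longrightarrow> f \<in> Hp0 p \<Longrightarrow> g \<in> Hp0 p \<Longrightarrow> f - g \<in> Hp0 p"
  unfolding Hp0_iff by (auto simp: left_diff_distrib cint_diff Lp_Linf_L1 intro: Lp_diff)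

lemma Hp0_const_mult: "p \<ge> 1 \<Longrightarrow> f \<in> Hp0 p \<Longrightarrow> circle_const c * f \<in> Hp0 p"
  unfolding Hp0_iff by (auto simp: mult.assoc cint_const_mult intro: Lp_mult)

lemma cpoly_Hp: "p > 0 \<Longrightarrow> cpoly Q \<in> Hp p"
  unfolding Hp_iff by (auto intro: Linf_Lp simp: cZ_power_cpoly cpoly_mult[symmetric] cint_cpoly poly_monom zero_power)

lemma cpoly_Lp: "p > 0 \<Longrightarrow> cpoly Q \<in> Lp p"
  by (auto intro: Linf_Lp)

lemma Hp_eqI:
  assumes "p > 1" "f \<in> Hp p" "g \<in> Hp p" "\<And>n. cint (f * circle_cnj cZ ^ n) = cint (g * circle_cnj cZ ^ n)"
  shows "f = g"
proof (rule Lp_eqI[OF assms(1)])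
  fix n show "cint (f * cZ ^ n) = cint (g * cZ ^ n)"
    using assms(2,3) assms(4)[of 0] by (cases "n = 0") (auto simp: Hp_iff)
qed (use assms in \<open>auto simp: Hp_Lp\<close>)

text \<open>The limit construction restated for classes: \<open>g\<close> inherits membership in
  \<open>Hp p\<close> from the polynomials Q n, and its nonnegative coefficients agree with those of
  \<open>f\<close> because conj (R n) contributes nothing to them. The polynomials are kept, as they
  yield density.\<close>

lemma riesz_part:
  fixes p :: real
  assumes p: "p > 1"
  shows "\<exists>C\<ge>0. \<forall>f\<in>Lp p. \<exists>g Q. g \<in> Hp p \<and> lp_norm p g \<le> C * lp_norm p f \<and>
     (\<forall>n. cint (g * circle_cnj cZ ^ n) = cint (f * circle_cnj cZ ^ n)) \<and> (\<lambda>n. lp_norm p (g - cpoly (Q n))) \<longlonglongrightarrow> 0"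
proof -
  obtain K where K: "K \<ge> 0" "\<And>f. pint p f \<Longrightarrow> (\<exists>g Q R. (\<forall>n. poly (R n) 0 = 0) \<and> pint p g \<and> pmass p g \<le> K * pmass p f \<and>
     (\<lambda>n. pmass p (\<lambda>\<zeta>. f \<zeta> - (poly (Q n) \<zeta> + cnj (poly (R n) \<zeta>)))) \<longlonglongrightarrow> 0 \<and>
     (\<lambda>n. pmass p (\<lambda>\<zeta>. g \<zeta> - poly (Q n) \<zeta>)) \<longlonglongrightarrow> 0)"
    using riesz_exists[OF p] by blast
  define q where "q = p / (p - 1)"
  note pq = Hp_conjugate_exponent[OF p, folded q_def]
  have p0: "p > 0" "p \<ge> 1" "q > 0" using p pq by auto
  show ?thesis
  proof (intro exI[of _ "K powr (1/p)"] conjI ballI)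
    fix f assume "f \<in> Lp p"
    then obtain f' where f': "f' \<in> borel_measurable borel" "pint p f'" "f = abs_circle_fun f'" by (rule Lp_obtain)
    obtain g' Q R where R: "\<And>n. poly (R n) 0 = 0" and g': "pint p g'" "pmass p g' \<le> K * pmass p f'"
      and lim1: "(\<lambda>n. pmass p (\<lambda>\<zeta>. f' \<zeta> - (poly (Q n) \<zeta> + cnj (poly (R n) \<zeta>)))) \<longlonglongrightarrow> 0"
      and lim2: "(\<lambda>n. pmass p (\<lambda>\<zeta>. g' \<zeta> - poly (Q n) \<zeta>)) \<longlonglongrightarrow> 0"
      using K(2)[OF f'(2)] by blast
    have [measurable]: "g' \<in> borel_measurable borel" "f' \<in> borel_measurable borel" using g' f' by (auto simp: pint_measurable)
    define g where "g = abs_circle_fun g'"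
    have gL: "g \<in> Lp p" using g' by (simp add: g_def Lp_abs)
    define T where "T n = cpoly (Q n) + circle_cnj (cpoly (R n))" for n
    have TL: "T n \<in> Lp p" for n unfolding T_def using p0 by (intro Lp_add Lp_cnj cpoly_Lp) auto
    have "lp_norm p (f - T n) = pmass p (\<lambda>\<zeta>. f' \<zeta> - (poly (Q n) \<zeta> + cnj (poly (R n) \<zeta>))) powr (1/p)" for n
      by (simp add: T_def f'(3) cpoly_def abs_circle_plus abs_circle_minus abs_circle_cnj abs_circle_lp_norm)
    moreover have "(\<lambda>n. pmass p (\<lambda>\<zeta>. f' \<zeta> - (poly (Q n) \<zeta> + cnj (poly (R n) \<zeta>))) powr (1/p)) \<longlonglongrightarrow> 0 powr (1/p)"
      using p by (intro tendsto_powr' lim1) auto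
    ultimately have l1: "(\<lambda>n. lp_norm p (f - T n)) \<longlonglongrightarrow> 0" by simp
    have "lp_norm p (g - cpoly (Q n)) = pmass p (\<lambda>\<zeta>. g' \<zeta> - poly (Q n) \<zeta>) powr (1/p)" for n
      by (simp add: g_def cpoly_def abs_circle_plus abs_circle_minus abs_circle_cnj abs_circle_lp_norm)
    moreover have "(\<lambda>n. pmass p (\<lambda>\<zeta>. g' \<zeta> - poly (Q n) \<zeta>) powr (1/p)) \<longlonglongrightarrow> 0 powr (1/p)"
      using p by (intro tendsto_powr' lim2) auto
    ultimately have l2: "(\<lambda>n. lp_norm p (g - cpoly (Q n))) \<longlonglongrightarrow> 0" by simp
    have norm: "lp_norm p g \<le> K powr (1/p) * lp_norm p f"
    proof -
      have "pmass p g' powr (1/p) \<le> (K * pmass p f') powr (1/p)" using g' p by (intro powr_mono2) auto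
      then show ?thesis using K by (simp add: g_def f'(3) abs_circle_lp_norm powr_mult)
    qed
    have Zq: "cZ ^ n \<in> Lp q" "circle_cnj cZ ^ n \<in> Lp q" for n using p0 by (auto intro!: Linf_Lp)
    have gH: "g \<in> Hp p" unfolding Hp_iff
    proof (intro conjI allI impI gL)
      fix n :: nat assume n: "1 \<le> n"
      have "(\<lambda>k. cint (cpoly (Q k) * cZ ^ n)) \<longlonglongrightarrow> cint (g * cZ ^ n)"
        by (rule Lp_cint_tendsto[OF p pq gL _ Zq(1) l2]) (simp add: cpoly_Lp p0)
      moreover have "cint (cpoly (Q k) * cZ ^ n) = 0" for k using cpoly_Hp[of p "Q k"] p0 n by (simp add: Hp_iff)
      ultimately show "cint (g * cZ ^ n) = 0" by (simp add: LIMSEQ_const_iff)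
    qed
    have coeff: "cint (g * circle_cnj cZ ^ n) = cint (f * circle_cnj cZ ^ n)" for n
    proof -
      have "(\<lambda>k. cint (cpoly (Q k) * circle_cnj cZ ^ n)) \<longlonglongrightarrow> cint (g * circle_cnj cZ ^ n)"
        by (rule Lp_cint_tendsto[OF p pq gL _ Zq(2) l2]) (simp add: cpoly_Lp p0)
      moreover have "(\<lambda>k. cint (T k * circle_cnj cZ ^ n)) \<longlonglongrightarrow> cint (f * circle_cnj cZ ^ n)"
        by (rule Lp_cint_tendsto[OF p pq \<open>f \<in> Lp p\<close> TL Zq(2) l1])
      moreover have "cint (T k * circle_cnj cZ ^ n) = cint (cpoly (Q k) * circle_cnj cZ ^ n)" for k
      proof -
        have "cint (circle_cnj (cpoly (R k)) * circle_cnj cZ ^ n) = cnj (cint (cpoly (R k) * cZ ^ n))"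
          by (subst cint_cnj[symmetric]) simp
        also have "\<dots> = 0" by (simp add: cZ_power_cpoly cpoly_mult[symmetric] cint_cpoly R)
        finally show ?thesis unfolding T_def distrib_right
          using p0 by (subst cint_add) (auto intro!: Lp_Linf_L1[of p] Lp_cnj cpoly_Lp)
      qed
      ultimately show ?thesis using LIMSEQ_unique by simp blast
    qed
    show "\<exists>g Q. g \<in> Hp p \<and> lp_norm p g \<le> K powr (1/p) * lp_norm p f \<and>
      (\<forall>n. cint (g * circle_cnj cZ ^ n) = cint (f * circle_cnj cZ ^ n)) \<and> (\<lambda>n. lp_norm p (g - cpoly (Q n))) \<longlonglongrightarrow> 0"
      using gH norm coeff l2 by blast
  qed simp
qed

text \<open>A function in \<open>Hp p\<close> is its own analytic part, so the polynomials built for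
  the projection converge to it.\<close>

lemma Hp_poly_dense:
  assumes p: "p > 1" and f: "f \<in> Hp p"
  obtains Q where "(\<lambda>n. lp_norm p (f - cpoly (Q n))) \<longlonglongrightarrow> 0"
proof -
  obtain g Q where "g \<in> Hp p" "\<forall>n. cint (g * circle_cnj cZ ^ n) = cint (f * circle_cnj cZ ^ n)"
      "(\<lambda>n. lp_norm p (g - cpoly (Q n))) \<longlonglongrightarrow> 0"
    using riesz_part[OF p] Hp_Lp[OF f] by blast
  moreover have "g = f" using calculation f by (intro Hp_eqI[OF p]) auto
  ultimately show thesis using that by blast
qed

text \<open>The constant term of Q n is the mean of Q n - f, hence no larger than the error itself,
  and may be removed.\<close>

lemma Hp0_poly_dense:
  assumes p: "p > 1" and f: "f \<in> Hp0 p"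
  obtains Q where "(\<lambda>n. lp_norm p (f - cZ * cpoly (Q n))) \<longlonglongrightarrow> 0"
proof -
  obtain Q where Q: "(\<lambda>n. lp_norm p (f - cpoly (Q n))) \<longlonglongrightarrow> 0"
    using Hp_poly_dense[OF p Hp0_Hp[OF f]] by blast
  have fL: "f \<in> Lp p" using f by (simp add: Hp0_Hp Hp_Lp)
  have QL: "cpoly (Q n) \<in> Lp p" for n using p by (simp add: cpoly_Lp)
  define R where "R n = poly_shift 1 (Q n)" for n
  have QR: "cpoly (Q n) = circle_const (poly (Q n) 0) + cZ * cpoly (R n)" for n
  proof -
    have "Q n = pCons (poly (Q n) 0) (R n)" unfolding R_def
      by (rule poly_eqI) (auto simp: coeff_pCons coeff_poly_shift poly_0_coeff_0 split: nat.splits)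
    then show ?thesis using cpoly_pCons by metis
  qed
  have c: "cmod (poly (Q n) 0) \<le> lp_norm p (f - cpoly (Q n))" for n
  proof -
    have "cint f = 0" using f unfolding Hp0_iff by (metis mult.right_neutral power_0)
    then have "cint (f - cpoly (Q n)) = - poly (Q n) 0"
      using fL QL[of n] Lp_mono(1)[of _ p 1] p by (simp add: cint_diff cint_cpoly)
    then show ?thesis using cint_norm_le[OF Lp_diff[OF _ fL QL[of n]]] p by (metis less_eq_real_def norm_minus_cancel order_trans zero_le_one)
  qed
  have le: "lp_norm p (f - cZ * cpoly (R n)) \<le> 4 * (lp_norm p (f - cpoly (Q n)) + lp_norm p (f - cpoly (Q n)) * lp_norm p 1)" for n
  proof -
    have "lp_norm p ((f - cpoly (Q n)) + circle_const (poly (Q n) 0) * 1) \<le>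
      4 * (lp_norm p (f - cpoly (Q n)) + lp_norm p (circle_const (poly (Q n) 0) * 1))"
      using p by (intro lp_norm_add Lp_diff fL QL Linf_Lp) auto
    also have "lp_norm p (circle_const (poly (Q n) 0) * 1) \<le> lp_norm p (f - cpoly (Q n)) * lp_norm p 1"
      using c p by (subst lp_norm_const_mult) (auto intro: mult_right_mono)
    finally show ?thesis by (simp add: QR)
  qed
  have "(\<lambda>n. 4 * (lp_norm p (f - cpoly (Q n)) + lp_norm p (f - cpoly (Q n)) * lp_norm p 1)) \<longlonglongrightarrow> 4 * (0 + 0 * lp_norm p 1)"
    by (intro tendsto_intros Q)
  then have lim: "(\<lambda>n. 4 * (lp_norm p (f - cpoly (Q n)) + lp_norm p (f - cpoly (Q n)) * lp_norm p 1)) \<longlonglongrightarrow> 0"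
    by simp
  have "(\<lambda>n. lp_norm p (f - cZ * cpoly (R n))) \<longlonglongrightarrow> 0"
    by (rule tendsto_sandwich[OF _ _ tendsto_const lim]) (use le in auto)
  then show thesis using that by blast
qed

text \<open>For a polynomial factor, induction passes each \<open>cZ\<close> to g, and
  \<open>cZ * g\<close> has mean 0, so only the constant term survives; density and Hoelder extend
  this to f.\<close>

lemma cint_mult_Hp:
  assumes pq: "p > 1" "q > 1" "1/p + 1/q = 1" and f: "f \<in> Hp p" and g: "g \<in> Hp q"
  shows "cint (f * g) = cint f * cint g"
proof -
  have poly: "cint (cpoly Q * g) = poly Q 0 * cint g" if "g \<in> Hp q" for Q g
    using that
  proof (induction Q arbitrary: g)
    case (pCons a Q)
    have gL: "g \<in> Lp q" using pCons.prems by (rule Hp_Lp)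
    have z: "cint (cZ * g) = 0" using pCons.prems unfolding Hp_iff by (metis mult.commute order_refl power_one_right)
    have "cZ * g \<in> Hp q" unfolding Hp_iff
    proof (intro conjI allI impI)
      fix n :: nat assume "1 \<le> n"
      have "cZ * g * cZ ^ n = g * cZ ^ Suc n" by (simp add: mult_ac)
      then show "cint (cZ * g * cZ ^ n) = 0" using pCons.prems unfolding Hp_iff by (metis le_add1 plus_1_eq_Suc)
    qed (use gL pq in \<open>auto intro: Lp_mult\<close>)
    then have "cint (cpoly Q * (cZ * g)) = 0" using pCons.IH z by simp
    moreover have "cpoly (pCons a Q) * g = circle_const a * g + cpoly Q * (cZ * g)" by (simp add: algebra_simps)
    moreover have "circle_const a * g \<in> Lp 1" "cpoly Q * (cZ * g) \<in> Lp 1"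
      using gL pq by (auto intro!: Lp_mono(1)[of _ q 1] Lp_mult)
    ultimately show ?case by (simp add: cint_add cint_const_mult)
  qed simp
  obtain Q where Q: "(\<lambda>n. lp_norm p (f - cpoly (Q n))) \<longlonglongrightarrow> 0" using Hp_poly_dense[OF pq(1) f] by blast
  have QL: "cpoly (Q n) \<in> Lp p" for n using pq by (simp add: cpoly_Lp)
  have "(\<lambda>n. cint (cpoly (Q n) * g)) \<longlonglongrightarrow> cint (f * g)"
    by (rule Lp_cint_tendsto[OF pq Hp_Lp[OF f] QL Hp_Lp[OF g] Q])
  moreover have "(\<lambda>n. cint (cpoly (Q n) * 1)) \<longlonglongrightarrow> cint (f * 1)"
    by (rule Lp_cint_tendsto[OF pq Hp_Lp[OF f] QL _ Q]) (use pq in \<open>auto intro: Linf_Lp\<close>)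
  then have "(\<lambda>n. poly (Q n) 0 * cint g) \<longlonglongrightarrow> cint f * cint g"
    by (intro tendsto_mult_right) (simp add: cint_cpoly)
  ultimately show ?thesis using poly[OF g] LIMSEQ_unique by simp blast
qed

section \<open>Bounded analytic functions acting on Hardy spaces\<close>

lemma Hinf_radial:
  assumes "\<phi> \<in> Hinf"
  obtains F f B where "F holomorphic_on ball 0 1" "\<And>z. z \<in> ball 0 1 \<Longrightarrow> cmod (F z) \<le> B" "f \<in> borel_measurable borel"
    "\<phi> = abs_circle_fun f" "AE \<zeta> in \<mu>. ((\<lambda>r. F (of_real r * \<zeta>)) \<longlongrightarrow> f \<zeta>) (at_left 1)"
proof -
  obtain F where F: "F holomorphic_on ball 0 1" "bounded (F ` ball 0 1)" "has_radial_limits F \<phi>"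
    using assms by (auto simp: Hinf_def)
  obtain B where B: "\<And>z. z \<in> ball 0 1 \<Longrightarrow> cmod (F z) \<le> B" using F(2) unfolding bounded_iff by blast
  obtain f where f: "f \<in> borel_measurable borel" "\<phi> = abs_circle_fun f" by (rule circle_fun_obtain)
  show thesis using that[OF F(1) B f] F(3) f by (simp add: abs_circle_radial)
qed

lemma HinfI:
  assumes "F holomorphic_on ball 0 1" "\<And>z. z \<in> ball 0 1 \<Longrightarrow> cmod (F z) \<le> B" "f \<in> borel_measurable borel"
    "AE \<zeta> in \<mu>. ((\<lambda>r. F (of_real r * \<zeta>)) \<longlongrightarrow> f \<zeta>) (at_left 1)"
  shows "abs_circle_fun f \<in> Hinf"
  unfolding Hinf_def using assms by (auto simp: abs_circle_radial bounded_iff intro!: exI[of _ F] exI[of _ B])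

lemma Hinf_Linf: "\<phi> \<in> Hinf \<Longrightarrow> \<phi> \<in> Linf"
  by (erule Hinf_radial, hypsubst, rule LinfI, assumption, rule radial_limit_integral(2))

lemma Hinf_Hp: "\<phi> \<in> Hinf \<Longrightarrow> p > 0 \<Longrightarrow> \<phi> \<in> Hp p"
proof -
  assume \<phi>: "\<phi> \<in> Hinf" and p: "p > 0"
  from \<phi> obtain F f B where F: "F holomorphic_on ball 0 1" "\<And>z. z \<in> ball 0 1 \<Longrightarrow> cmod (F z) \<le> B" and f: "f \<in> borel_measurable borel"
    "AE \<zeta> in \<mu>. ((\<lambda>r. F (of_real r * \<zeta>)) \<longlongrightarrow> f \<zeta>) (at_left 1)" and eq: "\<phi> = abs_circle_fun f"
    by (rule Hinf_radial) blast
  have "cint (\<phi> * cZ ^ n) = 0" if "n \<ge> 1" for n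
    using radial_limit_integral(1)[OF F f, of n] that f by (simp add: eq cZ_power abs_circle_times abs_circle_cint)
  then show ?thesis using p Hinf_Linf[OF \<phi>] by (auto simp: Hp_iff intro: Linf_Lp)
qed

lemma Hinf_mult:
  assumes "\<phi> \<in> Hinf" "\<psi> \<in> Hinf" shows "\<phi> * \<psi> \<in> Hinf"
proof -
  obtain F f A where F: "F holomorphic_on ball 0 1" "\<And>z. z \<in> ball 0 1 \<Longrightarrow> cmod (F z) \<le> A" and f: "f \<in> borel_measurable borel"
    "\<phi> = abs_circle_fun f" "AE \<zeta> in \<mu>. ((\<lambda>r. F (of_real r * \<zeta>)) \<longlongrightarrow> f \<zeta>) (at_left 1)"
    by (rule Hinf_radial[OF assms(1)]) (rule that)
  obtain G g B where G: "G holomorphic_on ball 0 1" "\<And>z. z \<in> ball 0 1 \<Longrightarrow> cmod (G z) \<le> B" and g: "g \<in> borel_measurable borel"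
    "\<psi> = abs_circle_fun g" "AE \<zeta> in \<mu>. ((\<lambda>r. G (of_real r * \<zeta>)) \<longlongrightarrow> g \<zeta>) (at_left 1)"
    by (rule Hinf_radial[OF assms(2)]) (rule that)
  have "abs_circle_fun (\<lambda>\<zeta>. f \<zeta> * g \<zeta>) \<in> Hinf"
  proof (rule HinfI)
    show "(\<lambda>z. F z * G z) holomorphic_on ball 0 1" using F G by (intro holomorphic_intros)
    show "(\<lambda>\<zeta>. f \<zeta> * g \<zeta>) \<in> borel_measurable borel" using f g by measurable
    show "AE \<zeta> in \<mu>. ((\<lambda>r. F (of_real r * \<zeta>) * G (of_real r * \<zeta>)) \<longlongrightarrow> f \<zeta> * g \<zeta>) (at_left 1)"
      using f(3) g(3) by eventually_elim (rule tendsto_mult)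
    fix z :: complex assume "z \<in> ball 0 1"
    then show "cmod (F z * G z) \<le> A * B" unfolding norm_mult
      using F(2)[of z] G(2)[of z] order_trans[OF norm_ge_zero] by (intro mult_mono) auto
  qed
  then show ?thesis using f g by (simp add: abs_circle_times)
qed

text \<open>Continuity on the closed disc gives radial limits at every boundary point. This supplies
  the polynomials and the fractional powers used in the factorization.\<close>

lemma Hinf_continuousI:
  assumes F: "F holomorphic_on ball 0 1" "continuous_on (cball 0 1) F"
    and f: "f \<in> borel_measurable borel" "\<And>\<zeta>. cmod \<zeta> = 1 \<Longrightarrow> f \<zeta> = F \<zeta>"
  shows "abs_circle_fun f \<in> Hinf"
proof -
  have "compact (F ` cball 0 1)" using F(2) by (rule compact_continuous_image) simp
  then obtain C where C: "\<And>x. x \<in> F ` cball 0 1 \<Longrightarrow> norm x \<le> C" using compact_imp_bounded bounded_iff by metis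
  show ?thesis
  proof (rule HinfI[OF F(1) _ f(1)])
    show "cmod (F z) \<le> C" if "z \<in> ball 0 1" for z using C that by auto
    show "AE \<zeta> in \<mu>. ((\<lambda>r. F (of_real r * \<zeta>)) \<longlongrightarrow> f \<zeta>) (at_left 1)"
    proof (rule AE_circleI)
      fix \<zeta> :: complex assume \<zeta>: "cmod \<zeta> = 1"
      have "continuous_on {0..1} (\<lambda>r. F (of_real r * \<zeta>))"
        by (intro continuous_on_compose2[OF F(2)] continuous_intros) (auto simp: norm_mult \<zeta>)
      then have "((\<lambda>r. F (of_real r * \<zeta>)) \<longlongrightarrow> F \<zeta>) (at 1 within {0..1})"
        unfolding continuous_on_def by (metis atLeastAtMost_iff mult_1 of_real_1 order_refl zero_le_one)
      moreover have "at_left (1::real) = at 1 within {0..1}"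
        by (metis at_within_Icc_at_left zero_less_one)
      ultimately show "((\<lambda>r. F (of_real r * \<zeta>)) \<longlongrightarrow> f \<zeta>) (at_left 1)" using \<zeta> f by simp
    qed
  qed
qed

lemma Hinf_cpoly [simp]: "cpoly Q \<in> Hinf"
  unfolding cpoly_def by (rule Hinf_continuousI[where F = "poly Q"]) (auto intro!: holomorphic_intros continuous_intros)

lemma Hinf_const [simp]: "circle_const c \<in> Hinf"
  using Hinf_cpoly[of "[:c:]"] by simp

lemma Hinf_cZ [simp]: "cZ \<in> Hinf"
  using Hinf_cpoly[of "[:0, 1:]"] by simp

lemma Hinf_cZ_power [simp]: "cZ ^ n \<in> Hinf"
  by (simp add: cZ_power_cpoly)

text \<open>The coefficient of \<phi> f at -n is the mean of the product of f with \<phi> z^n. The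
  latter lies in the Hardy space of the conjugate exponent and has mean 0, and means
  multiply.\<close>

lemma Hinf_mult_Hp:
  assumes p: "p > 1" and \<phi>: "\<phi> \<in> Hinf" and f: "f \<in> Hp p"
  shows "\<phi> * f \<in> Hp p"
  unfolding Hp_iff
proof (intro conjI allI impI)
  show "\<phi> * f \<in> Lp p" using p by (intro Lp_mult Hinf_Linf[OF \<phi>] Hp_Lp[OF f]) simp
  fix n :: nat assume n: "n \<ge> 1"
  define q where "q = p / (p - 1)"
  note pq = Hp_conjugate_exponent[OF p, folded q_def]
  have "\<phi> * cZ ^ n \<in> Hp q" using Hinf_Hp[OF Hinf_mult[OF \<phi> Hinf_cZ_power], of q] pq by simp
  moreover have "cint (\<phi> * cZ ^ n) = 0" using Hinf_Hp[OF \<phi>, of q] pq n by (auto simp: Hp_iff)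
  ultimately have "cint (f * (\<phi> * cZ ^ n)) = 0"
    using cint_mult_Hp[OF p pq f] by simp
  then show "cint (\<phi> * f * cZ ^ n) = 0" by (simp add: mult_ac)
qed

lemma Hinf_mult_Hp0:
  assumes p: "p > 1" and \<phi>: "\<phi> \<in> Hinf" and f: "f \<in> Hp0 p"
  shows "\<phi> * f \<in> Hp0 p"
proof -
  define q where "q = p / (p - 1)"
  note pq = Hp_conjugate_exponent[OF p, folded q_def]
  have "cint f = 0" using f unfolding Hp0_iff by (metis mult.right_neutral power_0)
  then have "cint (\<phi> * f) = 0"
    using cint_mult_Hp[OF p pq Hp0_Hp[OF f] Hinf_Hp[OF \<phi>]] pq by (simp add: mult.commute)
  then show ?thesis using Hinf_mult_Hp[OF p \<phi> Hp0_Hp[OF f]] by (simp add: Hp0_def disc_ext_0)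
qed

lemma cint_Hp0_mult_Hinf: "p > 1 \<Longrightarrow> f \<in> Hp0 p \<Longrightarrow> \<phi> \<in> Hinf \<Longrightarrow> cint (f * \<phi>) = 0"
  using Hinf_mult_Hp0[of p \<phi> f] by (simp add: Hp0_def disc_ext_0 mult.commute)

section \<open>The Riesz projection and the backward shift\<close>

text \<open>The difference f - g has only negative coefficients, so conjugation turns it into a
  function with only positive ones.\<close>

lemma Hp_minus_cnj_Hp0:
  assumes p: "p > 1" and f: "f \<in> Lp p" and g: "g \<in> Hp p"
    and eq: "\<And>n. cint (g * circle_cnj cZ ^ n) = cint (f * circle_cnj cZ ^ n)"
  shows "circle_cnj (f - g) \<in> Hp0 p"
  unfolding Hp0_iff
proof (intro conjI allI)
  have gL: "g \<in> Lp p" using g by (rule Hp_Lp)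
  show "circle_cnj (f - g) \<in> Lp p" using p f gL by (intro Lp_cnj Lp_diff) auto
  fix n
  have "cint (circle_cnj (f - g) * cZ ^ n) = cnj (cint ((f - g) * circle_cnj cZ ^ n))"
    by (subst cint_cnj[symmetric]) simp
  also have "cint ((f - g) * circle_cnj cZ ^ n) = 0"
    using Lp_Linf_L1[of p f] Lp_Linf_L1[of p g] p f gL eq[of n] by (simp add: left_diff_distrib cint_diff)
  finally show "cint (circle_cnj (f - g) * cZ ^ n) = 0" by simp
qed

lemma cint_cnj_Hp0:
  assumes "g \<in> Hp0 p"
  shows "cint (circle_cnj g * circle_cnj cZ ^ n) = 0"
proof -
  have "cint (circle_cnj g * circle_cnj cZ ^ n) = cnj (cint (g * cZ ^ n))"
    by (subst cint_cnj[symmetric]) simp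
  then show ?thesis using assms by (simp add: Hp0_iff)
qed

text \<open>The projection is built by choosing, for each f, the function in \<open>Hp p\<close>
  with the nonnegative coefficients of f. Coefficients determine a function in \<open>Hp p\<close>,
  so linearity is checked on them. The definite description in \<open>riesz_projection\<close> also
  needs uniqueness, which comes from splitting f into \<open>P f\<close> and the conjugate of a
  function in \<open>Hp0 p\<close>.\<close>

lemma riesz_projection_characterization:
  fixes p :: real
  assumes p: "p > 1"
  shows "riesz_projection p \<in> bounded_operators p (Lp p)"
    and "f \<in> Lp p \<Longrightarrow> riesz_projection p f \<in> Hp p"
    and "f \<in> Lp p \<Longrightarrow> cint (riesz_projection p f * circle_cnj cZ ^ n) = cint (f * circle_cnj cZ ^ n)"
proof -
  obtain C where C: "C \<ge> 0" "\<And>f. f \<in> Lp p \<Longrightarrow> \<exists>g. g \<in> Hp p \<and> lp_norm p g \<le> C * lp_norm p f \<and>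
     (\<forall>n. cint (g * circle_cnj cZ ^ n) = cint (f * circle_cnj cZ ^ n))"
    using riesz_part[OF p] by meson
  have p1: "p \<ge> 1" "p \<ge> 0" "p > 0" using p by auto
  define P where "P = restrict (\<lambda>f. SOME g. g \<in> Hp p \<and> lp_norm p g \<le> C * lp_norm p f \<and>
     (\<forall>n. cint (g * circle_cnj cZ ^ n) = cint (f * circle_cnj cZ ^ n))) (Lp p)"
  have P: "P f \<in> Hp p" "lp_norm p (P f) \<le> C * lp_norm p f"
    "\<And>n. cint (P f * circle_cnj cZ ^ n) = cint (f * circle_cnj cZ ^ n)" if "f \<in> Lp p" for f
    using someI_ex[OF C(2)[OF that]] that by (auto simp: P_def)
  have PL: "P f \<in> Lp p" if "f \<in> Lp p" for f using P(1)[OF that] by (rule Hp_Lp)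
  have PI: "P f = g" if "f \<in> Lp p" "g \<in> Hp p" "\<And>n. cint (g * circle_cnj cZ ^ n) = cint (f * circle_cnj cZ ^ n)" for f g
    using P[OF that(1)] that by (intro Hp_eqI[OF p]) auto
  have add: "P (f + g) = P f + P g" if "f \<in> Lp p" "g \<in> Lp p" for f g
    using that P p1 PL by (intro PI) (auto intro!: Lp_add Hp_add simp: distrib_right cint_add Lp_Linf_L1)
  have scale: "P (circle_const c * f) = circle_const c * P f" if "f \<in> Lp p" for f c
    using that P p1 PL by (intro PI) (auto intro!: Lp_mult Hp_const_mult simp: mult.assoc cint_const_mult)
  have id: "P f = f" if "f \<in> Hp p" for f
    using that by (intro PI) (auto intro: Hp_Lp)
  have bop: "P \<in> bounded_operators p (Lp p)"
    unfolding bounded_operators_def using P(2) PL add scale by (auto simp: P_def)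
  have im: "P ` Lp p = Hp p"
    using P(1) id by (force intro: Hp_Lp simp: image_iff)
  have idem: "P (P f) = P f" if "f \<in> Lp p" for f
    using id P(1)[OF that] by blast
  have kill: "P (circle_cnj g) = 0" if "g \<in> Hp0 p" for g
  proof (rule PI)
    show "circle_cnj g \<in> Lp p" using that by (intro Lp_cnj Hp_Lp Hp0_Hp)
    show "0 \<in> Hp p" by (simp add: Hp_iff)
  qed (simp add: cint_cnj_Hp0[OF that])
  have "riesz_projection p = P"
    unfolding riesz_projection_def
  proof (rule the_equality)
    show "P \<in> bounded_operators p (Lp p) \<and> P ` Lp p = Hp p \<and> (\<forall>f\<in>Lp p. P (P f) = P f) \<and> (\<forall>g\<in>Hp0 p. P (circle_cnj g) = 0)"
      using bop im idem kill by blast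
    fix P' assume P': "P' \<in> bounded_operators p (Lp p) \<and> P' ` Lp p = Hp p \<and> (\<forall>f\<in>Lp p. P' (P' f) = P' f) \<and> (\<forall>g\<in>Hp0 p. P' (circle_cnj g) = 0)"
    show "P' = P"
    proof (rule extensionalityI[of _ "Lp p"])
      show "P' \<in> extensional (Lp p)" using P' by (auto simp: bounded_operators_def PiE_def)
      show "P \<in> extensional (Lp p)" by (simp add: P_def)
      fix f assume f: "f \<in> Lp p"
      have u: "circle_cnj (f - P f) \<in> Hp0 p" using P[OF f] by (intro Hp_minus_cnj_Hp0[OF p f]) auto
      have "P' (P f + circle_cnj (circle_cnj (f - P f))) = P' (P f) + P' (circle_cnj (circle_cnj (f - P f)))"
        using P' PL[OF f] u Lp_cnj[OF Hp_Lp[OF Hp0_Hp[OF u]]] unfolding bounded_operators_def by blast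
      also have "P' (circle_cnj (circle_cnj (f - P f))) = 0" using P' u by blast
      \<comment> \<open>A projection acts as the identity on its image, and the image of P' is
        \<open>Hp p\<close>.\<close>
      also have "P' (P f) = P f" using P' P(1)[OF f] by (metis imageE)
      finally show "P' f = P f" by simp
    qed
  qed
  then show "riesz_projection p \<in> bounded_operators p (Lp p)"
    "f \<in> Lp p \<Longrightarrow> riesz_projection p f \<in> Hp p"
    "f \<in> Lp p \<Longrightarrow> cint (riesz_projection p f * circle_cnj cZ ^ n) = cint (f * circle_cnj cZ ^ n)"
    using bop P by auto
qed

context
  fixes p :: real
  assumes p: "1 < p"
begin

lemma exponent_bounds: "p \<ge> 1" "p \<ge> 0" "p > 0" using p by auto

lemma riesz_projection_Hp: "f \<in> Lp p \<Longrightarrow> riesz_projection p f \<in> Hp p"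
  using riesz_projection_characterization[OF p] by blast

lemma riesz_projection_Lp: "f \<in> Lp p \<Longrightarrow> riesz_projection p f \<in> Lp p"
  using riesz_projection_Hp Hp_Lp by blast

lemma riesz_projection_coeff: "f \<in> Lp p \<Longrightarrow> cint (riesz_projection p f * circle_cnj cZ ^ n) = cint (f * circle_cnj cZ ^ n)"
  using riesz_projection_characterization[OF p] by blast

lemma riesz_projection_eqI: "f \<in> Lp p \<Longrightarrow> g \<in> Hp p \<Longrightarrow> (\<And>n. cint (g * circle_cnj cZ ^ n) = cint (f * circle_cnj cZ ^ n)) \<Longrightarrow> riesz_projection p f = g"
  using riesz_projection_Hp riesz_projection_coeff by (intro Hp_eqI[OF p]) auto

lemma riesz_projection_add: "f \<in> Lp p \<Longrightarrow> g \<in> Lp p \<Longrightarrow> riesz_projection p (f + g) = riesz_projection p f + riesz_projection p g"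
  using riesz_projection_characterization(1)[OF p] by (auto simp: bounded_operators_def)

lemma riesz_projection_scale: "f \<in> Lp p \<Longrightarrow> riesz_projection p (circle_const c * f) = circle_const c * riesz_projection p f"
  using riesz_projection_characterization(1)[OF p] by (auto simp: bounded_operators_def)

lemma riesz_projection_bounded: "\<exists>C\<ge>0. \<forall>f\<in>Lp p. lp_norm p (riesz_projection p f) \<le> C * lp_norm p f"
proof -
  obtain C where C: "\<And>f. f \<in> Lp p \<Longrightarrow> lp_norm p (riesz_projection p f) \<le> C * lp_norm p f"
    using riesz_projection_characterization(1)[OF p] unfolding bounded_operators_def by blast
  have "lp_norm p (riesz_projection p f) \<le> max C 0 * lp_norm p f" if "f \<in> Lp p" for f
    using C[OF that] mult_right_mono[OF max.cobounded1[of C 0] lp_norm_nonneg[of p f]] by linarith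
  then show ?thesis by (intro exI[of _ "max C 0"]) auto
qed

lemma riesz_projection_id: "f \<in> Hp p \<Longrightarrow> riesz_projection p f = f"
  by (rule riesz_projection_eqI) (auto intro: Hp_Lp)

lemma riesz_projection_cnj_Hp0: "g \<in> Hp0 p \<Longrightarrow> riesz_projection p (circle_cnj g) = 0"
  by (rule riesz_projection_eqI) (auto simp: cint_cnj_Hp0 Hp_iff intro: Lp_cnj Hp_Lp Hp0_Hp)

lemma riesz_projection_complement: "f \<in> Lp p \<Longrightarrow> circle_cnj (f - riesz_projection p f) \<in> Hp0 p"
  using riesz_projection_Hp riesz_projection_coeff by (intro Hp_minus_cnj_Hp0[OF p]) auto

lemma Lp_cnj_Hinf_mult: "\<phi> \<in> Hinf \<Longrightarrow> f \<in> Lp p \<Longrightarrow> circle_cnj \<phi> * f \<in> Lp p"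
  by (intro Lp_mult exponent_bounds Linf_cnj Hinf_Linf)

text \<open>Multiplication by the conjugate of \<open>\<phi>\<close> preserves the conjugates of \<open>Hp0 p\<close>, so the inner projection can be dropped.\<close>

lemma riesz_projection_cnj_Hinf_absorb:
  assumes \<phi>: "\<phi> \<in> Hinf" and f: "f \<in> Lp p"
  shows "riesz_projection p (circle_cnj \<phi> * riesz_projection p f) = riesz_projection p (circle_cnj \<phi> * f)"
proof -
  have u: "\<phi> * circle_cnj (f - riesz_projection p f) \<in> Hp0 p" by (rule Hinf_mult_Hp0[OF p \<phi> riesz_projection_complement[OF f]])
  have "circle_cnj \<phi> * f = circle_cnj \<phi> * riesz_projection p f + circle_cnj (\<phi> * circle_cnj (f - riesz_projection p f))"
    by (simp add: algebra_simps)
  then have "riesz_projection p (circle_cnj \<phi> * f) = riesz_projection p (circle_cnj \<phi> * riesz_projection p f) + riesz_projection p (circle_cnj (\<phi> * circle_cnj (f - riesz_projection p f)))"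
    using riesz_projection_add[of "circle_cnj \<phi> * riesz_projection p f" "circle_cnj (\<phi> * circle_cnj (f - riesz_projection p f))"] Lp_cnj_Hinf_mult[OF \<phi> riesz_projection_Lp[OF f]]
      Lp_cnj[OF Hp_Lp[OF Hp0_Hp[OF u]]] by simp
  then show ?thesis using riesz_projection_cnj_Hp0[OF u] by simp
qed

text \<open>The part of f killed by the projection is conj u with u in \<open>Hp0 p\<close>, and its
  pairing with conj \<phi> is the conjugate of the mean of u \<phi>, which is 0.\<close>

lemma cint_riesz_projection_mult_cnj_Hinf:
  assumes f: "f \<in> Lp p" and \<phi>: "\<phi> \<in> Hinf"
  shows "cint (riesz_projection p f * circle_cnj \<phi>) = cint (f * circle_cnj \<phi>)"
proof -
  have "cint (circle_cnj (f - riesz_projection p f) * \<phi>) = 0" by (rule cint_Hp0_mult_Hinf[OF p riesz_projection_complement[OF f] \<phi>])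
  then have "cint ((f - riesz_projection p f) * circle_cnj \<phi>) = 0"
    using cint_cnj[of "circle_cnj (f - riesz_projection p f) * \<phi>"] by simp
  then show ?thesis
    using f riesz_projection_Lp[OF f] \<phi> exponent_bounds by (simp add: left_diff_distrib cint_diff Lp_Linf_L1 Linf_cnj Hinf_Linf)
qed

section \<open>The disc extension and the backward shift\<close>

lemma fourier_coeff_bounded: "f \<in> Lp p \<Longrightarrow> \<exists>B. \<forall>n. cmod (cint (f * circle_cnj cZ ^ n)) \<le> B"
proof -
  assume f: "f \<in> Lp p"
  define q where "q = p / (p - 1)"
  note pq = Hp_conjugate_exponent[OF p, folded q_def]
  have "cmod (cint (f * circle_cnj cZ ^ n)) \<le> lp_norm p f * 1" for n
  proof -
    have "cmod (cint (f * circle_cnj cZ ^ n)) \<le> lp_norm p f * lp_norm q (circle_cnj cZ ^ n)"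
      using Lp_Holder(2)[OF p pq f Linf_Lp[OF cZ_power_Linf(2)]] pq by simp
    also have "lp_norm q (circle_cnj cZ ^ n) = lp_norm q (cZ ^ n)"
      using lp_norm_cnj[of q "cZ ^ n"] by simp
    also have "lp_norm q (cZ ^ n) \<le> 1"
    proof -
      have "pmass q (\<lambda>\<zeta>. \<zeta> ^ n) \<le> 1 powr q"
        using pq by (intro pmass_bounded AE_circleI) (auto simp: norm_power)
      then have "pmass q (\<lambda>\<zeta>. \<zeta> ^ n) powr (1/q) \<le> 1" using pq by (intro powr_le1) auto
      then show ?thesis by (simp add: cZ_power abs_circle_lp_norm)
    qed
    finally show ?thesis by (simp add: mult_left_mono)
  qed
  then show ?thesis by blast
qed

lemma disc_ext_sums:
  assumes f: "f \<in> Lp p" and z: "cmod z < 1"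
  shows "(\<lambda>n. cint (f * circle_cnj cZ ^ n) * z ^ n) sums disc_ext f z"
proof -
  obtain B where B: "\<And>n. cmod (cint (f * circle_cnj cZ ^ n)) \<le> B" using fourier_coeff_bounded[OF f] by blast
  have "summable (\<lambda>n. cint (f * circle_cnj cZ ^ n) * z ^ n)"
  proof (rule summable_comparison_test')
    show "summable (\<lambda>n. B * cmod z ^ n)" using z by (intro summable_mult summable_geometric) simp
    show "norm (cint (f * circle_cnj cZ ^ n) * z ^ n) \<le> B * cmod z ^ n" for n
      using B[of n] by (simp add: norm_mult norm_power mult_right_mono)
  qed
  then show ?thesis by (simp add: disc_ext_def fourier_coeff_nonneg summable_sums)
qed

text \<open>Identity theorem for power series: the zeros of a nonzero one are isolated, whereas the
  two extensions agree on the whole punctured disc.\<close>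

lemma disc_ext_eq_coeff:
  assumes f: "f \<in> Lp p" and g: "g \<in> Lp p" and eq: "\<And>z. z \<in> ball 0 1 - {0} \<Longrightarrow> disc_ext f z = disc_ext g z"
  shows "cint (f * circle_cnj cZ ^ n) = cint (g * circle_cnj cZ ^ n)"
proof (rule ccontr)
  assume ne: "cint (f * circle_cnj cZ ^ n) \<noteq> cint (g * circle_cnj cZ ^ n)"
  \<comment> \<open>The difference is multiplied by z, which moves its coefficients up by one:
    \<open>powser_0_nonzero\<close> asks for a function vanishing at the centre and a nonzero
    coefficient of positive index.\<close>
  define a where "a k = (case k of 0 \<Rightarrow> 0 | Suc m \<Rightarrow> cint (f * circle_cnj cZ ^ m) - cint (g * circle_cnj cZ ^ m))" for k
  define F where "F z = z * (disc_ext f z - disc_ext g z)" for z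
  have "(\<lambda>k. a k * (z - 0) ^ k) sums F z" if "norm (z - 0) < 1" for z
  proof -
    have "(\<lambda>m. z * (cint (f * circle_cnj cZ ^ m) * z ^ m - cint (g * circle_cnj cZ ^ m) * z ^ m)) sums F z"
      unfolding F_def using that by (intro sums_mult sums_diff disc_ext_sums f g) auto
    then have "(\<lambda>m. a (Suc m) * z ^ Suc m) sums F z" by (simp add: a_def algebra_simps)
    then show ?thesis using sums_Suc_iff[of "\<lambda>k. a k * z ^ k" "F z"] by (simp add: a_def)
  qed
  moreover have "F 0 = 0" by (simp add: F_def)
  moreover have "a (Suc n) \<noteq> 0" using ne by (simp add: a_def)
  ultimately obtain s where s: "0 < s" "\<And>z. z \<in> cball 0 s - {0} \<Longrightarrow> F z \<noteq> 0"
    using powser_0_nonzero[where r = 1 and \<xi> = 0 and a = a and f = F and m = "Suc n"] by auto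
  define z where "z = complex_of_real (min s (1/2))"
  have "z \<in> cball 0 s - {0}" "z \<in> ball 0 1 - {0}" using s(1) by (auto simp: z_def)
  then show False using s(2)[of z] eq[of z] by (simp add: F_def)
qed

lemma cnj_cZ_Lp: "f \<in> Lp p \<Longrightarrow> circle_cnj cZ * f \<in> Lp p"
  by (rule Lp_cnj_Hinf_mult) auto

text \<open>On both sides the n-th coefficient is that of f with index n + 1, since subtracting f(0)
  and dividing by z drops the constant term and shifts the rest. The backward shift thus becomes the
  Toeplitz operator with symbol conj z and obeys the rules for the projection.\<close>

lemma backward_shift_eq:
  assumes f: "f \<in> Hp p"
  shows "backward_shift p f = riesz_projection p (circle_cnj cZ * f)"
proof -
  have fL: "f \<in> Lp p" using f by (rule Hp_Lp)
  define g where "g = riesz_projection p (circle_cnj cZ * f)"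
  have gH: "g \<in> Hp p" unfolding g_def by (intro riesz_projection_Hp cnj_cZ_Lp fL)
  have gc: "cint (g * circle_cnj cZ ^ n) = cint (f * circle_cnj cZ ^ Suc n)" for n
    unfolding g_def using riesz_projection_coeff[OF cnj_cZ_Lp[OF fL], of n] by (simp add: mult_ac)
  have gd: "disc_ext g z = (disc_ext f z - disc_ext f 0) / z" if z: "z \<in> ball 0 1 - {0}" for z
  proof -
    have "(\<lambda>n. cint (f * circle_cnj cZ ^ Suc n) * z ^ Suc n) sums (disc_ext f z - disc_ext f 0)"
      using disc_ext_sums[OF fL, of z] z sums_Suc_iff[of "\<lambda>n. cint (f * circle_cnj cZ ^ n) * z ^ n"] by (simp add: disc_ext_0)
    then have "(\<lambda>n. cint (f * circle_cnj cZ ^ Suc n) * z ^ Suc n / z) sums ((disc_ext f z - disc_ext f 0) / z)"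
      by (rule sums_divide)
    then have "(\<lambda>n. cint (g * circle_cnj cZ ^ n) * z ^ n) sums ((disc_ext f z - disc_ext f 0) / z)"
      using z by (simp add: gc)
    then show ?thesis using disc_ext_sums[OF Hp_Lp[OF gH], of z] z by (auto intro: sums_unique2)
  qed
  show ?thesis unfolding backward_shift_def g_def[symmetric]
  proof (rule the_equality)
    show "g \<in> Hp p \<and> (\<forall>z\<in>ball 0 1 - {0}. disc_ext g z = (disc_ext f z - disc_ext f 0) / z)" using gH gd by blast
    fix h assume h: "h \<in> Hp p \<and> (\<forall>z\<in>ball 0 1 - {0}. disc_ext h z = (disc_ext f z - disc_ext f 0) / z)"
    show "h = g"
    proof (rule Hp_eqI[OF p])
      show "h \<in> Hp p" "g \<in> Hp p" using h gH by auto
      show "cint (h * circle_cnj cZ ^ n) = cint (g * circle_cnj cZ ^ n)" for n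
        using h gd gH by (intro disc_ext_eq_coeff) (auto simp: Hp_Lp)
    qed
  qed
qed

end

section \<open>The dual of \<open>L\<^sup>1\<close>\<close>

text \<open>Zorn's lemma gives a maximal dominated graph, and a one-dimensional extension shows that
  its domain is V. Everything is relative to a subspace V because \<open>q\<close> is assumed
  sublinear only there; in the application V is L^1 inside the space of all classes.\<close>

lemma Hahn_Banach_dominated:
  fixes q :: "'a::real_vector \<Rightarrow> real"
  assumes M: "subspace M" and V: "subspace V" and MV: "M \<subseteq> V"
    and q_add: "\<And>x y. x \<in> V \<Longrightarrow> y \<in> V \<Longrightarrow> q (x + y) \<le> q x + q y"
    and q_scale: "\<And>x t. x \<in> V \<Longrightarrow> t \<ge> 0 \<Longrightarrow> q (t *\<^sub>R x) = t * q x"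
    and l_add: "\<And>x y. x \<in> M \<Longrightarrow> y \<in> M \<Longrightarrow> l (x + y) = l x + l y"
    and l_scale: "\<And>x t. x \<in> M \<Longrightarrow> l (t *\<^sub>R x) = t * l x"
    and l_le: "\<And>x. x \<in> M \<Longrightarrow> l x \<le> q x"
  obtains L where "\<And>x y. x \<in> V \<Longrightarrow> y \<in> V \<Longrightarrow> L (x + y) = L x + L y"
    "\<And>x t. x \<in> V \<Longrightarrow> L (t *\<^sub>R x) = t * L x"
    "\<And>x. x \<in> M \<Longrightarrow> L x = l x" "\<And>x. x \<in> V \<Longrightarrow> L x \<le> q x"
proof -
  \<comment> \<open>Extensions are represented by their graphs; a dominated subspace of \<open>V \<times> \<real>\<close> is automatically single-valued.\<close>
  define \<G> where "\<G> = {G :: ('a \<times> real) set. subspace G \<and> (\<lambda>x. (x, l x)) ` M \<subseteq> G \<and> (\<forall>(x, y)\<in>G. x \<in> V \<and> y \<le> q x)}"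
  have q0: "q 0 = 0" using q_scale[of 0 0] V by (simp add: subspace_0)
  have "subspace ((\<lambda>x. (x, l x)) ` M)"
  proof (rule subspaceI)
    have "l 0 = 0" using l_scale[of 0 0] M by (simp add: subspace_0)
    then show "0 \<in> (\<lambda>x. (x, l x)) ` M" using M by (auto simp: zero_prod_def subspace_0 intro!: image_eqI[of _ _ 0])
  next
    fix u v assume "u \<in> (\<lambda>x. (x, l x)) ` M" "v \<in> (\<lambda>x. (x, l x)) ` M"
    then show "u + v \<in> (\<lambda>x. (x, l x)) ` M" using M by (auto simp: l_add subspace_add intro!: image_eqI)
  next
    fix c u assume "u \<in> (\<lambda>x. (x, l x)) ` M"
    then show "c *\<^sub>R u \<in> (\<lambda>x. (x, l x)) ` M" using M by (auto simp: l_scale subspace_scale intro!: image_eqI)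
  qed
  then have ne: "\<G> \<noteq> {}" unfolding \<G>_def using MV l_le by (auto intro!: exI[of _ "(\<lambda>x. (x, l x)) ` M"])
  have chain: "\<Union>\<C> \<in> \<G>" if "\<C> \<noteq> {}" "subset.chain \<G> \<C>" for \<C>
  proof -
    have sub: "\<C> \<subseteq> \<G>" and tot: "\<And>X Y. X \<in> \<C> \<Longrightarrow> Y \<in> \<C> \<Longrightarrow> X \<subseteq> Y \<or> Y \<subseteq> X"
      using that(2) by (auto simp: subset_chain_def)
    have ss: "subspace X" if "X \<in> \<C>" for X using sub that by (auto simp: \<G>_def)
    have "subspace (\<Union>\<C>)"
    proof (rule subspaceI)
      show "0 \<in> \<Union>\<C>" using that(1) ss subspace_0 by blast
      fix u v assume "u \<in> \<Union>\<C>" "v \<in> \<Union>\<C>"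
      then obtain X Y where XY: "X \<in> \<C>" "u \<in> X" "Y \<in> \<C>" "v \<in> Y" by blast
      then obtain Z where "Z \<in> \<C>" "u \<in> Z" "v \<in> Z" using tot[of X Y] by blast
      then show "u + v \<in> \<Union>\<C>" using ss subspace_add by blast
    next
      fix c u assume "u \<in> \<Union>\<C>"
      then show "c *\<^sub>R u \<in> \<Union>\<C>" using ss subspace_scale by blast
    qed
    then show ?thesis using sub that(1) unfolding \<G>_def by blast
  qed
  obtain G where G: "G \<in> \<G>" "\<And>X. X \<in> \<G> \<Longrightarrow> G \<subseteq> X \<Longrightarrow> X = G"
    using subset_Zorn_nonempty[OF ne chain] by blast
  have Gs: "subspace G" and Gl: "\<And>x. x \<in> M \<Longrightarrow> (x, l x) \<in> G" and GV: "\<And>x y. (x, y) \<in> G \<Longrightarrow> x \<in> V"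
    and Gq: "\<And>x y. (x, y) \<in> G \<Longrightarrow> y \<le> q x" using G(1) by (auto simp: \<G>_def)
  have Gadd: "(x + x', y + y') \<in> G" if "(x, y) \<in> G" "(x', y') \<in> G" for x x' y y'
    using subspace_add[OF Gs that] by simp
  have Gscale: "(c *\<^sub>R x, c * y) \<in> G" if "(x, y) \<in> G" for c x y
    using subspace_scale[OF Gs that, of c] by simp
  have uniq: "y = y'" if "(x, y) \<in> G" "(x, y') \<in> G" for x y y'
  proof -
    \<comment> \<open>Both differences lie over the point 0 and are therefore at most q 0 =
      0.\<close>
    have "(0, y - y') \<in> G" "(0, y' - y) \<in> G"
      using subspace_diff[OF Gs that(1) that(2)] subspace_diff[OF Gs that(2) that(1)] by auto
    then show ?thesis using Gq[of 0 "y - y'"] Gq[of 0 "y' - y"] q0 by simp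
  qed
  have dom: "\<exists>y. (x0, y) \<in> G" if x0: "x0 \<in> V" for x0
  proof -
    \<comment> \<open>The value c at x0 must lie between all y - q (x - x0) and all q (x + x0) - y.
      Subadditivity makes every lower bound at most every upper one, and c is the supremum of the
      lower bounds.\<close>
    define S where "S = {y - q (x - x0) |x y. (x, y) \<in> G}"
    have bound: "y - q (x - x0) \<le> q (x' + x0) - y'" if "(x, y) \<in> G" "(x', y') \<in> G" for x y x' y'
    proof -
      have "y + y' \<le> q (x + x')" using Gq[OF Gadd[OF that]] .
      also have "q (x + x') = q ((x - x0) + (x' + x0))" by (simp add: algebra_simps)
      also have "\<dots> \<le> q (x - x0) + q (x' + x0)"
        by (intro q_add subspace_diff[OF V] subspace_add[OF V] GV[OF that(1)] GV[OF that(2)] x0)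
      finally show ?thesis by simp
    qed
    have G00: "(0, 0) \<in> G" using subspace_0[OF Gs] by (simp add: zero_prod_def)
    have Sne: "S \<noteq> {}" using G00 by (auto simp: S_def)
    have Sb: "bdd_above S" using bound[OF _ G00] by (auto simp: S_def bdd_above_def)
    define c where "c = Sup S"
    have c1: "y - q (x - x0) \<le> c" if "(x, y) \<in> G" for x y
      unfolding c_def using that by (intro cSup_upper[OF _ Sb]) (auto simp: S_def)
    have c2: "c \<le> q (x + x0) - y" if "(x, y) \<in> G" for x y
      unfolding c_def using bound that by (intro cSup_least[OF Sne]) (auto simp: S_def)
    define G' where "G' = {(x + t *\<^sub>R x0, y + t * c) |x y t. (x, y) \<in> G}"
    have G'I: "(x + t *\<^sub>R x0, y + t * c) \<in> G'" if "(x, y) \<in> G" for x y t using that by (auto simp: G'_def)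
    have "subspace G'"
    proof (rule subspaceI)
      show "0 \<in> G'" using G'I[OF G00, of 0] by (simp add: zero_prod_def)
      fix u v assume "u \<in> G'" "v \<in> G'"
      then obtain x y t x' y' t' where "u = (x + t *\<^sub>R x0, y + t * c)" "(x, y) \<in> G" "v = (x' + t' *\<^sub>R x0, y' + t' * c)" "(x', y') \<in> G"
        by (auto simp: G'_def)
      then show "u + v \<in> G'" using G'I[OF Gadd, of x y x' y' "t + t'"] by (simp add: algebra_simps)
    next
      fix a u assume "u \<in> G'"
      then obtain x y t where "u = (x + t *\<^sub>R x0, y + t * c)" "(x, y) \<in> G" by (auto simp: G'_def)
      then show "a *\<^sub>R u \<in> G'" using G'I[OF Gscale[of x y a], of "a * t"] by (simp add: algebra_simps)
    qed
    have dom': "x + t *\<^sub>R x0 \<in> V \<and> y + t * c \<le> q (x + t *\<^sub>R x0)" if xy: "(x, y) \<in> G" for x y t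
    proof
      show "x + t *\<^sub>R x0 \<in> V" by (intro subspace_add[OF V] subspace_scale[OF V] GV[OF xy] x0)
      \<comment> \<open>By homogeneity the nonzero cases reduce to t = 1 and t = -1, which are the
        two bounds on c.\<close>
      consider "t = 0" | "t > 0" | "t < 0" by linarith
      then show "y + t * c \<le> q (x + t *\<^sub>R x0)"
      proof cases
        case 1
        then show ?thesis using Gq[OF xy] by simp
      next
        case 2
        have g: "((1/t) *\<^sub>R x, (1/t) * y) \<in> G" by (rule Gscale[OF xy])
        have "q (t *\<^sub>R ((1/t) *\<^sub>R x + x0)) = t * q ((1/t) *\<^sub>R x + x0)"
          using 2 by (intro q_scale subspace_add[OF V] GV[OF g] x0) simp
        moreover have "t *\<^sub>R ((1/t) *\<^sub>R x + x0) = x + t *\<^sub>R x0" using 2 by (simp add: scaleR_right_distrib)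
        ultimately have "q (x + t *\<^sub>R x0) = t * q ((1/t) *\<^sub>R x + x0)" by simp
        moreover have "t * c \<le> t * (q ((1/t) *\<^sub>R x + x0) - (1/t) * y)" using c2[OF g] 2 by (intro mult_left_mono) auto
        ultimately show ?thesis using 2 by (simp add: right_diff_distrib)
      next
        case 3
        define s where "s = - t"
        have s: "s > 0" "t = - s" using 3 by (auto simp: s_def)
        have g: "((1/s) *\<^sub>R x, (1/s) * y) \<in> G" by (rule Gscale[OF xy])
        have "q (s *\<^sub>R ((1/s) *\<^sub>R x - x0)) = s * q ((1/s) *\<^sub>R x - x0)"
          using s by (intro q_scale subspace_diff[OF V] GV[OF g] x0) simp
        moreover have "s *\<^sub>R ((1/s) *\<^sub>R x - x0) = x + t *\<^sub>R x0" using s by (simp add: scaleR_right_diff_distrib)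
        ultimately have "q (x + t *\<^sub>R x0) = s * q ((1/s) *\<^sub>R x - x0)" by simp
        moreover have "s * ((1/s) * y - q ((1/s) *\<^sub>R x - x0)) \<le> s * c" using c1[OF g] s by (intro mult_left_mono) auto
        ultimately show ?thesis using s by (simp add: right_diff_distrib)
      qed
    qed
    have GG': "G \<subseteq> G'" using G'I[of _ _ 0] by auto
    have "G' \<in> \<G>" unfolding \<G>_def
    proof (intro CollectI conjI)
      show "subspace G'" by fact
      show "(\<lambda>x. (x, l x)) ` M \<subseteq> G'" using Gl GG' by blast
      show "\<forall>(x, y)\<in>G'. x \<in> V \<and> y \<le> q x" using dom' by (auto simp: G'_def)
    qed
    then have "G' = G" using G(2) GG' by blast
    moreover have "(x0, c) \<in> G'" using G'I[OF G00, of 1] by simp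
    ultimately show ?thesis by blast
  qed
  define L where "L x = (THE y. (x, y) \<in> G)" for x
  have LG: "(x, L x) \<in> G" if "x \<in> V" for x
    unfolding L_def using dom[OF that] uniq by (rule_tac theI') blast
  have Leq: "L x = y" if "(x, y) \<in> G" for x y using uniq[OF LG[OF GV[OF that]] that] .
  show thesis
  proof (rule that)
    show "L (x + y) = L x + L y" if "x \<in> V" "y \<in> V" for x y using Leq[OF Gadd[OF LG LG]] that by simp
    show "L (t *\<^sub>R x) = t * L x" if "x \<in> V" for x t using Leq[OF Gscale[OF LG]] that by simp
    show "L x = l x" if "x \<in> M" for x using Leq[OF Gl[OF that]] .
    show "L x \<le> q x" if "x \<in> V" for x using Gq[OF LG[OF that]] .
  qed
qed

text \<open>Adding C times the measure makes the set function T (indicator E) nonnegative, so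
  Radon-Nikodym for positive measures applies; subtracting C from the density gives
  \<open>a\<close>. The bounds 0 <= m E <= 2 C measure E turn into |a| <= C, and the values on
  indicators determine T by linearity and continuity.\<close>

lemma (in finite_measure) L1_functional_density:
  fixes T :: "('a \<Rightarrow> real) \<Rightarrow> real"
  assumes add: "\<And>u v. integrable M u \<Longrightarrow> integrable M v \<Longrightarrow> T (\<lambda>x. u x + v x) = T u + T v"
    and scale: "\<And>u c. integrable M u \<Longrightarrow> T (\<lambda>x. c * u x) = c * T u"
    and bound: "\<And>u. integrable M u \<Longrightarrow> \<bar>T u\<bar> \<le> C * (\<integral>x. \<bar>u x\<bar> \<partial>M)"
  obtains a where "a \<in> borel_measurable M" "AE x in M. \<bar>a x\<bar> \<le> C" "\<And>u. integrable M u \<Longrightarrow> T u = (\<integral>x. u x * a x \<partial>M)"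
proof -
  have ind: "integrable M (indicator E :: 'a \<Rightarrow> real)" if "E \<in> sets M" for E
    using that by (intro integrable_const_bound[where B = 1]) auto
  define m where "m E = T (indicator E) + C * measure M E" for E
  have T0: "T (\<lambda>x. 0) = 0" using scale[of "\<lambda>x. 0" 0] by simp
  have m_bound: "0 \<le> m E" "m E \<le> 2 * C * measure M E" if E: "E \<in> sets M" for E
    using bound[OF ind[OF E]] E by (auto simp: m_def)
  have Tsum: "T (\<lambda>x. \<Sum>i<n. indicator (A i) x) = (\<Sum>i<n. T (indicator (A i)))" if "\<And>i. A i \<in> sets M" for A and n :: nat
    by (induction n) (simp_all add: T0 add ind that)
  have m_sums: "(\<lambda>i. m (A i)) sums m (\<Union>i. A i)" if A: "range A \<subseteq> sets M" "disjoint_family A" for A :: "nat \<Rightarrow> 'a set"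
  proof -
    have As: "A i \<in> sets M" for i using A by auto
    define U where "U = (\<Union>i. A i)"
    have Us: "U \<in> sets M" using As by (auto simp: U_def)
    have ms: "(\<lambda>i. measure M (A i)) sums measure M U" unfolding U_def by (rule finite_measure_UNION[OF A])
    \<comment> \<open>For countable additivity: T is additive on finite sums, and on the remainder
      it is at most C times a measure tending to 0.\<close>
    define R where "R n = U - (\<Union>i<n. A i)" for n
    have Rs: "R n \<in> sets M" for n using Us As by (auto simp: R_def)
    have dec: "indicator U x = (\<Sum>i<n. indicator (A i) x) + (indicator (R n) x :: real)" for n x
    proof -
      have "(\<Sum>i<n. indicator (A i) x) = (indicator (\<Union>i<n. A i) x :: real)"
        using A(2) by (intro indicator_UN_disjoint[symmetric]) (auto simp: disjoint_family_on_def)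
      then show ?thesis by (auto simp: R_def U_def indicator_def)
    qed
    have TU: "T (indicator U) = (\<Sum>i<n. T (indicator (A i))) + T (indicator (R n))" for n
    proof -
      have "(indicator U :: 'a \<Rightarrow> real) = (\<lambda>x. (\<Sum>i<n. indicator (A i) x) + indicator (R n) x)" using dec by auto
      then have "T (indicator U) = T (\<lambda>x. \<Sum>i<n. indicator (A i) x) + T (indicator (R n))"
        using add[of "\<lambda>x. \<Sum>i<n. indicator (A i) x" "indicator (R n)"] ind As Rs by simp
      then show ?thesis using Tsum[OF As] by simp
    qed
    have "measure M (R n) = measure M U - (\<Sum>i<n. measure M (A i))" for n
    proof -
      have "measure M (\<Union>i<n. A i) = (\<Sum>i<n. measure M (A i))"
        using As A(2) by (intro finite_measure_finite_Union) (auto simp: disjoint_family_on_def)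
      moreover have "measure M (R n) = measure M U - measure M (\<Union>i<n. A i)"
        unfolding R_def using As Us by (intro finite_measure_Diff) (auto simp: U_def)
      ultimately show ?thesis by simp
    qed
    then have Rlim: "(\<lambda>n. measure M (R n)) \<longlonglongrightarrow> 0"
      using tendsto_diff[OF tendsto_const[of "measure M U"] ms[unfolded sums_def]] by simp
    have "(\<lambda>n. T (indicator (R n))) \<longlonglongrightarrow> 0"
    proof (rule tendsto_rabs_zero_cancel, rule tendsto_sandwich[OF _ _ tendsto_const])
      show "(\<lambda>n. C * measure M (R n)) \<longlonglongrightarrow> 0" using tendsto_mult_right_zero[OF Rlim] .
      show "\<forall>\<^sub>F n in sequentially. \<bar>T (indicator (R n))\<bar> \<le> C * measure M (R n)"
        using bound[OF ind[OF Rs]] Rs by simp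
    qed auto
    then have "(\<lambda>n. T (indicator U) - T (indicator (R n))) \<longlonglongrightarrow> T (indicator U) - 0"
      by (intro tendsto_intros)
    moreover have "T (indicator U) - T (indicator (R n)) = (\<Sum>i<n. T (indicator (A i)))" for n using TU[of n] by simp
    ultimately have "(\<lambda>i. T (indicator (A i))) sums T (indicator U)" by (simp add: sums_def)
    then have "(\<lambda>i. T (indicator (A i)) + C * measure M (A i)) sums (T (indicator U) + C * measure M U)"
      by (intro sums_add sums_mult ms)
    then show ?thesis by (simp add: m_def U_def)
  qed
  define N where "N = measure_of (space M) (sets M) (\<lambda>E. ennreal (m E))"
  have N_sets [simp]: "sets N = sets M" by (simp add: N_def)
  have N_em: "emeasure N E = ennreal (m E)" if E: "E \<in> sets M" for E
    unfolding N_def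
  proof (rule emeasure_measure_of_sigma[OF sets.sigma_algebra_axioms _ _ E])
    show "positive (sets M) (\<lambda>E. ennreal (m E))"
      using m_bound(2)[of "{}"] by (simp add: positive_def ennreal_neg)
    show "countably_additive (sets M) (\<lambda>E. ennreal (m E))"
      unfolding countably_additive_def
    proof (intro allI impI)
      fix A :: "nat \<Rightarrow> 'a set" assume A: "range A \<subseteq> sets M" "disjoint_family A"
      then have "\<And>i. 0 \<le> m (A i)" using m_bound by auto
      then show "(\<Sum>i. ennreal (m (A i))) = ennreal (m (\<Union>i. A i))" by (rule suminf_ennreal_eq) (rule m_sums[OF A])
    qed
  qed
  have "absolutely_continuous M N"
    unfolding absolutely_continuous_def
  proof
    fix E assume "E \<in> null_sets M"
    then have "E \<in> sets M" "measure M E = 0" by (auto simp: null_sets_def measure_def)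
    then show "E \<in> null_sets N" using m_bound[of E] N_em[of E] by (auto simp: null_sets_def ennreal_neg)
  qed
  then obtain f where fm [measurable]: "f \<in> borel_measurable M" and f: "density M f = N"
    using Radon_Nikodym[of N] by auto
  have fint: "(\<integral>\<^sup>+x. f x * indicator E x \<partial>M) = ennreal (m E)" if "E \<in> sets M" for E
    using emeasure_density[OF fm that] N_em[OF that] by (simp add: f)
  have "(\<integral>\<^sup>+x. f x \<partial>M) = ennreal (m (space M))"
    using fint[of "space M"] by (simp cong: nn_integral_cong)
  then have "AE x in M. f x \<noteq> \<infinity>" by (intro nn_integral_PInf_AE) auto
  define g where "g x = enn2real (f x)" for x
  have gf: "AE x in M. ennreal (g x) = f x"
    using \<open>AE x in M. f x \<noteq> \<infinity>\<close> by eventually_elim (auto simp: g_def less_top)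
  have [measurable]: "g \<in> borel_measurable M" unfolding g_def by measurable
  have gint: "integrable M (\<lambda>x. indicator E x * g x) \<and> (\<integral>x. indicator E x * g x \<partial>M) = m E" if E [measurable]: "E \<in> sets M" for E
  proof -
    have "(\<integral>\<^sup>+x. ennreal (indicator E x * g x) \<partial>M) = (\<integral>\<^sup>+x. f x * indicator E x \<partial>M)"
      by (rule nn_integral_cong_AE) (use gf in \<open>auto elim!: eventually_mono simp: indicator_def\<close>)
    also have "\<dots> = ennreal (m E)" by (rule fint[OF E])
    finally have *: "(\<integral>\<^sup>+x. ennreal (indicator E x * g x) \<partial>M) = ennreal (m E)" .
    show ?thesis
    proof
      show "integrable M (\<lambda>x. indicator E x * g x)"
        by (rule integrableI_nonneg) (use * in \<open>auto simp: g_def\<close>)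
      show "(\<integral>x. indicator E x * g x \<partial>M) = m E"
        by (subst integral_eq_nn_integral) (use * m_bound(1)[OF E] in \<open>auto simp: g_def\<close>)
    qed
  qed
  define a where "a x = g x - C" for x
  have [measurable]: "a \<in> borel_measurable M" unfolding a_def by measurable
  have aint: "(\<integral>x. indicator E x * a x \<partial>M) = T (indicator E)" if E: "E \<in> sets M" for E
    using gint[OF E] ind[OF E] E by (simp add: a_def right_diff_distrib m_def)
  have "AE x in M. a x \<le> C"
  proof -
    \<comment> \<open>On this set a - C > 0, whereas m E <= 2 C measure E makes the integral of a -
      C over it at most 0.\<close>
    define E where "E = {x \<in> space M. a x > C}"
    have E [measurable]: "E \<in> sets M" unfolding E_def by measurable
    have i: "integrable M (\<lambda>x. indicator E x * (a x - C))"
      using gint[OF E] ind[OF E] by (simp add: a_def right_diff_distrib)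
    have "(\<integral>x. indicator E x * (a x - C) \<partial>M) = m E - 2 * C * measure M E"
      using gint[OF E] ind[OF E] E by (simp add: a_def right_diff_distrib)
    also have "\<dots> \<le> 0" using m_bound(2)[OF E] by simp
    finally have "(\<integral>x. indicator E x * (a x - C) \<partial>M) \<le> 0" .
    moreover have nn: "AE x in M. 0 \<le> indicator E x * (a x - C)" by (auto simp: E_def indicator_def)
    ultimately have "(\<integral>x. indicator E x * (a x - C) \<partial>M) = 0" using integral_nonneg_AE[OF nn] by simp
    then have "AE x in M. indicator E x * (a x - C) = 0" using integral_nonneg_eq_0_iff_AE[OF i nn] by simp
    then show ?thesis using AE_space by eventually_elim (auto simp: E_def indicator_def split: if_splits)
  qed
  moreover have "- C \<le> a x" for x by (simp add: a_def g_def)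
  ultimately have ab: "AE x in M. \<bar>a x\<bar> \<le> C" by (auto elim!: eventually_mono simp: abs_le_iff minus_le_iff)
  have ia: "integrable M (\<lambda>x. u x * a x)" if u: "integrable M u" for u
  proof (rule Bochner_Integration.integrable_bound)
    show "integrable M (\<lambda>x. C * u x)" using u by simp
    show "AE x in M. norm (u x * a x) \<le> norm (C * u x)"
      using ab
    proof eventually_elim
      case (elim x)
      then have "\<bar>a x\<bar> * \<bar>u x\<bar> \<le> \<bar>C\<bar> * \<bar>u x\<bar>" by (intro mult_right_mono) auto
      then show ?case by (simp add: abs_mult mult.commute)
    qed
  qed (use u in auto)
  have rep: "T u = (\<integral>x. u x * a x \<partial>M)" if "integrable M u" for u
    using that
  proof (induction rule: integrable_induct)
    case (base A c)
    then show ?case using scale[OF ind, of A c] aint[of A] ind[of A]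
      by (simp add: mult.commute mult.left_commute scaleR_conv_of_real)
  next
    case (add f g)
    show ?case using add.IH add.hyps ia by (simp add: distrib_right assms(1))
  next
    case (lim f s)
    have fa: "integrable M (\<lambda>x. 2 * C * \<bar>f x\<bar>)" using lim by simp
    have "(\<lambda>i. \<integral>x. s i x * a x \<partial>M) \<longlonglongrightarrow> (\<integral>x. f x * a x \<partial>M)"
    proof (rule integral_dominated_convergence[OF _ _ fa])
      show "AE x in M. (\<lambda>i. s i x * a x) \<longlonglongrightarrow> f x * a x" by (intro AE_I2 tendsto_intros lim.hyps(2))
      fix i show "AE x in M. norm (s i x * a x) \<le> 2 * C * \<bar>f x\<bar>"
        using ab AE_space
      proof eventually_elim
        case (elim x)
        have "\<bar>s i x\<bar> * \<bar>a x\<bar> \<le> (2 * \<bar>f x\<bar>) * C" using elim lim.hyps(3)[of x i] by (intro mult_mono) auto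
        then show ?case by (simp add: abs_mult mult_ac)
      qed
    qed (use lim in auto)
    moreover have "(\<lambda>i. T (s i)) \<longlonglongrightarrow> T f"
    proof (rule LIM_zero_cancel, rule tendsto_rabs_zero_cancel)
      have d: "(\<lambda>i. \<integral>x. \<bar>s i x - f x\<bar> \<partial>M) \<longlonglongrightarrow> (\<integral>x. 0 \<partial>M)"
      proof (rule integral_dominated_convergence)
        show "integrable M (\<lambda>x. 3 * \<bar>f x\<bar>)" using lim by simp
        show "AE x in M. (\<lambda>i. \<bar>s i x - f x\<bar>) \<longlonglongrightarrow> 0"
          by (intro AE_I2 tendsto_rabs_zero LIM_zero lim.hyps(2))
        show "AE x in M. norm \<bar>s i x - f x\<bar> \<le> 3 * \<bar>f x\<bar>" for i
          using lim.hyps(3)[of _ i] by (intro AE_I2) fastforce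
      qed (use lim in auto)
      have "T (s i) - T f = T (\<lambda>x. s i x - f x)" for i
      proof -
        have "T (\<lambda>x. s i x + (-1) * f x) = T (s i) + T (\<lambda>x. (-1) * f x)"
          using lim by (intro assms(1)) auto
        then show ?thesis using scale[OF lim.hyps(4), of "-1"] by simp
      qed
      then have le: "\<bar>T (s i) - T f\<bar> \<le> C * (\<integral>x. \<bar>s i x - f x\<bar> \<partial>M)" for i
        using bound[of "\<lambda>x. s i x - f x"] lim by simp
      have "(\<lambda>i. C * (\<integral>x. \<bar>s i x - f x\<bar> \<partial>M)) \<longlonglongrightarrow> 0" using tendsto_mult_right_zero[of _ _ C] d by simp
      then show "(\<lambda>i. \<bar>T (s i) - T f\<bar>) \<longlonglongrightarrow> 0"
        by (rule tendsto_sandwich[OF _ _ tendsto_const, rotated 2]) (use le in auto)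
    qed
    ultimately show ?case using lim LIMSEQ_unique by simp blast
  qed
  show thesis by (rule that[OF _ ab rep]) auto
qed

text \<open>Real scaling through constant classes, so that the real Hahn-Banach extension applies to
  L^1.\<close>

instantiation circle_fun :: real_vector
begin

definition scaleR_circle_fun :: "real \<Rightarrow> circle_fun \<Rightarrow> circle_fun" where
  "scaleR_circle_fun r f = circle_const (of_real r) * f"

instance
  by standard (simp_all add: scaleR_circle_fun_def circle_const_add circle_const_mult algebra_simps)

end

lemma subspace_Lp1: "subspace (Lp 1)"
  by (rule subspaceI) (auto simp: scaleR_circle_fun_def intro: Lp_add Lp_mult)

text \<open>Hahn-Banach extends the real part of L to a real-linear functional l. Its values on u
  and on i u, for real functions u, are represented by real densities a and b, and \<psi> = a + i b
  combines them: a Re f + b Im f is the real part of \<psi> conj f. Since M is stable under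
  multiplication by i and L is conjugate linear, the real part determines L on M.\<close>

lemma L1_dual_circle:
  assumes M: "M \<subseteq> Lp 1" "0 \<in> M" and M_add: "\<And>f g. f \<in> M \<Longrightarrow> g \<in> M \<Longrightarrow> f + g \<in> M"
    and M_scale: "\<And>f c. f \<in> M \<Longrightarrow> circle_const c * f \<in> M"
    and L_add: "\<And>f g. f \<in> M \<Longrightarrow> g \<in> M \<Longrightarrow> L (f + g) = L f + L g"
    and L_scale: "\<And>f c. f \<in> M \<Longrightarrow> L (circle_const c * f) = cnj c * L f"
    and L_le: "\<And>f. f \<in> M \<Longrightarrow> cmod (L f) \<le> C * lp_norm 1 f" and C: "C \<ge> 0"
  obtains \<psi> where "\<psi> \<in> Linf" "\<And>f. f \<in> M \<Longrightarrow> L f = cint (\<psi> * circle_cnj f)"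
proof -
  have ex: "\<exists>l. (\<forall>x\<in>Lp 1. \<forall>y\<in>Lp 1. l (x + y) = l x + l y) \<and> (\<forall>x\<in>Lp 1. \<forall>t. l (t *\<^sub>R x) = t * l x) \<and>
    (\<forall>x\<in>M. l x = Re (L x)) \<and> (\<forall>x\<in>Lp 1. l x \<le> C * lp_norm 1 x)"
  proof (rule Hahn_Banach_dominated[of M "Lp 1" "\<lambda>f. C * lp_norm 1 f" "\<lambda>f. Re (L f)"])
    show "subspace M" using M M_add M_scale by (intro subspaceI) (auto simp: scaleR_circle_fun_def)
    show "C * lp_norm 1 (x + y) \<le> C * lp_norm 1 x + C * lp_norm 1 y" if "x \<in> Lp 1" "y \<in> Lp 1" for x y
      using mult_left_mono[OF lp_norm_1_triangle[OF that] C] by (simp add: distrib_left)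
    show "C * lp_norm 1 (t *\<^sub>R x) = t * (C * lp_norm 1 x)" if "0 \<le> t" for x t
      using that by (simp add: scaleR_circle_fun_def lp_norm_const_mult)
    show "Re (L (t *\<^sub>R x)) = t * Re (L x)" if "x \<in> M" for x t
      using L_scale[OF that, of "of_real t"] by (simp add: scaleR_circle_fun_def)
    show "Re (L x) \<le> C * lp_norm 1 x" if "x \<in> M" for x
      using L_le[OF that] complex_Re_le_cmod[of "L x"] by linarith
    fix l assume "\<And>x y. x \<in> Lp 1 \<Longrightarrow> y \<in> Lp 1 \<Longrightarrow> l (x + y) = l x + l y"
      "\<And>x t. x \<in> Lp 1 \<Longrightarrow> l (t *\<^sub>R x) = t * l x"
      "\<And>x. x \<in> M \<Longrightarrow> l x = Re (L x)" "\<And>x. x \<in> Lp 1 \<Longrightarrow> l x \<le> C * lp_norm 1 x"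
    then show "\<exists>l. (\<forall>x\<in>Lp 1. \<forall>y\<in>Lp 1. l (x + y) = l x + l y) \<and> (\<forall>x\<in>Lp 1. \<forall>t. l (t *\<^sub>R x) = t * l x) \<and>
      (\<forall>x\<in>M. l x = Re (L x)) \<and> (\<forall>x\<in>Lp 1. l x \<le> C * lp_norm 1 x)"
      by (intro exI[of _ l]) simp
  qed (use M L_add subspace_Lp1 in auto)
  then obtain l where l_add: "\<And>x y. x \<in> Lp 1 \<Longrightarrow> y \<in> Lp 1 \<Longrightarrow> l (x + y) = l x + l y"
    and l_scale: "\<And>x t. x \<in> Lp 1 \<Longrightarrow> l (t *\<^sub>R x) = t * l x"
    and l_M: "\<And>x. x \<in> M \<Longrightarrow> l x = Re (L x)" and l_le: "\<And>x. x \<in> Lp 1 \<Longrightarrow> l x \<le> C * lp_norm 1 x"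
    by blast
  have l_abs: "\<bar>l x\<bar> \<le> C * lp_norm 1 x" if x: "x \<in> Lp 1" for x
  proof -
    have "l ((-1) *\<^sub>R x) = - l x" using l_scale[OF x, of "-1"] by simp
    moreover have "(-1) *\<^sub>R x \<in> Lp 1" using x subspace_Lp1 by (simp add: subspace_neg)
    moreover have "lp_norm 1 ((-1) *\<^sub>R x) = lp_norm 1 x"
      using lp_norm_const_mult[of 1 "-1" x] by (simp add: scaleR_circle_fun_def)
    ultimately show ?thesis using l_le[OF x] l_le[of "(-1) *\<^sub>R x"] by simp
  qed
  have dens: "\<exists>a. a \<in> borel_measurable \<mu> \<and> (AE x in \<mu>. \<bar>a x\<bar> \<le> C) \<and>
     (\<forall>u. integrable \<mu> u \<longrightarrow> l (abs_circle_fun (\<lambda>\<zeta>. c * of_real (u \<zeta>))) = (\<integral>x. u x * a x \<partial>\<mu>))" if c: "cmod c = 1" for c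
  proof (rule circle.L1_functional_density[of "\<lambda>u. l (abs_circle_fun (\<lambda>\<zeta>. c * of_real (u \<zeta>)))" C])
    have m: "(\<lambda>\<zeta>. c * complex_of_real (u \<zeta>)) \<in> borel_measurable borel" if "integrable \<mu> u" for u
      using borel_measurable_integrable[OF that] by simp
    have Lu: "abs_circle_fun (\<lambda>\<zeta>. c * complex_of_real (u \<zeta>)) \<in> Lp 1" if "integrable \<mu> u" for u
      using that m[OF that] by (simp add: Lp1_iff)
    show "l (abs_circle_fun (\<lambda>\<zeta>. c * of_real (u \<zeta> + v \<zeta>))) =
        l (abs_circle_fun (\<lambda>\<zeta>. c * of_real (u \<zeta>))) + l (abs_circle_fun (\<lambda>\<zeta>. c * of_real (v \<zeta>)))"
      if "integrable \<mu> u" "integrable \<mu> v" for u v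
      using l_add[OF Lu[OF that(1)] Lu[OF that(2)]] m that by (simp add: abs_circle_plus distrib_left)
    show "l (abs_circle_fun (\<lambda>\<zeta>. c * of_real (t * u \<zeta>))) = t * l (abs_circle_fun (\<lambda>\<zeta>. c * of_real (u \<zeta>)))"
      if "integrable \<mu> u" for u t
      using l_scale[OF Lu[OF that], of t] m that by (simp add: scaleR_circle_fun_def circle_const_abs abs_circle_times mult_ac)
    show "\<bar>l (abs_circle_fun (\<lambda>\<zeta>. c * of_real (u \<zeta>)))\<bar> \<le> C * (\<integral>\<zeta>. \<bar>u \<zeta>\<bar> \<partial>\<mu>)" if "integrable \<mu> u" for u
      using l_abs[OF Lu[OF that]] m[OF that] c by (simp add: lp_norm_1_eq norm_mult)
  qed blast
  obtain a where a: "a \<in> borel_measurable borel" "AE x in \<mu>. \<bar>a x\<bar> \<le> C"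
     "\<And>u. integrable \<mu> u \<Longrightarrow> l (abs_circle_fun (\<lambda>\<zeta>. of_real (u \<zeta>))) = (\<integral>x. u x * a x \<partial>\<mu>)"
    using dens[of 1] by auto
  obtain b where b: "b \<in> borel_measurable borel" "AE x in \<mu>. \<bar>b x\<bar> \<le> C"
     "\<And>u. integrable \<mu> u \<Longrightarrow> l (abs_circle_fun (\<lambda>\<zeta>. \<i> * of_real (u \<zeta>))) = (\<integral>x. u x * b x \<partial>\<mu>)"
    using dens[of \<i>] by auto
  note [measurable] = a(1) b(1)
  define \<psi>' where "\<psi>' \<zeta> = of_real (a \<zeta>) + \<i> * of_real (b \<zeta>)" for \<zeta>
  have pm [measurable]: "\<psi>' \<in> borel_measurable borel" unfolding \<psi>'_def by measurable
  have pb: "AE \<zeta> in \<mu>. cmod (\<psi>' \<zeta>) \<le> C + C"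
    using a(2) b(2)
  proof eventually_elim
    case (elim \<zeta>)
    have "cmod (\<psi>' \<zeta>) \<le> cmod (of_real (a \<zeta>)) + cmod (\<i> * of_real (b \<zeta>))" unfolding \<psi>'_def by (rule norm_triangle_ineq)
    then show ?case using elim by (simp add: norm_mult)
  qed
  have int: "integrable \<mu> (\<lambda>\<zeta>. u \<zeta> * c \<zeta>)" if "integrable \<mu> u" "c \<in> borel_measurable borel" "AE \<zeta> in \<mu>. \<bar>c \<zeta>\<bar> \<le> C" for u c :: "complex \<Rightarrow> real"
  proof (rule Bochner_Integration.integrable_bound)
    show "integrable \<mu> (\<lambda>\<zeta>. C * u \<zeta>)" using that by simp
    show "AE \<zeta> in \<mu>. norm (u \<zeta> * c \<zeta>) \<le> norm (C * u \<zeta>)"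
      using that(3)
    proof eventually_elim
      case (elim x)
      then have "\<bar>c x\<bar> * \<bar>u x\<bar> \<le> \<bar>C\<bar> * \<bar>u x\<bar>" by (intro mult_right_mono) auto
      then show ?case by (simp add: abs_mult mult.commute)
    qed
  qed (use that in auto)
  have Rel: "Re (L f) = Re (cint (abs_circle_fun \<psi>' * circle_cnj f))" if fM: "f \<in> M" for f
  proof -
    obtain f' where f' [measurable]: "f' \<in> borel_measurable borel" and fe: "f = abs_circle_fun f'" by (rule circle_fun_obtain)
    have fi: "integrable \<mu> f'" using fM M(1) f' by (auto simp: fe Lp1_iff)
    then have ri: "integrable \<mu> (\<lambda>\<zeta>. Re (f' \<zeta>))" "integrable \<mu> (\<lambda>\<zeta>. Im (f' \<zeta>))" by auto
    have Ls: "abs_circle_fun (\<lambda>\<zeta>. of_real (Re (f' \<zeta>))) \<in> Lp 1" "abs_circle_fun (\<lambda>\<zeta>. \<i> * of_real (Im (f' \<zeta>))) \<in> Lp 1"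
      using ri by (simp_all add: Lp1_iff)
    have "f = abs_circle_fun (\<lambda>\<zeta>. of_real (Re (f' \<zeta>))) + abs_circle_fun (\<lambda>\<zeta>. \<i> * of_real (Im (f' \<zeta>)))"
      by (simp add: fe abs_circle_plus complex_eq[symmetric])
    then have "Re (L f) = (\<integral>\<zeta>. Re (f' \<zeta>) * a \<zeta> \<partial>\<mu>) + (\<integral>\<zeta>. Im (f' \<zeta>) * b \<zeta> \<partial>\<mu>)"
      using l_M[OF fM] l_add[OF Ls] a(3)[OF ri(1)] b(3)[OF ri(2)] by simp
    also have "\<dots> = (\<integral>\<zeta>. Re (f' \<zeta>) * a \<zeta> + Im (f' \<zeta>) * b \<zeta> \<partial>\<mu>)"
      using int[OF ri(1) a(1,2)] int[OF ri(2) b(1,2)] by simp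
    also have "\<dots> = (\<integral>\<zeta>. Re (\<psi>' \<zeta> * cnj (f' \<zeta>)) \<partial>\<mu>)" by (simp add: \<psi>'_def algebra_simps)
    also have "\<dots> = Re (\<integral>\<zeta>. \<psi>' \<zeta> * cnj (f' \<zeta>) \<partial>\<mu>)"
    proof (rule integral_Re)
      have "pint 1 f'" using fi by (simp add: pint_def)
      then have "pint 1 (\<lambda>\<zeta>. \<psi>' \<zeta> * cnj (f' \<zeta>))" using pint_bounded_mult(1)[OF pint_cnj pm pb, of 1] by simp
      then show "integrable \<mu> (\<lambda>\<zeta>. \<psi>' \<zeta> * cnj (f' \<zeta>))" by (simp add: pint_def integrable_norm_iff)
    qed
    finally show ?thesis by (simp add: fe abs_circle_cnj abs_circle_times abs_circle_cint)
  qed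
  show thesis
  proof (rule that)
    show "abs_circle_fun \<psi>' \<in> Linf" by (rule LinfI[OF pm pb])
    fix f assume f: "f \<in> M"
    have "Re (L (circle_const \<i> * f)) = Re (cint (abs_circle_fun \<psi>' * circle_cnj (circle_const \<i> * f)))"
      by (rule Rel[OF M_scale[OF f]])
    moreover have "abs_circle_fun \<psi>' * circle_cnj (circle_const \<i> * f) = circle_const (- \<i>) * (abs_circle_fun \<psi>' * circle_cnj f)"
      by (simp add: mult_ac)
    ultimately have "Im (L f) = Im (cint (abs_circle_fun \<psi>' * circle_cnj f))"
      using L_scale[OF f, of \<i>] by (simp only: cint_const_mult) simp
    then show "L f = cint (abs_circle_fun \<psi>' * circle_cnj f)" using Rel[OF f] by (simp add: complex_eq_iff)
  qed
qed

section \<open>Fatou's theorem\<close>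

text \<open>For |x| <= 2 the Maclaurin remainder |x|^3 / 6 is at most 2 |x| / 3. The range covers
  |x| <= pi/2, where the estimate is applied.\<close>

lemma abs_sin_ge:
  fixes x :: real
  assumes "\<bar>x\<bar> \<le> 2"
  shows "\<bar>x\<bar> / 3 \<le> \<bar>sin x\<bar>"
proof -
  have "\<bar>sin x - (\<Sum>m<3. sin_coeff m * x ^ m)\<bar> \<le> inverse (fact 3) * \<bar>x\<bar> ^ 3" by (rule Maclaurin_sin_bound)
  then have b: "\<bar>sin x - x\<bar> \<le> \<bar>x\<bar> ^ 3 / 6"
    by (simp add: sin_coeff_def numeral_eq_Suc fact_numeral)
  have "\<bar>x\<bar> ^ 3 = \<bar>x\<bar> * \<bar>x\<bar>^2" by (simp add: power3_eq_cube power2_eq_square)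
  also have "\<dots> \<le> \<bar>x\<bar> * 2^2" using assms by (intro mult_left_mono power_mono) auto
  finally show ?thesis using b by (simp add: abs_if split: if_splits)
qed

text \<open>The chord from \<zeta> = cis \<theta> to cis t has length 2 |sin ((t - \<theta>)/2)|, so
  a chord shorter than \<rho> forces t within 3 \<rho> of \<theta> or of \<theta> + 2 pi.\<close>

lemma measure_circle_ball_le:
  assumes \<zeta>: "cmod \<zeta> = 1" and \<rho>: "\<rho> > 0"
  shows "measure \<mu> (ball \<zeta> \<rho>) \<le> 2 * \<rho>"
proof -
  define \<theta> where "\<theta> = Arg \<zeta>"
  have z: "\<zeta> = cis \<theta>" using \<zeta> cis_Arg[of \<zeta>] by (cases "\<zeta> = 0") (simp_all add: \<theta>_def sgn_eq)
  have th: "- pi < \<theta>" "\<theta> \<le> pi" using Arg_bounded[of \<zeta>] by (auto simp: \<theta>_def)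
  \<comment> \<open>Since \<theta> ranges over (-pi, pi] and t over [0, 2 pi], both representatives
    of the angle occur. The total length is at most 12 \<rho>, and 12 / (2 pi) <= 2.\<close>
  define J where "J = {\<theta> - 3*\<rho>..\<theta> + 3*\<rho>} \<union> {\<theta> + 2*pi - 3*\<rho>..\<theta> + 2*pi + 3*\<rho>}"
  have J: "t \<in> J" if t: "0 \<le> t" "t \<le> 2*pi" and d: "cis t \<in> ball \<zeta> \<rho>" for t
  proof -
    define x where "x = (t - \<theta>) / 2"
    have "cis t - cis \<theta> = cis \<theta> * (cis (t - \<theta>) - 1)" by (simp add: right_diff_distrib cis_mult)
    then have "cmod (cis t - cis \<theta>) = cmod (exp (\<i> * of_real (t - \<theta>)) - 1)"
      by (simp add: norm_mult cis_conv_exp)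
    also have "\<dots> = 2 * \<bar>sin x\<bar>" unfolding dist_exp_i_1 x_def ..
    finally have s: "2 * \<bar>sin x\<bar> < \<rho>" using d by (simp add: z dist_norm norm_minus_commute)
    have x: "- pi / 2 \<le> x" "x \<le> 3 * pi / 2" using th t by (auto simp: x_def)
    show ?thesis
    proof (cases "x \<le> pi / 2")
      case True
      then have "\<bar>x\<bar> \<le> 2" using x pi_less_4 by linarith
      then have "\<bar>x\<bar> / 3 < \<rho> / 2" using abs_sin_ge[of x] s by linarith
      then show ?thesis by (auto simp: J_def x_def abs_less_iff field_simps)
    next
      case False
      then have "\<bar>x - pi\<bar> \<le> 2" using x pi_less_4 by linarith
      moreover have "\<bar>sin (x - pi)\<bar> = \<bar>sin x\<bar>" by (simp add: sin_diff)
      ultimately have "\<bar>x - pi\<bar> / 3 < \<rho> / 2" using abs_sin_ge[of "x - pi"] s by linarith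
      then show ?thesis by (auto simp: J_def x_def abs_less_iff field_simps)
    qed
  qed
  have Jm: "J \<in> sets lborel" by (auto simp: J_def)
  have Jfin: "emeasure lborel J < \<infinity>"
    by (intro emeasure_bounded_finite) (simp add: J_def bounded_closed_interval)
  have Jmeas: "measure lborel J \<le> 12 * \<rho>"
    unfolding J_def using \<rho> by (intro order_trans[OF measure_Un_le]) auto
  have "measure \<mu> (ball \<zeta> \<rho>) = (\<integral>\<xi>. indicator (ball \<zeta> \<rho>) \<xi> \<partial>\<mu>)" by simp
  also have "\<dots> = (\<integral>t. (indicator {0..2*pi} t / (2*pi)) *\<^sub>R indicator (ball \<zeta> \<rho>) (cis t) \<partial>lborel)"
    by (rule circle_integral_eq, rule borel_measurable_indicator) simp
  also have "\<dots> \<le> (\<integral>t. indicator J t / (2*pi) \<partial>lborel)"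
  proof (rule integral_mono')
    show "integrable lborel (\<lambda>t. indicator J t / (2*pi))" using Jm Jfin by (intro integrable_divide integrable_real_indicator) auto
    fix t show "(indicator {0..2*pi} t / (2*pi)) *\<^sub>R indicator (ball \<zeta> \<rho>) (cis t) \<le> indicator J t / (2*pi)"
      using J[of t] by (auto simp: indicator_def)
  qed auto
  also have "\<dots> = measure lborel J / (2*pi)" by simp
  also have "\<dots> \<le> 12 * \<rho> / (2*pi)" using Jmeas by (intro divide_right_mono) auto
  also have "\<dots> \<le> 12 * \<rho> / (2*3)" using \<rho> pi_gt3 by (intro divide_left_mono) auto
  finally show ?thesis by simp
qed

text \<open>Vitali's covering lemma for the balls on which the integral of h exceeds L \<rho>: a
  disjoint subfamily, enlarged five times, covers them all. The constant 10 is this factor 5 times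
  the 2 in the bound for the measure of a ball. E is the union of the enlarged balls, hence open and
  measurable.\<close>

lemma maximal_weak_type:
  fixes h :: "complex \<Rightarrow> real"
  assumes h: "integrable \<mu> h" "\<And>\<xi>. h \<xi> \<ge> 0" and l: "L > 0"
  obtains E where "E \<in> sets borel" "measure \<mu> E \<le> 10 * (\<integral>\<xi>. h \<xi> \<partial>\<mu>) / L"
    "\<And>\<zeta> \<rho>. cmod \<zeta> = 1 \<Longrightarrow> \<zeta> \<notin> E \<Longrightarrow> \<rho> > 0 \<Longrightarrow> (\<integral>\<xi>. indicator (ball \<zeta> \<rho>) \<xi> * h \<xi> \<partial>\<mu>) \<le> L * \<rho>"
proof -
  have [measurable]: "h \<in> borel_measurable borel" using h(1) by auto
  define H where "H = (\<integral>\<xi>. h \<xi> \<partial>\<mu>)"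
  have H0: "H \<ge> 0" using h(2) by (simp add: H_def)
  have bi: "integrable \<mu> (\<lambda>\<xi>. indicator B \<xi> * h \<xi>)" if "B \<in> sets borel" for B
    using that by (intro Bochner_Integration.integrable_bound[OF h(1)]) (auto simp: indicator_def)
  define K where "K = {(\<zeta>, \<rho>). cmod \<zeta> = 1 \<and> \<rho> > 0 \<and> (\<integral>\<xi>. indicator (ball \<zeta> \<rho>) \<xi> * h \<xi> \<partial>\<mu>) > L * \<rho>}"
  define S where "S = (\<Union>i\<in>K. ball (fst i) (snd i))"
  \<comment> \<open>Bad balls have radius at most H/L, the uniform bound that the covering lemma
    requires.\<close>
  have r: "0 < snd i \<and> snd i \<le> H / L" if "i \<in> K" for i
  proof -
    have "L * snd i < (\<integral>\<xi>. indicator (ball (fst i) (snd i)) \<xi> * h \<xi> \<partial>\<mu>)" using that by (auto simp: K_def)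
    also have "\<dots> \<le> H" unfolding H_def
      by (intro integral_mono bi h(1)) (auto simp: indicator_def h(2))
    finally show ?thesis using that l by (auto simp: K_def field_simps)
  qed
  obtain C where C: "countable C" "C \<subseteq> K" "pairwise (\<lambda>i j. disjnt (ball (fst i) (snd i)) (ball (fst j) (snd j))) C"
      "S \<subseteq> (\<Union>i\<in>C. ball (fst i) (5 * snd i))"
    using Vitali_covering_lemma_balls[where S = S and K = K and a = fst and r = snd and B = "H / L"] r unfolding S_def by auto
  define E where "E = (\<Union>i\<in>C. ball (fst i) (5 * snd i))"
  \<comment> \<open>The estimate is made for finite subfamilies, where sum and integral can be
    exchanged; an enumeration of C then exhausts E.\<close>
  have fin: "measure \<mu> (\<Union>i\<in>F. ball (fst i) (5 * snd i)) \<le> 10 * H / L" if F: "finite F" "F \<subseteq> C" for F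
  proof -
    have FK: "F \<subseteq> K" using F C by auto
    have disj: "disjoint_family_on (\<lambda>i. ball (fst i) (snd i)) F"
      using C(3) F(2) unfolding disjoint_family_on_def pairwise_def disjnt_def by blast
    have "measure \<mu> (\<Union>i\<in>F. ball (fst i) (5 * snd i)) \<le> (\<Sum>i\<in>F. measure \<mu> (ball (fst i) (5 * snd i)))"
      using F by (intro circle.finite_measure_subadditive_finite) auto
    also have "\<dots> \<le> (\<Sum>i\<in>F. 10 / L * (\<integral>\<xi>. indicator (ball (fst i) (snd i)) \<xi> * h \<xi> \<partial>\<mu>))"
    proof (rule sum_mono)
      fix i assume "i \<in> F"
      then have i: "cmod (fst i) = 1" "snd i > 0" "L * snd i < (\<integral>\<xi>. indicator (ball (fst i) (snd i)) \<xi> * h \<xi> \<partial>\<mu>)"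
        using FK by (auto simp: K_def)
      have "measure \<mu> (ball (fst i) (5 * snd i)) \<le> 2 * (5 * snd i)" using i by (intro measure_circle_ball_le) auto
      also have "\<dots> = 10 / L * (L * snd i)" using l by simp
      also have "\<dots> \<le> 10 / L * (\<integral>\<xi>. indicator (ball (fst i) (snd i)) \<xi> * h \<xi> \<partial>\<mu>)"
        using i l by (intro mult_left_mono) auto
      finally show "measure \<mu> (ball (fst i) (5 * snd i)) \<le> \<dots>" .
    qed
    also have "\<dots> = 10 / L * (\<integral>\<xi>. (\<Sum>i\<in>F. indicator (ball (fst i) (snd i)) \<xi> * h \<xi>) \<partial>\<mu>)"
      by (subst Bochner_Integration.integral_sum) (auto intro: bi simp: sum_distrib_left)
    also have "\<dots> \<le> 10 / L * H"
    proof (rule mult_left_mono)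
      show "(\<integral>\<xi>. (\<Sum>i\<in>F. indicator (ball (fst i) (snd i)) \<xi> * h \<xi>) \<partial>\<mu>) \<le> H"
        unfolding H_def
      proof (rule integral_mono)
        show "integrable \<mu> (\<lambda>\<xi>. \<Sum>i\<in>F. indicator (ball (fst i) (snd i)) \<xi> * h \<xi>)"
          by (intro Bochner_Integration.integrable_sum bi) auto
        fix \<xi>
        have "(\<Sum>i\<in>F. indicator (ball (fst i) (snd i)) \<xi>) = (indicator (\<Union>i\<in>F. ball (fst i) (snd i)) \<xi> :: real)"
          by (rule indicator_UN_disjoint[OF F(1) disj, symmetric])
        then show "(\<Sum>i\<in>F. indicator (ball (fst i) (snd i)) \<xi> * h \<xi>) \<le> h \<xi>"
          using h(2)[of \<xi>] by (simp add: sum_distrib_right[symmetric] indicator_def)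
      qed (rule h(1))
    qed (use l in auto)
    finally show ?thesis by simp
  qed
  have Em: "E \<in> sets borel" unfolding E_def by (intro borel_open open_UN) auto
  have "measure \<mu> E \<le> 10 * H / L"
  proof (cases "C = {}")
    case True
    then show ?thesis using H0 l by (simp add: E_def)
  next
    case False
    define g where "g = from_nat_into C"
    have g: "range g = C" unfolding g_def using range_from_nat_into[OF False C(1)] .
    define A where "A n = (\<Union>i\<in>g ` {..<n}. ball (fst i) (5 * snd i))" for n :: nat
    have "(\<lambda>n. measure \<mu> (A n)) \<longlonglongrightarrow> measure \<mu> (\<Union>n. A n)"
    proof (rule circle.finite_Lim_measure_incseq)
      show "incseq A" unfolding A_def incseq_def by (intro allI impI UN_mono image_mono) auto
    qed (auto simp: A_def)
    moreover have "(\<Union>n. A n) = E" unfolding E_def A_def g[symmetric] by auto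
    ultimately have "(\<lambda>n. measure \<mu> (A n)) \<longlonglongrightarrow> measure \<mu> E" by simp
    moreover have "measure \<mu> (A n) \<le> 10 * H / L" for n
      unfolding A_def by (rule fin) (use g in auto)
    ultimately show ?thesis by (intro LIMSEQ_le_const2) auto
  qed
  moreover have "(\<integral>\<xi>. indicator (ball \<zeta> \<rho>) \<xi> * h \<xi> \<partial>\<mu>) \<le> L * \<rho>" if "cmod \<zeta> = 1" "\<zeta> \<notin> E" "\<rho> > 0" for \<zeta> \<rho>
  proof (rule ccontr)
    assume "\<not> ?thesis"
    then have "(\<zeta>, \<rho>) \<in> K" using that by (auto simp: K_def)
    then have "\<zeta> \<in> S" using that unfolding S_def by force
    then have "\<zeta> \<in> E" using C(4) unfolding E_def by blast
    then show False using that by blast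
  qed
  ultimately show thesis using that Em unfolding H_def by blast
qed

section \<open>The Poisson kernel and Cauchy integrals\<close>

definition poisson :: "complex \<Rightarrow> complex \<Rightarrow> real" where
  "poisson z \<xi> = (1 - (cmod z)^2) / (cmod (\<xi> - z))^2"

lemma poisson_measurable [measurable]: "poisson z \<in> borel_measurable borel"
  unfolding poisson_def by measurable

lemma poisson_nonneg: "cmod z < 1 \<Longrightarrow> poisson z \<xi> \<ge> 0"
  by (simp add: poisson_def power_le_one)

text \<open>The kernel is at most 2 s / d^2 with s = 1 - r and d the distance from \<xi> to r
  \<zeta>. If k is least with \<xi> in the ball of radius 2^k s, then d >= 2^k s / 4, which gives
  the 32, and the k-th term of the sum is already large enough. The assumption on N makes the last
  ball contain the whole circle.\<close>

lemma poisson_le_balls: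
  assumes \<zeta>: "cmod \<zeta> = 1" and \<xi>: "cmod \<xi> = 1" and r: "0 < r" "r < 1" and N: "2 ^ N * (1 - r) > 2"
  shows "poisson (of_real r * \<zeta>) \<xi> \<le> (\<Sum>k\<le>N. 32 / (4^k * (1 - r)) * indicator (ball \<zeta> (2^k * (1 - r))) \<xi>)"
proof -
  define s where "s = 1 - r"
  have s: "0 < s" "s < 1" using r by (auto simp: s_def)
  define d where "d = cmod (\<xi> - of_real r * \<zeta>)"
  have zr: "cmod (\<zeta> - of_real r * \<zeta>) = s"
  proof -
    have "\<zeta> - of_real r * \<zeta> = of_real s * \<zeta>" by (simp add: s_def algebra_simps)
    then show ?thesis using \<zeta> s by (simp add: norm_mult)
  qed
  have d1: "d \<ge> s" using norm_triangle_ineq2[of \<xi> "of_real r * \<zeta>"] \<xi> \<zeta> r by (simp add: d_def s_def norm_mult)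
  have d2: "cmod (\<xi> - \<zeta>) \<le> 2 * d"
    using norm_triangle_ineq4[of "\<xi> - of_real r * \<zeta>" "\<zeta> - of_real r * \<zeta>"] d1 zr by (simp add: d_def)
  have P: "poisson (of_real r * \<zeta>) \<xi> \<le> 2 * s / d^2"
  proof -
    have "1 - (cmod (of_real r * \<zeta>))^2 = s * (1 + r)" using \<zeta> by (simp add: norm_mult s_def power2_eq_square algebra_simps)
    also have "\<dots> \<le> s * 2" using s r by (intro mult_left_mono) auto
    finally have "1 - (cmod (of_real r * \<zeta>))^2 \<le> 2 * s" by simp
    then show ?thesis unfolding poisson_def d_def[symmetric] by (rule divide_right_mono) simp
  qed
  have ex: "cmod (\<xi> - \<zeta>) < 2 ^ N * s" using norm_triangle_ineq4[of \<xi> \<zeta>] \<xi> \<zeta> N by (simp add: s_def)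
  define k where "k = (LEAST k. cmod (\<xi> - \<zeta>) < 2 ^ k * s)"
  have k: "cmod (\<xi> - \<zeta>) < 2 ^ k * s" unfolding k_def by (rule LeastI[of _ N]) (rule ex)
  have kN: "k \<le> N" unfolding k_def by (rule Least_le) (rule ex)
  have dpos: "d > 0" using d1 s by simp
  have "poisson (of_real r * \<zeta>) \<xi> \<le> 32 / (4^k * s)"
  proof (cases k)
    case 0
    have "2 * s / d^2 \<le> 2 * s / s^2" using d1 s by (intro divide_left_mono power_mono mult_pos_pos) auto
    also have "\<dots> = 2 / s" using s by (simp add: power2_eq_square)
    also have "\<dots> \<le> 32 / s" using s by (intro divide_right_mono) auto
    finally show ?thesis using P 0 by simp
  next
    case (Suc j)
    then have "\<not> cmod (\<xi> - \<zeta>) < 2 ^ j * s" using not_less_Least[of j "\<lambda>k. cmod (\<xi> - \<zeta>) < 2 ^ k * s"] by (simp add: k_def)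
    then have d3: "d \<ge> 2 ^ j * s / 2" using d2 by simp
    have "2 * s / d^2 \<le> 2 * s / (2 ^ j * s / 2)^2" using d3 s dpos by (intro divide_left_mono power_mono mult_pos_pos) auto
    also have "\<dots> = 8 / (4 ^ j * s)" using s by (simp add: power2_eq_square power_mult_distrib[symmetric] field_simps)
    also have "\<dots> = 32 / (4 ^ k * s)" by (simp add: Suc)
    finally show ?thesis using P by simp
  qed
  also have "\<dots> = 32 / (4^k * s) * indicator (ball \<zeta> (2^k * s)) \<xi>"
    using k by (simp add: dist_norm norm_minus_commute)
  also have "\<dots> \<le> (\<Sum>k\<le>N. 32 / (4^k * s) * indicator (ball \<zeta> (2^k * s)) \<xi>)"
    using kN s by (intro member_le_sum) auto
  finally show ?thesis by (simp add: s_def)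
qed

text \<open>Each ball contributes 32/(4^k s) times L 2^k s, that is 32 L / 2^k, and the geometric
  series sums to at most 64 L.\<close>

lemma poisson_integral_le_maximal:
  fixes h :: "complex \<Rightarrow> real"
  assumes h: "integrable \<mu> h" "\<And>\<xi>. h \<xi> \<ge> 0" and \<zeta>: "cmod \<zeta> = 1" and l: "L \<ge> 0"
    and max: "\<And>\<rho>. \<rho> > 0 \<Longrightarrow> (\<integral>\<xi>. indicator (ball \<zeta> \<rho>) \<xi> * h \<xi> \<partial>\<mu>) \<le> L * \<rho>"
    and r: "0 < r" "r < 1"
  shows "(\<integral>\<xi>. poisson (of_real r * \<zeta>) \<xi> * h \<xi> \<partial>\<mu>) \<le> 64 * L"
proof -
  have [measurable]: "h \<in> borel_measurable borel" using h(1) by auto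
  define s where "s = 1 - r"
  have s: "s > 0" using r by (simp add: s_def)
  obtain N where "(2::real)^N > 2 / s" using real_arch_pow[of 2 "2/s"] by auto
  then have N: "2 ^ N * (1 - r) > 2" using s by (simp add: field_simps s_def[symmetric])
  have bi: "integrable \<mu> (\<lambda>\<xi>. indicator (ball \<zeta> \<rho>) \<xi> * h \<xi>)" for \<rho>
    by (intro Bochner_Integration.integrable_bound[OF h(1)]) (auto simp: indicator_def)
  have "(\<integral>\<xi>. poisson (of_real r * \<zeta>) \<xi> * h \<xi> \<partial>\<mu>) \<le>
      (\<integral>\<xi>. (\<Sum>k\<le>N. 32 / (4^k * s) * (indicator (ball \<zeta> (2^k * s)) \<xi> * h \<xi>)) \<partial>\<mu>)"
  proof (rule integral_mono_AE')
    show "integrable \<mu> (\<lambda>\<xi>. \<Sum>k\<le>N. 32 / (4^k * s) * (indicator (ball \<zeta> (2^k * s)) \<xi> * h \<xi>))"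
      by (intro Bochner_Integration.integrable_sum integrable_mult_right bi)
    show "AE \<xi> in \<mu>. poisson (of_real r * \<zeta>) \<xi> * h \<xi> \<le> (\<Sum>k\<le>N. 32 / (4^k * s) * (indicator (ball \<zeta> (2^k * s)) \<xi> * h \<xi>))"
    proof (rule AE_circleI)
      fix \<xi> :: complex assume "cmod \<xi> = 1"
      then have "poisson (of_real r * \<zeta>) \<xi> * h \<xi> \<le> (\<Sum>k\<le>N. 32 / (4^k * s) * indicator (ball \<zeta> (2^k * s)) \<xi>) * h \<xi>"
        unfolding s_def by (intro mult_right_mono poisson_le_balls \<zeta> r N h)
      then show "poisson (of_real r * \<zeta>) \<xi> * h \<xi> \<le> (\<Sum>k\<le>N. 32 / (4^k * s) * (indicator (ball \<zeta> (2^k * s)) \<xi> * h \<xi>))"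
        by (simp add: sum_distrib_right mult.assoc)
    qed
    show "AE \<xi> in \<mu>. 0 \<le> (\<Sum>k\<le>N. 32 / (4^k * s) * (indicator (ball \<zeta> (2^k * s)) \<xi> * h \<xi>))"
      using s h by (intro AE_I2 sum_nonneg mult_nonneg_nonneg) auto
  qed
  also have "\<dots> = (\<Sum>k\<le>N. 32 / (4^k * s) * (\<integral>\<xi>. indicator (ball \<zeta> (2^k * s)) \<xi> * h \<xi> \<partial>\<mu>))"
    by (subst Bochner_Integration.integral_sum, intro integrable_mult_right bi) (simp only: integral_mult_right_zero)
  also have "\<dots> \<le> (\<Sum>k\<le>N. 32 / (4^k * s) * (L * (2^k * s)))"
    using s by (intro sum_mono mult_left_mono max) auto
  also have "\<dots> = 32 * L * (\<Sum>k\<le>N. (1/2)^k)"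
    unfolding sum_distrib_left
  proof (rule sum.cong[OF refl])
    fix k :: nat
    have "(4::real)^k = 2^k * 2^k" by (simp add: power_mult_distrib[symmetric])
    then show "32 / (4^k * s) * (L * (2^k * s)) = 32 * L * (1/2)^k"
      using s by (simp add: power_one_over field_simps)
  qed
  also have "(\<Sum>k\<le>N. (1/2::real)^k) = 2 - (1/2)^N" by (induction N) auto
  then have "(\<Sum>k\<le>N. (1/2::real)^k) \<le> 2" by simp
  then have "32 * L * (\<Sum>k\<le>N. (1/2)^k) \<le> 32 * L * 2" using l by (intro mult_left_mono) auto
  finally show ?thesis by simp
qed

text \<open>The geometric series is integrated term by term; |w| < 1 gives a summable majorant. With
  g the conjugation it yields the Cauchy integral, with g the identity its conjugate
  counterpart.\<close>

lemma geometric_kernel_sums: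
  assumes [measurable]: "f \<in> borel_measurable borel" "g \<in> borel_measurable borel"
    and B: "AE \<xi> in \<mu>. cmod (f \<xi>) \<le> B" and g: "\<And>\<xi>. cmod \<xi> = 1 \<Longrightarrow> cmod (g \<xi>) = 1" and w: "cmod w < 1"
  shows "(\<lambda>n. w ^ n * (\<integral>\<xi>. f \<xi> * g \<xi> ^ n \<partial>\<mu>)) sums (\<integral>\<xi>. f \<xi> / (1 - w * g \<xi>) \<partial>\<mu>)"
    and "integrable \<mu> (\<lambda>\<xi>. f \<xi> / (1 - w * g \<xi>))"
proof -
  have geo: "(\<lambda>n. w ^ n * (f \<xi> * g \<xi> ^ n)) sums (f \<xi> / (1 - w * g \<xi>))" if "cmod \<xi> = 1" for \<xi>
  proof -
    have "(\<lambda>n. f \<xi> * (w * g \<xi>) ^ n) sums (f \<xi> * (1 / (1 - w * g \<xi>)))"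
      using w g[OF that] by (intro sums_mult geometric_sums) (simp add: norm_mult)
    then show ?thesis by (simp add: power_mult_distrib mult_ac)
  qed
  have nrm: "AE \<xi> in \<mu>. norm (w ^ n * (f \<xi> * g \<xi> ^ n)) \<le> B * cmod w ^ n" for n
    using B AE_circle_norm by eventually_elim (simp add: norm_mult norm_power g mult.commute[of "cmod w ^ n"] mult_right_mono)
  have int: "integrable \<mu> (\<lambda>\<xi>. w ^ n * (f \<xi> * g \<xi> ^ n))" for n
    by (rule circle.integrable_const_bound[OF nrm[of n]]) measurable
  have geosm: "summable (\<lambda>n. B * cmod w ^ n)" using w by (intro summable_mult summable_geometric) simp
  have sm: "AE \<xi> in \<mu>. summable (\<lambda>n. norm (w ^ n * (f \<xi> * g \<xi> ^ n)))"
  proof -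
    have "AE \<xi> in \<mu>. \<forall>n. norm (w ^ n * (f \<xi> * g \<xi> ^ n)) \<le> B * cmod w ^ n" using nrm by (simp add: AE_all_countable)
    then show ?thesis by eventually_elim (rule summable_comparison_test'[OF geosm, of 0], simp)
  qed
  have smi: "summable (\<lambda>n. \<integral>\<xi>. norm (w ^ n * (f \<xi> * g \<xi> ^ n)) \<partial>\<mu>)"
  proof (rule summable_comparison_test'[OF geosm, of 0])
    fix n :: nat
    have "(\<integral>\<xi>. norm (w ^ n * (f \<xi> * g \<xi> ^ n)) \<partial>\<mu>) \<le> (\<integral>\<xi>. B * cmod w ^ n \<partial>\<mu>)"
      using int nrm by (intro integral_mono_AE) auto
    then show "norm (\<integral>\<xi>. norm (w ^ n * (f \<xi> * g \<xi> ^ n)) \<partial>\<mu>) \<le> B * cmod w ^ n" by simp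
  qed
  have eq: "AE \<xi> in \<mu>. (\<Sum>n. w ^ n * (f \<xi> * g \<xi> ^ n)) = f \<xi> / (1 - w * g \<xi>)"
    by (rule AE_circleI) (use geo in \<open>auto simp: sums_iff\<close>)
  have eqi: "(\<integral>\<xi>. (\<Sum>n. w ^ n * (f \<xi> * g \<xi> ^ n)) \<partial>\<mu>) = (\<integral>\<xi>. f \<xi> / (1 - w * g \<xi>) \<partial>\<mu>)"
    by (rule integral_cong_AE[OF _ _ eq]) measurable
  show "(\<lambda>n. w ^ n * (\<integral>\<xi>. f \<xi> * g \<xi> ^ n \<partial>\<mu>)) sums (\<integral>\<xi>. f \<xi> / (1 - w * g \<xi>) \<partial>\<mu>)"
    using sums_integral[OF int sm smi] unfolding eqi by simp
  show "integrable \<mu> (\<lambda>\<xi>. f \<xi> / (1 - w * g \<xi>))"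
    by (rule integrable_cong_AE_imp[OF integrable_suminf[OF int sm smi] _ eq]) measurable
qed

text \<open>For w = z conj \<xi> one has 1 - |w|^2 = (1 - conj w) + conj w (1 - w); division by |1 -
  w|^2 gives the two kernels, and |\<xi> - z| = |1 - w| on the circle.\<close>

lemma poisson_eq_kernels:
  assumes \<xi>: "cmod \<xi> = 1" and z: "cmod z < 1"
  shows "of_real (poisson z \<xi>) = 1 / (1 - z * cnj \<xi>) + cnj z * \<xi> / (1 - cnj z * \<xi>)"
proof -
  define w where "w = z * cnj \<xi>"
  have w: "cmod w = cmod z" using \<xi> by (simp add: w_def norm_mult)
  have w1: "1 - w \<noteq> 0" "1 - cnj w \<noteq> 0" using w z by (metis eq_iff_diff_eq_0 less_irrefl norm_one complex_mod_cnj)+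
  have "\<xi> - z = \<xi> * (1 - w)" using circle_mult_cnj[OF \<xi>] by (simp add: w_def right_diff_distrib mult.left_commute)
  then have d: "cmod (\<xi> - z) = cmod (1 - w)" using \<xi> by (simp add: norm_mult)
  have "1 / (1 - w) + cnj w / (1 - cnj w) = (1 - w * cnj w) / ((1 - w) * (1 - cnj w))"
    using w1 by (simp add: field_simps)
  also have "(1 - w) * (1 - cnj w) = of_real ((cmod (1 - w))^2)"
    using complex_norm_square[of "1 - w"] by simp
  also have "1 - w * cnj w = of_real (1 - (cmod w)^2)" using complex_norm_square[of w] by simp
  finally show ?thesis by (simp add: poisson_def d w) (simp add: w_def)
qed

lemma poisson_bounded:
  assumes z: "cmod z < 1" and \<xi>: "cmod \<xi> = 1"
  shows "poisson z \<xi> \<le> 1 / (1 - cmod z)^2"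
proof -
  have "1 - cmod z \<le> cmod (\<xi> - z)" using norm_triangle_ineq2[of \<xi> z] \<xi> by simp
  then show ?thesis unfolding poisson_def
    using z by (intro frac_le power_mono) (auto simp: power_le_one)
qed

lemma poisson_mult_integrable:
  fixes h :: "complex \<Rightarrow> 'b::{real_normed_field,banach,second_countable_topology}"
  assumes z: "cmod z < 1" and h: "integrable \<mu> h"
  shows "integrable \<mu> (\<lambda>\<xi>. of_real (poisson z \<xi>) * h \<xi>)"
proof (rule Bochner_Integration.integrable_bound)
  have [measurable]: "h \<in> borel_measurable borel" using h by auto
  show "integrable \<mu> (\<lambda>\<xi>. (1 / (1 - cmod z)^2) *\<^sub>R h \<xi>)" using h by simp
  show "AE \<xi> in \<mu>. norm (of_real (poisson z \<xi>) * h \<xi>) \<le> norm ((1 / (1 - cmod z)^2) *\<^sub>R h \<xi>)"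
  proof (rule AE_circleI)
    fix \<xi> :: complex assume "cmod \<xi> = 1"
    then have "poisson z \<xi> * norm (h \<xi>) \<le> 1 / (1 - cmod z)^2 * norm (h \<xi>)"
      by (intro mult_right_mono poisson_bounded z) auto
    then show "norm (of_real (poisson z \<xi>) * h \<xi>) \<le> norm ((1 / (1 - cmod z)^2) *\<^sub>R h \<xi>)"
      using poisson_nonneg[OF z, of \<xi>] by (simp add: norm_mult)
  qed
  show "(\<lambda>\<xi>. of_real (poisson z \<xi>) * h \<xi>) \<in> borel_measurable \<mu>" by simp
qed

text \<open>The conjugate half of the kernel expands into the means of f \<xi>^n with n >= 1, which
  vanish. The left side gives size estimates, the right side is analytic in z.\<close>

lemma poisson_representation:
  assumes [measurable]: "f \<in> borel_measurable borel" and B: "AE \<xi> in \<mu>. cmod (f \<xi>) \<le> B" and z: "cmod z < 1"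
    and neg: "\<And>n. n \<ge> 1 \<Longrightarrow> (\<integral>\<xi>. f \<xi> * \<xi> ^ n \<partial>\<mu>) = 0"
  shows "(\<integral>\<xi>. of_real (poisson z \<xi>) * f \<xi> \<partial>\<mu>) = (\<integral>\<xi>. f \<xi> / (1 - z * cnj \<xi>) \<partial>\<mu>)"
proof -
  note K1 = geometric_kernel_sums[of f cnj B z, OF _ _ B _ z]
  have fB: "AE \<xi> in \<mu>. cmod (f \<xi> * \<xi>) \<le> B" using B AE_circle_norm by eventually_elim (simp add: norm_mult)
  have cz: "cmod (cnj z) < 1" using z by simp
  have fm: "(\<lambda>\<xi>. f \<xi> * \<xi>) \<in> borel_measurable borel" by measurable
  have K2: "(\<lambda>n. cnj z ^ n * (\<integral>\<xi>. f \<xi> * \<xi> * \<xi> ^ n \<partial>\<mu>)) sums (\<integral>\<xi>. f \<xi> * \<xi> / (1 - cnj z * \<xi>) \<partial>\<mu>)"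
    "integrable \<mu> (\<lambda>\<xi>. f \<xi> * \<xi> / (1 - cnj z * \<xi>))"
    using geometric_kernel_sums[OF fm measurable_ident_sets[OF refl, of borel] fB _ cz] by simp_all
  have "(\<integral>\<xi>. f \<xi> * \<xi> * \<xi> ^ n \<partial>\<mu>) = 0" for n using neg[of "Suc n"] by (simp add: mult_ac)
  then have z0: "(\<integral>\<xi>. f \<xi> * \<xi> / (1 - cnj z * \<xi>) \<partial>\<mu>) = 0"
    using K2(1) by (simp add: sums_iff)
  have "(\<integral>\<xi>. of_real (poisson z \<xi>) * f \<xi> \<partial>\<mu>) = (\<integral>\<xi>. f \<xi> / (1 - z * cnj \<xi>) + cnj z * (f \<xi> * \<xi> / (1 - cnj z * \<xi>)) \<partial>\<mu>)"
  proof (rule integral_cong_AE)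
    show "AE \<xi> in \<mu>. of_real (poisson z \<xi>) * f \<xi> = f \<xi> / (1 - z * cnj \<xi>) + cnj z * (f \<xi> * \<xi> / (1 - cnj z * \<xi>))"
    proof (rule AE_circleI)
      fix \<xi> :: complex assume \<xi>: "cmod \<xi> = 1"
      show "of_real (poisson z \<xi>) * f \<xi> = f \<xi> / (1 - z * cnj \<xi>) + cnj z * (f \<xi> * \<xi> / (1 - cnj z * \<xi>))"
        unfolding poisson_eq_kernels[OF \<xi> z] distrib_right by (simp add: mult_ac)
    qed
  qed measurable
  also have "\<dots> = (\<integral>\<xi>. f \<xi> / (1 - z * cnj \<xi>) \<partial>\<mu>) + cnj z * (\<integral>\<xi>. f \<xi> * \<xi> / (1 - cnj z * \<xi>) \<partial>\<mu>)"
    using K1(2) K2(2) by (subst Bochner_Integration.integral_add) (simp_all del: times_divide_eq_right)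
  finally show ?thesis by (simp add: z0)
qed

text \<open>On the circle \<xi> / (1 - z conj \<xi>) = \<xi> + z / (1 - z conj \<xi>), so a factor
  \<xi> in the integrand becomes a factor z outside.\<close>

lemma cauchy_kernel_poly:
  assumes z: "cmod z < 1"
  shows "(\<integral>\<xi>. poly Q \<xi> / (1 - z * cnj \<xi>) \<partial>\<mu>) = poly Q z"
proof (induction Q)
  case (pCons a Q)
  have ker: "(\<lambda>n. z ^ n * (\<integral>\<xi>. f \<xi> * cnj \<xi> ^ n \<partial>\<mu>)) sums (\<integral>\<xi>. f \<xi> / (1 - z * cnj \<xi>) \<partial>\<mu>)"
    "integrable \<mu> (\<lambda>\<xi>. f \<xi> / (1 - z * cnj \<xi>))" if c: "continuous_on UNIV f" for f
  proof -
    obtain B where "\<And>\<zeta>. cmod \<zeta> = 1 \<Longrightarrow> cmod (f \<zeta>) \<le> B"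
      using continuous_circle_bounded[OF continuous_on_subset[OF c subset_UNIV]] by blast
    then have "AE \<xi> in \<mu>. cmod (f \<xi>) \<le> B" by (intro AE_circleI)
    then show "(\<lambda>n. z ^ n * (\<integral>\<xi>. f \<xi> * cnj \<xi> ^ n \<partial>\<mu>)) sums (\<integral>\<xi>. f \<xi> / (1 - z * cnj \<xi>) \<partial>\<mu>)"
      "integrable \<mu> (\<lambda>\<xi>. f \<xi> / (1 - z * cnj \<xi>))"
      using geometric_kernel_sums[of f cnj B z] z borel_measurable_continuous_onI[OF c] by auto
  qed
  have "(\<integral>\<xi>. cnj \<xi> ^ n \<partial>\<mu>) = (if n = 0 then 1 else 0)" for n
    using integral_cnj_poly[of "monom 1 n"] by (simp add: poly_monom power_0_left)
  then have "(\<lambda>n. z ^ n * (\<integral>\<xi>. a * cnj \<xi> ^ n \<partial>\<mu>)) = (\<lambda>n. if n = 0 then a else 0)" by auto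
  then have a: "(\<integral>\<xi>. a / (1 - z * cnj \<xi>) \<partial>\<mu>) = a"
    using ker(1)[of "\<lambda>_. a"] sums_unique2[OF _ sums_single[of 0 "\<lambda>_. a"]] by auto
  have "(\<integral>\<xi>. \<xi> * poly Q \<xi> / (1 - z * cnj \<xi>) \<partial>\<mu>) = (\<integral>\<xi>. poly (pCons 0 Q) \<xi> + z * (poly Q \<xi> / (1 - z * cnj \<xi>)) \<partial>\<mu>)"
  proof (rule integral_cong_AE)
    show "AE \<xi> in \<mu>. \<xi> * poly Q \<xi> / (1 - z * cnj \<xi>) = poly (pCons 0 Q) \<xi> + z * (poly Q \<xi> / (1 - z * cnj \<xi>))"
    proof (rule AE_circleI)
      fix \<xi> :: complex assume \<xi>: "cmod \<xi> = 1"
      then have "cmod (z * cnj \<xi>) < 1" using z by (simp add: norm_mult)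
      then have ne: "1 - z * cnj \<xi> \<noteq> 0" by auto
      have "\<xi> = \<xi> * (1 - z * cnj \<xi>) + z" using circle_mult_cnj[OF \<xi>] by (simp add: algebra_simps)
      then have "\<xi> / (1 - z * cnj \<xi>) = \<xi> + z / (1 - z * cnj \<xi>)" using ne by (simp add: field_simps)
      then have "poly Q \<xi> * (\<xi> / (1 - z * cnj \<xi>)) = poly Q \<xi> * (\<xi> + z / (1 - z * cnj \<xi>))" by simp
      then show "\<xi> * poly Q \<xi> / (1 - z * cnj \<xi>) = poly (pCons 0 Q) \<xi> + z * (poly Q \<xi> / (1 - z * cnj \<xi>))"
        by (simp add: algebra_simps)
    qed
  qed measurable
  also have "\<dots> = (\<integral>\<xi>. poly (pCons 0 Q) \<xi> \<partial>\<mu>) + z * (\<integral>\<xi>. poly Q \<xi> / (1 - z * cnj \<xi>) \<partial>\<mu>)"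
    using ker(2)[OF continuous_on_poly[OF continuous_on_id], of Q]
    by (subst Bochner_Integration.integral_add) (simp_all del: times_divide_eq_right poly_pCons)
  also have "\<dots> = z * poly Q z" by (simp add: pCons.IH integral_poly_circle del: poly_pCons) simp
  finally have b: "(\<integral>\<xi>. \<xi> * poly Q \<xi> / (1 - z * cnj \<xi>) \<partial>\<mu>) = z * poly Q z" .
  have "(\<integral>\<xi>. poly (pCons a Q) \<xi> / (1 - z * cnj \<xi>) \<partial>\<mu>) = (\<integral>\<xi>. a / (1 - z * cnj \<xi>) + \<xi> * poly Q \<xi> / (1 - z * cnj \<xi>) \<partial>\<mu>)"
    by (simp add: add_divide_distrib)
  also have "\<dots> = a + z * poly Q z"
    using ker(2)[OF continuous_on_const, of a] ker(2)[OF continuous_on_poly[OF continuous_on_id], of "pCons 0 Q"] a b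
    by (subst Bochner_Integration.integral_add) simp_all
  finally show ?case by simp
qed simp

lemma poisson_poly:
  assumes z: "cmod z < 1"
  shows "(\<integral>\<xi>. of_real (poisson z \<xi>) * poly Q \<xi> \<partial>\<mu>) = poly Q z"
proof -
  obtain B where "\<And>\<zeta>. cmod \<zeta> = 1 \<Longrightarrow> cmod (poly Q \<zeta>) \<le> B"
    using continuous_circle_bounded[OF continuous_on_poly[OF continuous_on_id]] by blast
  then have B: "AE \<xi> in \<mu>. cmod (poly Q \<xi>) \<le> B" by (intro AE_circleI)
  have "(\<integral>\<xi>. poly Q \<xi> * \<xi> ^ n \<partial>\<mu>) = 0" if "n \<ge> 1" for n
    using integral_poly_circle[of "Q * monom 1 n"] that by (simp add: poly_monom zero_power)
  then show ?thesis using poisson_representation[OF _ B z] cauchy_kernel_poly[OF z] by simp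
qed

text \<open>Polynomials approximating f in L^1 have radial limits, and the weak type bound controls
  the Poisson integrals of the errors at all radii at once. Thresholds 2^(-k) against errors 4^(-k)
  make the measures of the exceptional sets summable, so by Borel-Cantelli almost every point lies
  in only finitely many of them.\<close>

lemma fatou_Hinf:
  assumes "\<phi> \<in> Linf" and "\<phi> \<in> Hp 2"
  shows "\<phi> \<in> Hinf"
proof -
  obtain f B where fm [measurable]: "f \<in> borel_measurable borel" and B: "AE \<xi> in \<mu>. cmod (f \<xi>) \<le> B" "B \<ge> 0" and \<phi>: "\<phi> = abs_circle_fun f"
    using assms(1) by (rule Linf_obtain)
  have neg: "(\<integral>\<xi>. f \<xi> * \<xi> ^ n \<partial>\<mu>) = 0" if "n \<ge> 1" for n
    using assms(2) that by (simp add: Hp_iff \<phi> cZ_power abs_circle_times abs_circle_cint)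
  have fint: "integrable \<mu> f" by (rule circle.integrable_const_bound[OF B(1)]) simp
  \<comment> \<open>The extension is the Cauchy integral of f: its power series gives holomorphy,
    and its equality with the Poisson integral gives the bound B.\<close>
  define F where "F z = (\<integral>\<xi>. f \<xi> / (1 - z * cnj \<xi>) \<partial>\<mu>)" for z
  have F_poisson: "F z = (\<integral>\<xi>. of_real (poisson z \<xi>) * f \<xi> \<partial>\<mu>)" if "cmod z < 1" for z
    unfolding F_def by (rule poisson_representation[OF fm B(1) that neg, symmetric])
  have holF: "F holomorphic_on ball 0 1"
  proof (rule power_series_holomorphic)
    fix z :: complex assume "z \<in> ball 0 1"
    then have "cmod z < 1" by simp
    from geometric_kernel_sums(1)[OF fm measurable_cnj B(1) _ this]
    show "(\<lambda>n. (\<integral>\<xi>. f \<xi> * cnj \<xi> ^ n \<partial>\<mu>) * (z - 0) ^ n) sums F z"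
      by (simp add: F_def mult.commute)
  qed
  have poisson_mass: "(\<integral>\<xi>. poisson z \<xi> \<partial>\<mu>) = 1" if "cmod z < 1" for z
    using poisson_poly[OF that, of 1] by simp
  have poisson_int: "integrable \<mu> (\<lambda>\<xi>. poisson z \<xi> * u \<xi>)" if "cmod z < 1" "integrable \<mu> u" for z and u :: "complex \<Rightarrow> real"
    using poisson_mult_integrable[OF that] by simp
  have diff_le: "cmod (F z - poly Q z) \<le> (\<integral>\<xi>. poisson z \<xi> * cmod (f \<xi> - poly Q \<xi>) \<partial>\<mu>)" if z: "cmod z < 1" for z Q
  proof -
    have "F z - poly Q z = (\<integral>\<xi>. of_real (poisson z \<xi>) * (f \<xi> - poly Q \<xi>) \<partial>\<mu>)"
      using F_poisson[OF z] poisson_poly[OF z, of Q] poisson_mult_integrable[OF z fint] poisson_mult_integrable[OF z poly_integrable[of Q]]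
      by (simp add: right_diff_distrib)
    also have "cmod \<dots> \<le> (\<integral>\<xi>. cmod (of_real (poisson z \<xi>) * (f \<xi> - poly Q \<xi>)) \<partial>\<mu>)" by (rule integral_norm_bound)
    finally show ?thesis using poisson_nonneg[OF z] by (simp add: norm_mult)
  qed
  have Fb: "cmod (F z) \<le> B" if "z \<in> ball 0 1" for z
  proof -
    have z: "cmod z < 1" using that by simp
    have "cmod (F z) \<le> (\<integral>\<xi>. poisson z \<xi> * cmod (f \<xi>) \<partial>\<mu>)" using diff_le[OF z, of 0] by simp
    also have "\<dots> \<le> (\<integral>\<xi>. poisson z \<xi> * B \<partial>\<mu>)"
    proof (rule integral_mono_AE)
      show "AE \<xi> in \<mu>. poisson z \<xi> * cmod (f \<xi>) \<le> poisson z \<xi> * B"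
        using B(1) by eventually_elim (use poisson_nonneg[OF z] in \<open>auto intro: mult_left_mono\<close>)
      show "integrable \<mu> (\<lambda>\<xi>. poisson z \<xi> * cmod (f \<xi>))" using fint by (intro poisson_int z) auto
      show "integrable \<mu> (\<lambda>\<xi>. poisson z \<xi> * B)" by (intro poisson_int z) auto
    qed
    also have "\<dots> = B" using poisson_mass[OF z] by simp
    finally show ?thesis .
  qed
  obtain Qs where Qs: "(\<lambda>n. lp_norm 2 (\<phi> - cpoly (Qs n))) \<longlonglongrightarrow> 0"
    using Hp_poly_dense[OF _ assms(2)] by auto
  have "\<exists>Q. (\<integral>\<xi>. cmod (f \<xi> - poly Q \<xi>) \<partial>\<mu>) < (1/4)^k" for k :: nat
  proof -
    have "eventually (\<lambda>n. lp_norm 2 (\<phi> - cpoly (Qs n)) < (1/4)^k) sequentially"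
      using order_tendstoD(2)[OF Qs, of "(1/4)^k"] by simp
    then obtain n where n: "lp_norm 2 (\<phi> - cpoly (Qs n)) < (1/4)^k" by (auto simp: eventually_sequentially)
    have "\<phi> - cpoly (Qs n) \<in> Lp 2" using assms(2) by (intro Lp_diff) (auto simp: Hp_Lp cpoly_Lp)
    then have "lp_norm 1 (\<phi> - cpoly (Qs n)) < (1/4)^k" using Lp_mono(2)[of _ 2 1] n by fastforce
    then show ?thesis by (intro exI[of _ "Qs n"]) (simp add: \<phi> cpoly_def abs_circle_minus lp_norm_1_eq)
  qed
  then obtain Q where Q: "\<And>k. (\<integral>\<xi>. cmod (f \<xi> - poly (Q k) \<xi>) \<partial>\<mu>) < (1/4)^k" by metis
  define h where "h k \<xi> = cmod (f \<xi> - poly (Q k) \<xi>)" for k \<xi>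
  have hint: "integrable \<mu> (h k)" for k unfolding h_def using fint by simp
  have [measurable]: "h k \<in> borel_measurable borel" for k unfolding h_def by measurable
  have hQ: "(\<integral>\<xi>. h k \<xi> \<partial>\<mu>) / (1/2)^k \<le> (1/2)^k" for k
  proof -
    have "(1/4::real)^k = (1/2)^k * (1/2)^k" by (simp add: power_mult_distrib[symmetric])
    then show ?thesis using Q[of k] by (simp add: h_def field_simps)
  qed
  have "\<exists>E. E \<in> sets borel \<and> measure \<mu> E \<le> 10 * (1/2)^k \<and>
      (\<forall>\<zeta> \<rho>. cmod \<zeta> = 1 \<longrightarrow> \<zeta> \<notin> E \<longrightarrow> \<rho> > 0 \<longrightarrow> (\<integral>\<xi>. indicator (ball \<zeta> \<rho>) \<xi> * h k \<xi> \<partial>\<mu>) \<le> (1/2)^k * \<rho>)" for k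
  proof (rule maximal_weak_type[OF hint[of k], of "(1/2)^k"])
    fix E assume "E \<in> sets borel" "measure \<mu> E \<le> 10 * (\<integral>\<xi>. h k \<xi> \<partial>\<mu>) / (1/2)^k"
      "\<And>\<zeta> \<rho>. cmod \<zeta> = 1 \<Longrightarrow> \<zeta> \<notin> E \<Longrightarrow> \<rho> > 0 \<Longrightarrow> (\<integral>\<xi>. indicator (ball \<zeta> \<rho>) \<xi> * h k \<xi> \<partial>\<mu>) \<le> (1/2)^k * \<rho>"
    moreover have "10 * (\<integral>\<xi>. h k \<xi> \<partial>\<mu>) / (1/2)^k \<le> 10 * (1/2)^k" using hQ[of k] by linarith
    ultimately show ?thesis by (intro exI[of _ E]) (meson order_trans)
  qed (auto simp: h_def)
  then obtain E where E: "\<And>k. E k \<in> sets borel" "\<And>k. measure \<mu> (E k) \<le> 10 * (1/2)^k"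
      "\<And>k \<zeta> \<rho>. cmod \<zeta> = 1 \<Longrightarrow> \<zeta> \<notin> E k \<Longrightarrow> \<rho> > 0 \<Longrightarrow> (\<integral>\<xi>. indicator (ball \<zeta> \<rho>) \<xi> * h k \<xi> \<partial>\<mu>) \<le> (1/2)^k * \<rho>"
    by metis
  \<comment> \<open>Besides the maximal estimate, |f - Q k| must be small at the boundary point
    itself; Chebyshev bounds the measure of the set where it is not.\<close>
  define A where "A k = {\<xi>. h k \<xi> \<ge> (1/2)^k}" for k
  have Am: "A k \<in> sets borel" for k unfolding A_def by measurable
  have Ab: "measure \<mu> (A k) \<le> (1/2)^k" for k
  proof -
    have "measure \<mu> (A k) \<le> (\<integral>\<xi>. h k \<xi> \<partial>\<mu>) / (1/2)^k"
    proof -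
      have "(1/2)^k * measure \<mu> (A k) = (\<integral>\<xi>. (1/2)^k * indicator (A k) \<xi> \<partial>\<mu>)" using Am by simp
      also have "\<dots> \<le> (\<integral>\<xi>. h k \<xi> \<partial>\<mu>)"
        by (rule integral_mono'[OF hint]) (auto simp: A_def indicator_def h_def)
      finally show ?thesis by (simp add: field_simps)
    qed
    with hQ[of k] show ?thesis by linarith
  qed
  define G where "G k = E k \<union> A k" for k
  have Gm: "G k \<in> sets \<mu>" for k using E Am by (auto simp: G_def)
  have Gb: "measure \<mu> (G k) \<le> 11 * (1/2)^k" for k
    unfolding G_def using measure_Un_le[of "E k" \<mu> "A k"] E(1,2)[of k] Am[of k] Ab[of k] by simp
  have "AE \<xi> in \<mu>. eventually (\<lambda>k. \<xi> \<in> space \<mu> - G k) sequentially"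
  proof (rule borel_cantelli_AE1[OF Gm])
    have "summable (\<lambda>k. 11 * (1/2::real)^k)" by (intro summable_mult summable_geometric) simp
    then show "summable (\<lambda>k. measure \<mu> (G k))" by (rule summable_comparison_test'[of _ 0]) (use Gb in simp)
    show "emeasure \<mu> (G k) < \<infinity>" for k by (simp add: circle.emeasure_eq_measure)
  qed
  then have "AE \<zeta> in \<mu>. ((\<lambda>r. F (of_real r * \<zeta>)) \<longlongrightarrow> f \<zeta>) (at_left 1)"
    using AE_circle_norm
  proof eventually_elim
    case (elim \<zeta>)
    then have \<zeta>: "cmod \<zeta> = 1" by simp
    show ?case
    proof (rule tendstoI)
      fix e :: real assume e: "e > 0"
      \<comment> \<open>65 = 64 + 1: the Poisson estimate along the radius and the error at \<zeta>.
        The other half of e is left for the continuity of the polynomial.\<close>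
      have "(\<lambda>k. 65 * (1/2::real)^k) \<longlonglongrightarrow> 65 * 0" by (intro tendsto_intros LIMSEQ_realpow_zero) auto
      from order_tendstoD(2)[OF this, of "e / 2"]
      have "eventually (\<lambda>k. 65 * (1/2::real)^k < e / 2) sequentially" using e by simp
      then have "eventually (\<lambda>k. 65 * (1/2::real)^k < e / 2 \<and> \<zeta> \<in> space \<mu> - G k) sequentially"
        using elim(1) by eventually_elim simp
      then obtain k where k: "65 * (1/2::real)^k < e / 2" "\<zeta> \<notin> G k" by (auto simp: eventually_sequentially)
      have kE: "\<zeta> \<notin> E k" and kA: "h k \<zeta> < (1/2)^k" using k(2) by (auto simp: G_def A_def)
      have "((\<lambda>r. poly (Q k) (of_real r * \<zeta>)) \<longlongrightarrow> poly (Q k) (of_real 1 * \<zeta>)) (at_left 1)"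
        by (intro tendsto_intros)
      then have "eventually (\<lambda>r. dist (poly (Q k) (of_real r * \<zeta>)) (poly (Q k) \<zeta>) < e / 2) (at_left 1)"
        using e by (intro tendstoD) auto
      moreover have "eventually (\<lambda>r::real. 0 < r \<and> r < 1) (at_left 1)"
        by (auto simp: eventually_at_left[of 0 "1::real"] intro!: exI[of _ 0])
      ultimately show "eventually (\<lambda>r. dist (F (of_real r * \<zeta>)) (f \<zeta>) < e) (at_left 1)"
      proof eventually_elim
        case (elim r)
        have rz: "cmod (of_real r * \<zeta>) < 1" using elim \<zeta> by (simp add: norm_mult)
        have "cmod (F (of_real r * \<zeta>) - poly (Q k) (of_real r * \<zeta>)) \<le> (\<integral>\<xi>. poisson (of_real r * \<zeta>) \<xi> * h k \<xi> \<partial>\<mu>)"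
          unfolding h_def by (rule diff_le[OF rz])
        also have "\<dots> \<le> 64 * (1/2)^k"
          using elim by (intro poisson_integral_le_maximal[OF hint _ \<zeta>] E(3) \<zeta> kE) (auto simp: h_def)
        finally have 1: "dist (F (of_real r * \<zeta>)) (poly (Q k) (of_real r * \<zeta>)) \<le> 64 * (1/2)^k" by (simp add: dist_norm)
        have 2: "dist (poly (Q k) \<zeta>) (f \<zeta>) \<le> (1/2)^k" using kA by (simp add: h_def dist_norm norm_minus_commute)
        have "dist (F (of_real r * \<zeta>)) (f \<zeta>) \<le> dist (F (of_real r * \<zeta>)) (poly (Q k) (of_real r * \<zeta>)) +
            dist (poly (Q k) (of_real r * \<zeta>)) (poly (Q k) \<zeta>) + dist (poly (Q k) \<zeta>) (f \<zeta>)"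
          by (meson add_mono dist_triangle dist_triangle2 order_refl order_trans)
        then show "dist (F (of_real r * \<zeta>)) (f \<zeta>) < e" using 1 2 elim(1) k(1) by linarith
      qed
    qed
  qed
  then show ?thesis unfolding \<phi> by (intro HinfI[OF holF Fb fm])
qed

section \<open>Factorization of polynomials\<close>

text \<open>On the circle h and g have moduli |G|^(1/q) and |G|^(1/p), so that the L^q norm of h and
  the L^p norm of g multiply to the L^1 norm of G. The conditions are multiplicative in G, which
  reduces existence to constants and linear factors.\<close>

definition power_factor :: "real \<Rightarrow> real \<Rightarrow> complex poly \<Rightarrow> (complex \<Rightarrow> complex) \<Rightarrow> (complex \<Rightarrow> complex) \<Rightarrow> bool" where
  "power_factor p q G h g \<longleftrightarrow> h \<in> borel_measurable borel \<and> g \<in> borel_measurable borel \<and>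
     abs_circle_fun h \<in> Hinf \<and> abs_circle_fun g \<in> Hinf \<and>
     (\<forall>\<zeta>. cmod \<zeta> = 1 \<longrightarrow> poly G \<zeta> = h \<zeta> * g \<zeta> \<and> cmod (h \<zeta>) powr q = cmod (poly G \<zeta>) \<and> cmod (g \<zeta>) powr p = cmod (poly G \<zeta>))"

lemma power_factor_mult:
  assumes "power_factor p q G h g" "power_factor p q G' h' g'"
  shows "power_factor p q (G * G') (\<lambda>\<zeta>. h \<zeta> * h' \<zeta>) (\<lambda>\<zeta>. g \<zeta> * g' \<zeta>)"
proof -
  have m: "h \<in> borel_measurable borel" "g \<in> borel_measurable borel" "h' \<in> borel_measurable borel" "g' \<in> borel_measurable borel"
    using assms by (auto simp: power_factor_def)
  have "abs_circle_fun (\<lambda>\<zeta>. h \<zeta> * h' \<zeta>) \<in> Hinf" "abs_circle_fun (\<lambda>\<zeta>. g \<zeta> * g' \<zeta>) \<in> Hinf"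
    using assms Hinf_mult[of "abs_circle_fun h" "abs_circle_fun h'"] Hinf_mult[of "abs_circle_fun g" "abs_circle_fun g'"] m
    by (auto simp: power_factor_def abs_circle_times)
  then show ?thesis using assms m unfolding power_factor_def
    by (auto simp: norm_mult powr_mult)
qed

lemma power_factor_const:
  assumes pq: "p > 0" "q > 0" "1/p + 1/q = 1"
  shows "\<exists>h g. power_factor p q [:c:] h g"
proof (cases "c = 0")
  case True
  have "abs_circle_fun (\<lambda>_. 0) \<in> Hinf" using Hinf_const[of 0] by (simp add: circle_zero_abs)
  then show ?thesis using True pq by (intro exI[of _ "\<lambda>_. 0"]) (simp add: power_factor_def)
next
  case False
  define a where "a = cmod c powr (1/q)"
  have a: "a > 0" using False by (simp add: a_def)
  have "cmod c = cmod c powr (1/p) * a" using False pq(3) by (simp add: a_def powr_add[symmetric])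
  then have "cmod c / a = cmod c powr (1/p)" using a by (simp add: field_simps)
  then have "(cmod c / a) powr p = cmod c" "a powr q = cmod c" using pq by (simp_all add: powr_powr a_def)
  then have "power_factor p q [:c:] (\<lambda>_. of_real a) (\<lambda>_. c / of_real a)"
    using a by (simp add: power_factor_def circle_const_abs[symmetric] norm_divide)
  then show ?thesis by blast
qed

text \<open>A branch of (1 - b z)^s. For |b| <= 1 and |z| < 1 the base has positive real part, so
  the principal branch is holomorphic in the disc; for s > 0 it is continuous up to the circle, also
  at a zero of the base.\<close>

definition one_minus_power :: "complex \<Rightarrow> real \<Rightarrow> complex \<Rightarrow> complex" where
  "one_minus_power b s z = (1 - b * z) powr (of_real s)"

lemma norm_one_minus_power: "s > 0 \<Longrightarrow> cmod (one_minus_power b s z) = cmod (1 - b * z) powr s"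
  by (cases "1 - b * z = 0") (simp_all add: one_minus_power_def powr_def)

lemma one_minus_power_mult: "s + t = 1 \<Longrightarrow> one_minus_power b s z * one_minus_power b t z = 1 - b * z"
proof -
  assume "s + t = 1"
  then have "one_minus_power b s z * one_minus_power b t z = (1 - b * z) powr 1"
    unfolding one_minus_power_def by (subst powr_add[symmetric]) (simp flip: of_real_add)
  then show ?thesis by simp
qed

lemma Re_one_minus:
  assumes "cmod b \<le> 1" "cmod z \<le> 1"
  shows "0 \<le> Re (1 - b * z)" "cmod z < 1 \<Longrightarrow> 0 < Re (1 - b * z)"
proof -
  have "Re (b * z) \<le> cmod (b * z)" by (rule complex_Re_le_cmod)
  moreover have "cmod (b * z) \<le> 1 * cmod z" unfolding norm_mult using assms by (intro mult_right_mono) auto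
  ultimately show "0 \<le> Re (1 - b * z)" "cmod z < 1 \<Longrightarrow> 0 < Re (1 - b * z)" using assms by simp_all
qed

lemma one_minus_power_holomorphic:
  assumes b: "cmod b \<le> 1" shows "one_minus_power b s holomorphic_on ball 0 1"
  unfolding one_minus_power_def
proof (intro holomorphic_intros)
  fix z :: complex assume "z \<in> ball 0 1"
  then show "1 - b * z \<notin> \<real>\<^sub>\<le>\<^sub>0" using Re_one_minus(2)[OF b, of z] by (auto simp: complex_nonpos_Reals_iff)
qed

lemma one_minus_power_continuous:
  assumes b: "cmod b \<le> 1" and s: "s > 0" shows "continuous_on (cball 0 1) (one_minus_power b s)"
  unfolding one_minus_power_def
proof (rule continuous_on_powr_complex)
  show "cball 0 1 \<subseteq> {z. 0 \<le> Re (1 - b * z) \<or> Im (1 - b * z) \<noteq> 0}" using Re_one_minus(1)[OF b] by auto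
qed (use s in \<open>auto intro!: continuous_intros\<close>)

lemma power_factor_continuousI:
  assumes h: "H holomorphic_on ball 0 1" "continuous_on (cball 0 1) H" and g: "K holomorphic_on ball 0 1" "continuous_on (cball 0 1) K"
    and eq: "\<And>\<zeta>. cmod \<zeta> = 1 \<Longrightarrow> poly G \<zeta> = H \<zeta> * K \<zeta> \<and> cmod (H \<zeta>) powr q = cmod (poly G \<zeta>) \<and> cmod (K \<zeta>) powr p = cmod (poly G \<zeta>)"
  shows "\<exists>h g. power_factor p q G h g"
proof -
  define h where "h \<zeta> = indicator (cball 0 1) \<zeta> *\<^sub>R H \<zeta>" for \<zeta>
  define g where "g \<zeta> = indicator (cball 0 1) \<zeta> *\<^sub>R K \<zeta>" for \<zeta>
  have m: "h \<in> borel_measurable borel" "g \<in> borel_measurable borel" unfolding h_def[abs_def] g_def[abs_def]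
    using assms by (auto intro!: borel_measurable_continuous_on_indicator)
  have hg: "h \<zeta> = H \<zeta>" "g \<zeta> = K \<zeta>" if "cmod \<zeta> = 1" for \<zeta> using that by (auto simp: h_def g_def)
  have "abs_circle_fun h \<in> Hinf" "abs_circle_fun g \<in> Hinf"
    using Hinf_continuousI[OF h m(1)] Hinf_continuousI[OF g m(2)] hg by auto
  then have "power_factor p q G h g" using m eq hg by (simp add: power_factor_def)
  then show ?thesis by blast
qed

lemma power_factor_one_minus:
  assumes pq: "p > 0" "q > 0" "1/p + 1/q = 1" and b: "cmod b \<le> 1"
  shows "\<exists>h g. power_factor p q [:1, - b:] h g"
proof (rule power_factor_continuousI[of "one_minus_power b (1/q)" "one_minus_power b (1/p)"])
  fix \<zeta> :: complex
  have e: "poly [:1, - b:] \<zeta> = 1 - b * \<zeta>" by (simp add: mult.commute)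
  show "poly [:1, - b:] \<zeta> = one_minus_power b (1/q) \<zeta> * one_minus_power b (1/p) \<zeta> \<and>
    cmod (one_minus_power b (1/q) \<zeta>) powr q = cmod (poly [:1, - b:] \<zeta>) \<and>
    cmod (one_minus_power b (1/p) \<zeta>) powr p = cmod (poly [:1, - b:] \<zeta>)"
    unfolding e using pq one_minus_power_mult[of "1/q" "1/p" b \<zeta>] by (simp add: norm_one_minus_power powr_powr)
qed (use pq b in \<open>auto intro: one_minus_power_holomorphic one_minus_power_continuous\<close>)

text \<open>A zero inside the disc is moved into a Blaschke factor, which is unimodular on the circle.\<close>

lemma power_factor_linear:
  assumes pq: "p > 0" "q > 0" "1/p + 1/q = 1"
  shows "\<exists>h g. power_factor p q [:- a, 1:] h g"
proof (cases "cmod a < 1")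
  case True
  define b where "b = cnj a"
  have b: "cmod b < 1" "cmod b \<le> 1" using True by (auto simp: b_def)
  have ne: "1 - b * z \<noteq> 0" if "cmod z \<le> 1" for z
  proof
    assume "1 - b * z = 0"
    then have "cmod b * cmod z = 1" by (metis eq_iff_diff_eq_0 norm_mult norm_one)
    moreover have "cmod b * cmod z \<le> cmod b * 1" using that by (intro mult_left_mono) auto
    ultimately show False using b by simp
  qed
  define K where "K z = (z - a) / (1 - b * z) * one_minus_power b (1/p) z" for z
  show ?thesis
  proof (rule power_factor_continuousI[of "one_minus_power b (1/q)" K])
    show "one_minus_power b (1/q) holomorphic_on ball 0 1" "continuous_on (cball 0 1) (one_minus_power b (1/q))"
      using b pq by (auto intro: one_minus_power_holomorphic one_minus_power_continuous)
    show "K holomorphic_on ball 0 1" unfolding K_def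
      by (intro holomorphic_intros one_minus_power_holomorphic b) (use ne in auto)
    show "continuous_on (cball 0 1) K" unfolding K_def
      by (intro continuous_intros one_minus_power_continuous b) (use ne pq in auto)
    fix \<zeta> :: complex assume \<zeta>: "cmod \<zeta> = 1"
    \<comment> \<open>Hence (z - a)/(1 - b z) is unimodular on the circle and can be attached to one
      of the two powers without changing moduli.\<close>
    have "\<zeta> - a = \<zeta> * cnj (1 - b * \<zeta>)" using circle_mult_cnj[OF \<zeta>] by (simp add: b_def right_diff_distrib mult.left_commute)
    then have n: "cmod (\<zeta> - a) = cmod (1 - b * \<zeta>)" using \<zeta> by (simp only: norm_mult complex_mod_cnj mult_1)
    have ne1: "1 - b * \<zeta> \<noteq> 0" using ne \<zeta> by simp
    have "one_minus_power b (1/q) \<zeta> * K \<zeta> = (\<zeta> - a) / (1 - b * \<zeta>) * (one_minus_power b (1/q) \<zeta> * one_minus_power b (1/p) \<zeta>)"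
      by (simp add: K_def mult_ac)
    also have "one_minus_power b (1/q) \<zeta> * one_minus_power b (1/p) \<zeta> = 1 - b * \<zeta>"
      using pq by (intro one_minus_power_mult) simp
    finally have 1: "poly [:- a, 1:] \<zeta> = one_minus_power b (1/q) \<zeta> * K \<zeta>" using ne1 by simp
    have "cmod (K \<zeta>) = cmod (one_minus_power b (1/p) \<zeta>)" using ne1 n by (simp add: K_def norm_mult norm_divide)
    with 1 show "poly [:- a, 1:] \<zeta> = one_minus_power b (1/q) \<zeta> * K \<zeta> \<and>
      cmod (one_minus_power b (1/q) \<zeta>) powr q = cmod (poly [:- a, 1:] \<zeta>) \<and> cmod (K \<zeta>) powr p = cmod (poly [:- a, 1:] \<zeta>)"
      using pq n by (simp add: norm_one_minus_power powr_powr)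
  qed
next
  case False
  then have a: "a \<noteq> 0" "cmod (1 / a) \<le> 1" by (auto simp: norm_divide divide_le_eq_1 not_less)
  obtain h g where 1: "power_factor p q [:- a:] h g" using power_factor_const[OF pq] by blast
  obtain h' g' where 2: "power_factor p q [:1, - (1 / a):] h' g'" using power_factor_one_minus[OF pq a(2)] by blast
  \<comment> \<open>For a zero outside the open disc, 1 - z/a has nonnegative real part on the
    closed disc and its powers are available directly.\<close>
  have "[:- a:] * [:1, - (1 / a):] = [:- a, 1:]" using a by simp
  then show ?thesis using power_factor_mult[OF 1 2] by auto
qed

lemma power_factor_exists:
  assumes pq: "p > 0" "q > 0" "1/p + 1/q = 1"
  shows "\<exists>h g. power_factor p q G h g"
proof (induction "degree G" arbitrary: G)
  case 0
  then obtain c where "G = [:c:]" using degree_0_id by metis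
  then show ?case using power_factor_const[OF pq] by simp
next
  case (Suc n)
  then have "\<not> constant (poly G)" by (simp add: constant_degree)
  then obtain a where "poly G a = 0" using fundamental_theorem_of_algebra by blast
  then obtain G' where G': "G = [:- a, 1:] * G'" by (auto simp: poly_eq_0_iff_dvd dvd_def)
  then have "G' \<noteq> 0" using Suc.hyps(2) by auto
  then have "degree G = Suc (degree G')" unfolding G' by (subst degree_mult_eq) auto
  then have "n = degree G'" using Suc.hyps(2) by simp
  then obtain h g where "power_factor p q G' h g" using Suc.hyps(1) by blast
  then show ?case using power_factor_linear[OF pq, of a] power_factor_mult G' by blast
qed

section \<open>The commutant\<close>

lemma cZ_mult_Hp:
  assumes p: "p > 1" and f: "f \<in> Hp p" shows "cZ * f \<in> Hp0 p"
  unfolding Hp0_iff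
proof (intro conjI allI)
  show "cZ * f \<in> Lp p" using p f by (intro Lp_mult) (auto simp: Hp_Lp)
  fix n
  have "cZ * f * cZ ^ n = f * cZ ^ Suc n" by (simp add: mult_ac)
  then show "cint (cZ * f * cZ ^ n) = 0" using f unfolding Hp_iff by (metis le_add1 plus_1_eq_Suc)
qed

context
  fixes p :: real and I :: circle_fun
  assumes p: "1 < p" and I: "inner_function I"
begin

private abbreviation (input) K where "K \<equiv> model_space p I"
private abbreviation (input) S where "S \<equiv> restrict (backward_shift p) K"

text \<open>The map \<open>g \<mapsto> P\<^sub>+ (I g\<^sup>*)\<close>, with \<open>g\<^sup>*\<close> the conjugate of \<open>g\<close>, is a conjugate-linear surjection of
  \<open>Hp0\<close> onto the model space which intertwines multiplication by \<open>z\<close> with the backward shift.\<close>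

definition model_proj :: "circle_fun \<Rightarrow> circle_fun" where "model_proj g = riesz_projection p (I * circle_cnj g)"

lemma I_Hinf: "I \<in> Hinf" and I_cnj: "I * circle_cnj I = 1" and I_Linf: "I \<in> Linf"
  using I unimodular_cnj_mult Hinf_Linf by (auto simp: inner_function_def)

lemma Hp0_Lp: "g \<in> Hp0 p \<Longrightarrow> g \<in> Lp p"
  by (simp add: Hp0_Hp Hp_Lp)

lemma I_cnj_Lp: "g \<in> Lp p \<Longrightarrow> I * circle_cnj g \<in> Lp p"
  by (intro Lp_mult exponent_bounds[OF p] I_Linf Lp_cnj)

lemma model_space_obtain:
  assumes "k \<in> K" obtains g where "g \<in> Hp0 p" "k = I * circle_cnj g" "k \<in> Hp p"
  using assms by (auto simp: model_space_def)

lemma model_spaceI: "g \<in> Hp0 p \<Longrightarrow> k = I * circle_cnj g \<Longrightarrow> k \<in> Hp p \<Longrightarrow> k \<in> K"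
  by (simp add: model_space_def)

lemma model_space_Hp: "k \<in> K \<Longrightarrow> k \<in> Hp p"
  by (auto simp: model_space_def)

lemma model_space_Lp: "k \<in> K \<Longrightarrow> k \<in> Lp p"
  by (auto simp: model_space_def Hp_Lp)

text \<open>The discarded part of I conj g is conj u with u in \<open>Hp0 p\<close>, and conj u = I
  conj (I u) because I is unimodular. Subtracting it replaces g by g - I u, so the projection has
  the form required by \<open>model_space\<close>.\<close>

lemma model_proj_mem:
  assumes g: "g \<in> Hp0 p" shows "model_proj g \<in> K"
proof -
  have L: "I * circle_cnj g \<in> Lp p" by (rule I_cnj_Lp[OF Hp0_Lp[OF g]])
  define u where "u = circle_cnj (I * circle_cnj g - riesz_projection p (I * circle_cnj g))"
  have u: "u \<in> Hp0 p" unfolding u_def by (rule riesz_projection_complement[OF p L])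
  have "circle_cnj u = (I * circle_cnj I) * circle_cnj u" by (simp add: I_cnj)
  then have "riesz_projection p (I * circle_cnj g) = I * circle_cnj (g - I * u)"
    by (simp add: u_def algebra_simps)
  moreover have "g - I * u \<in> Hp0 p" by (intro Hp0_diff exponent_bounds[OF p] g Hinf_mult_Hp0[OF p I_Hinf u])
  ultimately show ?thesis
    unfolding model_proj_def using riesz_projection_Hp[OF p L] by (intro model_spaceI)
qed

lemma model_proj_add:
  assumes "f \<in> Hp0 p" "g \<in> Hp0 p" shows "model_proj (f + g) = model_proj f + model_proj g"
  using riesz_projection_add[OF p I_cnj_Lp[OF Hp0_Lp[OF assms(1)]] I_cnj_Lp[OF Hp0_Lp[OF assms(2)]]]
  by (simp add: model_proj_def distrib_left)

lemma model_proj_scale: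
  assumes "f \<in> Hp0 p" shows "model_proj (circle_const c * f) = circle_const (cnj c) * model_proj f"
  using riesz_projection_scale[OF p I_cnj_Lp[OF Hp0_Lp[OF assms]], of "cnj c"]
  by (simp add: model_proj_def mult_ac)

lemma model_proj_mult:
  assumes g: "g \<in> Hp0 p" and \<phi>: "\<phi> \<in> Hinf"
  shows "riesz_projection p (circle_cnj \<phi> * model_proj g) = model_proj (\<phi> * g)"
  unfolding model_proj_def using riesz_projection_cnj_Hinf_absorb[OF p \<phi> I_cnj_Lp[OF Hp0_Lp[OF g]]] by (simp add: mult_ac)

lemma model_proj_bounded: "\<exists>C\<ge>0. \<forall>g\<in>Hp0 p. lp_norm p (model_proj g) \<le> C * lp_norm p g"
proof -
  obtain C where C: "C \<ge> 0" "\<And>f. f \<in> Lp p \<Longrightarrow> lp_norm p (riesz_projection p f) \<le> C * lp_norm p f" using riesz_projection_bounded[OF p] by blast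
  obtain B where B: "B \<ge> 0" "\<And>f. f \<in> Lp p \<Longrightarrow> lp_norm p (I * f) \<le> B * lp_norm p f" using Lp_Linf_mult[OF exponent_bounds(3)[OF p] I_Linf] by blast
  have "lp_norm p (model_proj g) \<le> C * B * lp_norm p g" if "g \<in> Hp0 p" for g
  proof -
    have "lp_norm p (model_proj g) \<le> C * lp_norm p (I * circle_cnj g)"
      unfolding model_proj_def by (rule C(2)[OF I_cnj_Lp[OF Hp0_Lp[OF that]]])
    also have "\<dots> \<le> C * (B * lp_norm p (circle_cnj g))"
      by (intro mult_left_mono B C Lp_cnj Hp0_Lp that)
    finally show ?thesis by (simp add: mult.assoc)
  qed
  then show ?thesis using B C by (intro exI[of _ "C * B"]) auto
qed

lemma model_space_add: "f \<in> K \<Longrightarrow> g \<in> K \<Longrightarrow> f + g \<in> K"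
proof -
  assume "f \<in> K" "g \<in> K"
  then obtain f' g' where f: "f' \<in> Hp0 p" "f = I * circle_cnj f'" "f \<in> Hp p" and g: "g' \<in> Hp0 p" "g = I * circle_cnj g'" "g \<in> Hp p"
    by (metis model_space_obtain)
  have "f + g \<in> Hp p" by (intro Hp_add exponent_bounds[OF p] f g)
  moreover have "f + g = I * circle_cnj (f' + g')" by (simp add: f g distrib_left)
  ultimately show "f + g \<in> K" using Hp0_add[OF exponent_bounds(1)[OF p] f(1) g(1)] by (intro model_spaceI)
qed

lemma model_space_scale: "f \<in> K \<Longrightarrow> circle_const c * f \<in> K"
proof -
  assume "f \<in> K"
  then obtain f' where f: "f' \<in> Hp0 p" "f = I * circle_cnj f'" "f \<in> Hp p" by (metis model_space_obtain)
  have "circle_const c * f \<in> Hp p" by (intro Hp_const_mult exponent_bounds[OF p] f)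
  moreover have "circle_const c * f = I * circle_cnj (circle_const (cnj c) * f')" by (simp add: f mult_ac)
  ultimately show ?thesis using Hp0_const_mult[OF exponent_bounds(1)[OF p] f(1)] by (intro model_spaceI)
qed

text \<open>For k = I conj g the image is \<open>model_proj\<close> of \<phi> g, and \<phi> g stays
  in \<open>Hp0 p\<close>.\<close>

lemma riesz_projection_cnj_model_space:
  assumes \<phi>: "\<phi> \<in> Hinf" and k: "k \<in> K"
  shows "riesz_projection p (circle_cnj \<phi> * k) \<in> K"
proof -
  obtain g where g: "g \<in> Hp0 p" "k = I * circle_cnj g" "k \<in> Hp p" using k by (rule model_space_obtain)
  have "riesz_projection p (circle_cnj \<phi> * k) = model_proj (\<phi> * g)" by (simp add: g(2) model_proj_def mult_ac)
  then show ?thesis using model_proj_mem[OF Hinf_mult_Hp0[OF p \<phi> g(1)]] by simp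
qed

lemma shift_eq: "k \<in> K \<Longrightarrow> S k = riesz_projection p (circle_cnj cZ * k)"
  using backward_shift_eq[OF p] by (auto simp: model_space_def)

lemma shift_mem: "k \<in> K \<Longrightarrow> riesz_projection p (circle_cnj cZ * k) \<in> K"
  by (rule riesz_projection_cnj_model_space[OF Hinf_cZ])

text \<open>Absorbing the inner projection turns both compositions into the projection of conj
  \<phi> conj z k.\<close>

lemma toeplitz_in_commutant:
  assumes \<phi>: "\<phi> \<in> Hinf"
  shows "restrict (toeplitz p (circle_cnj \<phi>)) K \<in> commutant p K S"
proof -
  define T where "T = restrict (toeplitz p (circle_cnj \<phi>)) K"
  have T: "T k = riesz_projection p (circle_cnj \<phi> * k)" if "k \<in> K" for k using that by (simp add: T_def toeplitz_def)
  have TK: "T k \<in> K" if "k \<in> K" for k using riesz_projection_cnj_model_space[OF \<phi> that] T[OF that] by simp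
  have L: "circle_cnj \<phi> * k \<in> Lp p" if "k \<in> K" for k by (rule Lp_cnj_Hinf_mult[OF p \<phi> model_space_Lp[OF that]])
  have "T \<in> bounded_operators p K"
    unfolding bounded_operators_def
  proof (intro CollectI conjI ballI allI)
    show "T \<in> K \<rightarrow>\<^sub>E K" using TK by (auto simp: T_def)
    show "T (f + g) = T f + T g" if "f \<in> K" "g \<in> K" for f g
      using riesz_projection_add[OF p L L] that by (simp add: T model_space_add distrib_left)
    show "T (circle_const c * f) = circle_const c * T f" if "f \<in> K" for c f
      using riesz_projection_scale[OF p L[OF that], of c] that by (simp add: T model_space_scale mult.left_commute)
    obtain C where C: "C \<ge> 0" "\<And>f. f \<in> Lp p \<Longrightarrow> lp_norm p (riesz_projection p f) \<le> C * lp_norm p f" using riesz_projection_bounded[OF p] by blast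
    obtain B where B: "\<And>f. f \<in> Lp p \<Longrightarrow> lp_norm p (circle_cnj \<phi> * f) \<le> B * lp_norm p f"
      using Lp_Linf_mult[OF exponent_bounds(3)[OF p] Linf_cnj[OF Hinf_Linf[OF \<phi>]]] by blast
    have "lp_norm p (T f) \<le> C * B * lp_norm p f" if "f \<in> K" for f
      using C(2)[OF L[OF that]] mult_left_mono[OF B[OF model_space_Lp[OF that]] C(1)] by (simp add: T[OF that] mult.assoc)
    then show "\<exists>C. \<forall>f\<in>K. lp_norm p (T f) \<le> C * lp_norm p f" by blast
  qed
  moreover have "compose K T S = compose K S T"
  proof (rule extensionalityI[of _ K])
    fix k assume k: "k \<in> K"
    have "T (S k) = riesz_projection p (circle_cnj \<phi> * riesz_projection p (circle_cnj cZ * k))"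
      by (simp only: shift_eq[OF k] T[OF shift_mem[OF k]])
    also have "\<dots> = riesz_projection p (circle_cnj cZ * riesz_projection p (circle_cnj \<phi> * k))"
      using riesz_projection_cnj_Hinf_absorb[OF p \<phi> cnj_cZ_Lp[OF p model_space_Lp[OF k]]] riesz_projection_cnj_Hinf_absorb[OF p Hinf_cZ L[OF k]]
      by (simp add: mult.left_commute)
    also have "\<dots> = S (T k)"
      by (simp only: T[OF k, symmetric] shift_eq[OF TK[OF k]])
    finally have "T (S k) = S (T k)" .
    then show "compose K T S k = compose K S T k" using k by (simp add: compose_eq del: restrict_apply)
  qed (auto simp: compose_def)
  ultimately show ?thesis by (simp add: commutant_def T_def)
qed

section \<open>A fixed operator in the commutant and its functional\<close>

context
  fixes A :: "circle_fun \<Rightarrow> circle_fun"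
  assumes A: "A \<in> commutant p K S"
begin

lemma commutant_add: "f \<in> K \<Longrightarrow> g \<in> K \<Longrightarrow> A (f + g) = A f + A g"
  and commutant_scale: "f \<in> K \<Longrightarrow> A (circle_const c * f) = circle_const c * A f"
  and commutant_mem: "f \<in> K \<Longrightarrow> A f \<in> K"
  using A by (auto simp: commutant_def bounded_operators_def)

lemma commutant_ext: "A \<in> extensional K"
  using A by (simp add: commutant_def bounded_operators_def PiE_def)

lemma commutant_bounded: "\<exists>C\<ge>0. \<forall>f\<in>K. lp_norm p (A f) \<le> C * lp_norm p f"
proof -
  obtain C where C: "\<And>f. f \<in> K \<Longrightarrow> lp_norm p (A f) \<le> C * lp_norm p f"
    using A unfolding commutant_def bounded_operators_def by blast
  have "lp_norm p (A f) \<le> max C 0 * lp_norm p f" if "f \<in> K" for f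
    using C[OF that] mult_right_mono[OF max.cobounded1[of C 0] lp_norm_nonneg[of p f]] by linarith
  then show ?thesis by (intro exI[of _ "max C 0"]) auto
qed

lemma commutant_Lp: "f \<in> K \<Longrightarrow> A f \<in> Lp p"
  by (intro model_space_Lp commutant_mem)

lemma commutant_shift: "k \<in> K \<Longrightarrow> A (riesz_projection p (circle_cnj cZ * k)) = riesz_projection p (circle_cnj cZ * A k)"
proof -
  assume k: "k \<in> K"
  have "compose K A S k = compose K S A k" using A by (simp add: commutant_def)
  then have "A (S k) = S (A k)" using k by (simp add: compose_eq del: restrict_apply)
  then show ?thesis using shift_eq[OF k] shift_eq[OF commutant_mem[OF k]] by simp
qed

text \<open>Commutation with the shift, iterated over the coefficients of Q. Pairing with conj Q
  does not see the projection, so each conj z on the left can be completed to a backward shift of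
  \<open>A k\<close> and moved inside A.\<close>

lemma cint_commutant_cpoly:
  assumes "k \<in> K"
  shows "cint (A k * circle_cnj (cpoly Q)) = cint (A (riesz_projection p (circle_cnj (cpoly Q) * k)))"
  using assms
proof (induction Q arbitrary: k)
  case 0
  have "A (circle_const 0 * k) = circle_const 0 * A k" by (rule commutant_scale[OF 0])
  moreover have "riesz_projection p (circle_const 0 * 0) = circle_const 0 * riesz_projection p 0" by (rule riesz_projection_scale[OF p]) simp
  ultimately show ?case by simp
next
  case (pCons a Q)
  note k = pCons.prems
  define k' where "k' = riesz_projection p (circle_cnj cZ * k)"
  have k': "k' \<in> K" unfolding k'_def by (rule shift_mem[OF k])
  have kL: "k \<in> Lp p" by (rule model_space_Lp[OF k])
  have AkL: "A k \<in> Lp p" by (rule commutant_Lp[OF k])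
  have QL: "circle_cnj (cpoly Q) \<in> Linf" by (intro Linf_cnj Linf_cpoly)
  have zAL: "circle_cnj cZ * A k \<in> Lp p" by (rule cnj_cZ_Lp[OF p AkL])
  have L1a: "circle_const (cnj a) * A k \<in> Lp 1"
    using Lp_mono(1)[OF Lp_mult[OF exponent_bounds(3)[OF p] Linf_const AkL], of 1] exponent_bounds[OF p] by simp
  have L1b: "(circle_cnj cZ * A k) * circle_cnj (cpoly Q) \<in> Lp 1" by (rule Lp_Linf_L1[OF exponent_bounds(1)[OF p] zAL QL])
  have "cint (A k * circle_cnj (cpoly (pCons a Q))) = cint (circle_const (cnj a) * A k + (circle_cnj cZ * A k) * circle_cnj (cpoly Q))"
    by (simp add: algebra_simps)
  also have "\<dots> = cnj a * cint (A k) + cint ((circle_cnj cZ * A k) * circle_cnj (cpoly Q))"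
    by (simp only: cint_add[OF L1a L1b] cint_const_mult)
  also have "cint ((circle_cnj cZ * A k) * circle_cnj (cpoly Q)) = cint (riesz_projection p (circle_cnj cZ * A k) * circle_cnj (cpoly Q))"
    by (rule cint_riesz_projection_mult_cnj_Hinf[OF p zAL Hinf_cpoly, symmetric])
  also have "riesz_projection p (circle_cnj cZ * A k) = A k'" unfolding k'_def by (rule commutant_shift[OF k, symmetric])
  also have "cint (A k' * circle_cnj (cpoly Q)) = cint (A (riesz_projection p (circle_cnj (cpoly Q) * k')))" by (rule pCons.IH[OF k'])
  finally have 1: "cint (A k * circle_cnj (cpoly (pCons a Q))) = cnj a * cint (A k) + cint (A (riesz_projection p (circle_cnj (cpoly Q) * k')))" .
  have zkL: "circle_cnj cZ * k \<in> Lp p" by (rule cnj_cZ_Lp[OF p kL])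
  have "riesz_projection p (circle_cnj (cpoly (pCons a Q)) * k) = riesz_projection p (circle_const (cnj a) * k + circle_cnj (cpoly Q) * (circle_cnj cZ * k))"
    by (simp add: algebra_simps)
  also have "\<dots> = riesz_projection p (circle_const (cnj a) * k) + riesz_projection p (circle_cnj (cpoly Q) * (circle_cnj cZ * k))"
    by (rule riesz_projection_add[OF p Lp_mult[OF exponent_bounds(3)[OF p] Linf_const kL] Lp_mult[OF exponent_bounds(3)[OF p] QL zkL]])
  also have "riesz_projection p (circle_const (cnj a) * k) = circle_const (cnj a) * k"
    by (rule riesz_projection_id[OF p model_space_Hp[OF model_space_scale[OF k]]])
  also have "riesz_projection p (circle_cnj (cpoly Q) * (circle_cnj cZ * k)) = riesz_projection p (circle_cnj (cpoly Q) * k')"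
    unfolding k'_def by (rule riesz_projection_cnj_Hinf_absorb[OF p Hinf_cpoly zkL, symmetric])
  finally have "A (riesz_projection p (circle_cnj (cpoly (pCons a Q)) * k)) = circle_const (cnj a) * A k + A (riesz_projection p (circle_cnj (cpoly Q) * k'))"
    using k k' by (simp only: commutant_add[OF model_space_scale[OF k] riesz_projection_cnj_model_space[OF Hinf_cpoly k']] commutant_scale[OF k])
  then have "cint (A (riesz_projection p (circle_cnj (cpoly (pCons a Q)) * k))) = cnj a * cint (A k) + cint (A (riesz_projection p (circle_cnj (cpoly Q) * k')))"
    using cint_add[OF L1a Lp_mono(1)[OF commutant_Lp[OF riesz_projection_cnj_model_space[OF Hinf_cpoly k']], of 1]] exponent_bounds[OF p]
    by (simp only: cint_const_mult zero_less_one)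
  with 1 show ?case by simp
qed

text \<open>The functional \<Lambda>, with the value at 0 expressed as a mean; it is conjugate
  linear because \<open>model_proj\<close> is.\<close>

definition functional :: "circle_fun \<Rightarrow> complex" where "functional g = cint (A (model_proj g))"

lemma functional_add: "f \<in> Hp0 p \<Longrightarrow> g \<in> Hp0 p \<Longrightarrow> functional (f + g) = functional f + functional g"
  unfolding functional_def model_proj_add
  using commutant_Lp[OF model_proj_mem] exponent_bounds[OF p] by (simp add: commutant_add model_proj_mem model_proj_add cint_add Lp_mono(1)[of _ p 1])

lemma functional_scale: "f \<in> Hp0 p \<Longrightarrow> functional (circle_const c * f) = cnj c * functional f"
  unfolding functional_def by (simp add: model_proj_scale commutant_scale model_proj_mem cint_const_mult)

text \<open>The first bound serves the continuity of the functional, the second enters Hoelder's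
  inequality when \<open>A (model_proj g)\<close> is paired with h.\<close>

lemma functional_bounded: "\<exists>C\<ge>0. \<forall>g\<in>Hp0 p. cmod (functional g) \<le> C * lp_norm p g \<and> lp_norm p (A (model_proj g)) \<le> C * lp_norm p g"
proof -
  obtain C where C: "C \<ge> 0" "\<And>f. f \<in> K \<Longrightarrow> lp_norm p (A f) \<le> C * lp_norm p f" using commutant_bounded by blast
  obtain B where B: "B \<ge> 0" "\<And>g. g \<in> Hp0 p \<Longrightarrow> lp_norm p (model_proj g) \<le> B * lp_norm p g" using model_proj_bounded by blast
  have 1: "lp_norm p (A (model_proj g)) \<le> C * B * lp_norm p g" if "g \<in> Hp0 p" for g
    using C(2)[OF model_proj_mem[OF that]] mult_left_mono[OF B(2)[OF that] C(1)] by (simp add: mult.assoc)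
  have "cmod (functional g) \<le> C * B * lp_norm p g" if "g \<in> Hp0 p" for g
    unfolding functional_def using cint_norm_le[OF commutant_Lp[OF model_proj_mem[OF that]] exponent_bounds(1)[OF p]] 1[OF that] by linarith
  with 1 show ?thesis using B C by (intro exI[of _ "C * B"]) auto
qed

lemma functional_tendsto:
  assumes g: "g \<in> Hp0 p" and G: "\<And>n. G n \<in> Hp0 p" and lim: "(\<lambda>n. lp_norm p (g - G n)) \<longlonglongrightarrow> 0"
  shows "(\<lambda>n. functional (G n)) \<longlonglongrightarrow> functional g"
proof (rule LIM_zero_cancel, rule tendsto_norm_zero_cancel)
  obtain C where C: "C \<ge> 0" "\<And>g. g \<in> Hp0 p \<Longrightarrow> cmod (functional g) \<le> C * lp_norm p g" using functional_bounded by blast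
  have le: "cmod (functional (G n) - functional g) \<le> C * lp_norm p (g - G n)" for n
  proof -
    have d: "g - G n \<in> Hp0 p" by (intro Hp0_diff exponent_bounds[OF p] g G)
    have "functional g = functional ((g - G n) + G n)" by simp
    also have "\<dots> = functional (g - G n) + functional (G n)" by (rule functional_add[OF d G])
    finally show ?thesis using C(2)[OF d] by (simp add: norm_minus_commute)
  qed
  show "(\<lambda>n. cmod (functional (G n) - functional g)) \<longlonglongrightarrow> 0"
    by (rule tendsto_sandwich[OF _ _ tendsto_const tendsto_mult_right_zero[OF lim, of C]]) (use le in auto)
qed

text \<open>For polynomial h this is the commutation identity; general h is reached by polynomial
  approximation. The left side needs convergence in L^q, for the pairing, and the right side in L^p,
  for the continuity of the functional.\<close>

lemma cint_commutant_mult_Hinf: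
  assumes g: "g \<in> Hp0 p" "g \<in> Linf" and h: "h \<in> Hinf"
  shows "cint (A (model_proj g) * circle_cnj h) = functional (h * g)"
proof -
  define q where "q = p / (p - 1)"
  note pq = Hp_conjugate_exponent[OF p, folded q_def]
  have pq': "1 / q + 1 / p = 1" using pq by simp
  \<comment> \<open>One approximating sequence in the larger exponent converges in both norms, the
    total mass being 1.\<close>
  define s where "s = max p q"
  have s: "s > 1" "p \<le> s" "q \<le> s" using p by (auto simp: s_def)
  have hs: "h \<in> Hp s" using Hinf_Hp[OF h] s by simp
  obtain Q where Q: "(\<lambda>n. lp_norm s (h - cpoly (Q n))) \<longlonglongrightarrow> 0" using Hp_poly_dense[OF s(1) hs] by blast
  have dL: "h - cpoly (Q n) \<in> Lp s" for n using s hs by (intro Lp_diff) (auto simp: Hp_Lp cpoly_Lp)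
  have lim: "(\<lambda>n. lp_norm t (h - cpoly (Q n))) \<longlonglongrightarrow> 0" if "t > 0" "t \<le> s" for t
    by (rule tendsto_sandwich[OF _ _ tendsto_const Q]) (use Lp_mono(2)[OF dL that] in auto)
  have k: "model_proj g \<in> K" by (rule model_proj_mem[OF g(1)])
  have "(\<lambda>n. cint (circle_cnj (cpoly (Q n)) * A (model_proj g))) \<longlonglongrightarrow> cint (circle_cnj h * A (model_proj g))"
  proof (rule Lp_cint_tendsto[OF pq(1) p pq'])
    show "circle_cnj h \<in> Lp q" using Hinf_Hp[OF h, of q] pq by (intro Lp_cnj Hp_Lp) simp
    show "circle_cnj (cpoly (Q n)) \<in> Lp q" for n using pq by (intro Lp_cnj cpoly_Lp) simp
    show "A (model_proj g) \<in> Lp p" by (rule commutant_Lp[OF k])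
    have "lp_norm q (circle_cnj h - circle_cnj (cpoly (Q n))) = lp_norm q (h - cpoly (Q n))" for n
      using lp_norm_cnj[of q "h - cpoly (Q n)"] by simp
    then show "(\<lambda>n. lp_norm q (circle_cnj h - circle_cnj (cpoly (Q n)))) \<longlonglongrightarrow> 0" using lim[of q] pq s by simp
  qed
  moreover have "(\<lambda>n. functional (cpoly (Q n) * g)) \<longlonglongrightarrow> functional (h * g)"
  proof (rule functional_tendsto)
    show "h * g \<in> Hp0 p" "cpoly (Q n) * g \<in> Hp0 p" for n by (intro Hinf_mult_Hp0[OF p _ g(1)] h Hinf_cpoly)+
    \<comment> \<open>Boundedness of g turns convergence of the polynomials into convergence of
      their products with g.\<close>
    obtain B where B: "\<And>f. f \<in> Lp p \<Longrightarrow> lp_norm p (g * f) \<le> B * lp_norm p f" using Lp_Linf_mult[OF exponent_bounds(3)[OF p] g(2)] by blast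
    have "lp_norm p (h * g - cpoly (Q n) * g) \<le> B * lp_norm p (h - cpoly (Q n))" for n
      using B[OF Lp_mono(1)[OF dL exponent_bounds(3)[OF p] s(2)]] by (simp add: algebra_simps)
    then show "(\<lambda>n. lp_norm p (h * g - cpoly (Q n) * g)) \<longlonglongrightarrow> 0"
      by (intro tendsto_sandwich[OF _ _ tendsto_const tendsto_mult_right_zero[OF lim[OF exponent_bounds(3)[OF p] s(2)], of B]]) auto
  qed
  moreover have "cint (circle_cnj (cpoly (Q n)) * A (model_proj g)) = functional (cpoly (Q n) * g)" for n
    using cint_commutant_cpoly[OF k, of "Q n"] model_proj_mult[OF g(1) Hinf_cpoly] by (simp add: functional_def mult.commute)
  ultimately have "cint (circle_cnj h * A (model_proj g)) = functional (h * g)" using LIMSEQ_unique by simp blast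
  then show ?thesis by (simp add: mult.commute)
qed

text \<open>Splitting a polynomial into factors of equal absolute power turns the \<open>L\<^sup>q\<close>-\<open>L\<^sup>p\<close> bound into an \<open>L\<^sup>1\<close> bound.\<close>

lemma functional_L1_bound: "\<exists>C\<ge>0. \<forall>G. cmod (functional (cZ * cpoly G)) \<le> C * lp_norm 1 (cZ * cpoly G)"
proof -
  define q where "q = p / (p - 1)"
  note pq = Hp_conjugate_exponent[OF p, folded q_def]
  obtain C where C: "C \<ge> 0" "\<And>g. g \<in> Hp0 p \<Longrightarrow> lp_norm p (A (model_proj g)) \<le> C * lp_norm p g" using functional_bounded by blast
  obtain B where B: "B \<ge> 0" "\<And>f. f \<in> Lp p \<Longrightarrow> lp_norm p (cZ * f) \<le> B * lp_norm p f" using Lp_Linf_mult[OF exponent_bounds(3)[OF p] Linf_cZ] by blast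
  obtain D where D: "D \<ge> 0" "\<And>f. f \<in> Lp 1 \<Longrightarrow> lp_norm 1 (circle_cnj cZ * f) \<le> D * lp_norm 1 f"
    using Lp_Linf_mult[OF zero_less_one Linf_cnj[OF Linf_cZ]] by blast
  have "cmod (functional (cZ * cpoly G)) \<le> C * B * D * lp_norm 1 (cZ * cpoly G)" for G
  proof -
    obtain h g where hg: "power_factor p q G h g" using power_factor_exists[of p q G] pq exponent_bounds[OF p] by auto
    have m: "h \<in> borel_measurable borel" "g \<in> borel_measurable borel" using hg by (auto simp: power_factor_def)
    define h' g' where "h' = abs_circle_fun h" and "g' = abs_circle_fun g"
    have H: "h' \<in> Hinf" "g' \<in> Hinf" using hg by (auto simp: power_factor_def h'_def g'_def)
    have prod: "cpoly G = h' * g'"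
      using hg m by (auto simp: cpoly_def h'_def g'_def abs_circle_times abs_circle_fun_eq_iff power_factor_def intro!: AE_circleI)
    have mass: "pmass q h = (\<integral>\<zeta>. cmod (poly G \<zeta>) \<partial>\<mu>)" "pmass p g = (\<integral>\<zeta>. cmod (poly G \<zeta>) \<partial>\<mu>)"
      unfolding pmass_def using m hg by (auto intro!: integral_cong_AE AE_circleI simp: power_factor_def)
    have norms: "lp_norm p g' * lp_norm q h' = lp_norm 1 (cpoly G)"
    proof -
      define X where "X = (\<integral>\<zeta>. cmod (poly G \<zeta>) \<partial>\<mu>)"
      have "lp_norm p g' * lp_norm q h' = X powr (1/p) * X powr (1/q)" using m by (simp add: h'_def g'_def abs_circle_lp_norm mass X_def)
      \<comment> \<open>Both norms are powers of the same integral, and the exponents add up to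
        1.\<close>
      also have "\<dots> = X" using pq(2) by (subst powr_add[symmetric]) (simp add: X_def)
      finally show ?thesis by (simp add: cpoly_def lp_norm_1_eq X_def)
    qed
    \<comment> \<open>The factor \<open>cZ\<close> goes to g', because the argument of
      \<open>model_proj\<close> must lie in \<open>Hp0 p\<close>, while membership in
      \<open>Hinf\<close> suffices for h'.\<close>
    have g'H: "cZ * g' \<in> Hp0 p" using Hinf_Hp[OF H(2) exponent_bounds(3)[OF p]] by (rule cZ_mult_Hp[OF p])
    have g'L: "cZ * g' \<in> Linf" by (intro Linf_mult Linf_cZ Hinf_Linf H)
    have "functional (cZ * cpoly G) = functional (h' * (cZ * g'))" by (simp add: prod mult_ac)
    also have "\<dots> = cint (A (model_proj (cZ * g')) * circle_cnj h')" by (rule cint_commutant_mult_Hinf[OF g'H g'L H(1), symmetric])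
    also have "cmod \<dots> \<le> lp_norm p (A (model_proj (cZ * g'))) * lp_norm q (circle_cnj h')"
      using Hinf_Hp[OF H(1), of q] pq by (intro Lp_Holder(2)[OF p pq] commutant_Lp model_proj_mem g'H Lp_cnj Hp_Lp) simp
    also have "\<dots> \<le> (C * (B * lp_norm p g')) * lp_norm q h'"
    proof -
      have "lp_norm p (A (model_proj (cZ * g'))) \<le> C * lp_norm p (cZ * g')" by (rule C(2)[OF g'H])
      also have "\<dots> \<le> C * (B * lp_norm p g')" using Hinf_Hp[OF H(2) exponent_bounds(3)[OF p]] by (intro mult_left_mono B C Hp_Lp)
      finally show ?thesis by (simp add: mult_right_mono)
    qed
    also have "\<dots> = C * B * lp_norm 1 (cpoly G)" by (simp add: norms[symmetric])
    \<comment> \<open>D bounds multiplication by conj z in L^1, which brings \<open>cZ\<close> back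
      into the norm.\<close>
    also have "\<dots> \<le> C * B * (D * lp_norm 1 (cZ * cpoly G))"
    proof (rule mult_left_mono)
      have "lp_norm 1 (circle_cnj cZ * (cZ * cpoly G)) \<le> D * lp_norm 1 (cZ * cpoly G)"
        by (intro D(2) Lp_mult cpoly_Lp) auto
      then show "lp_norm 1 (cpoly G) \<le> D * lp_norm 1 (cZ * cpoly G)" by (simp add: mult.assoc[symmetric])
    qed (use B C in simp)
    finally show ?thesis by (simp add: mult.assoc)
  qed
  then show ?thesis using B C D by (intro exI[of _ "C * B * D"]) auto
qed

lemma cZ_cpoly_Hp0: "cZ * cpoly G \<in> Hp0 p"
  by (rule cZ_mult_Hp[OF p cpoly_Hp[OF exponent_bounds(3)[OF p]]])

text \<open>The L^1 bound is known on the polynomials vanishing at 0, and this subspace is passed to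
  the duality lemma. The formula extends to \<open>Hp0 p\<close> because both sides are continuous
  in L^p: the left by boundedness of A, the right because \<psi> is bounded.\<close>

lemma functional_representation:
  obtains \<psi> where "\<psi> \<in> Linf" "\<And>g. g \<in> Hp0 p \<Longrightarrow> functional g = cint (\<psi> * circle_cnj g)"
proof -
  define q where "q = p / (p - 1)"
  note pq = Hp_conjugate_exponent[OF p, folded q_def]
  obtain C where C: "C \<ge> 0" "\<And>G. cmod (functional (cZ * cpoly G)) \<le> C * lp_norm 1 (cZ * cpoly G)"
    using functional_L1_bound by blast
  define M where "M = range (\<lambda>G. cZ * cpoly G)"
  have "\<exists>\<psi>. \<psi> \<in> Linf \<and> (\<forall>f\<in>M. functional f = cint (\<psi> * circle_cnj f))"
  proof (rule L1_dual_circle[of M functional C])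
    show "M \<subseteq> Lp 1" by (auto simp: M_def intro!: Lp_mult cpoly_Lp)
    show "0 \<in> M" unfolding M_def by (rule range_eqI[of _ _ 0]) simp
    show "f + g \<in> M" if "f \<in> M" "g \<in> M" for f g
    proof -
      obtain F G where "f = cZ * cpoly F" "g = cZ * cpoly G" using \<open>f \<in> M\<close> \<open>g \<in> M\<close> by (auto simp: M_def)
      then show ?thesis unfolding M_def by (intro range_eqI[of _ _ "F + G"]) (simp add: cpoly_add distrib_left)
    qed
    show "circle_const c * f \<in> M" if "f \<in> M" for f c
    proof -
      obtain F where "f = cZ * cpoly F" using \<open>f \<in> M\<close> by (auto simp: M_def)
      then show ?thesis unfolding M_def by (intro range_eqI[of _ _ "smult c F"]) (simp add: cpoly_smult mult.left_commute)
    qed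
    show "functional (f + g) = functional f + functional g" if "f \<in> M" "g \<in> M" for f g
      using that by (intro functional_add) (auto simp: M_def cZ_cpoly_Hp0)
    show "functional (circle_const c * f) = cnj c * functional f" if "f \<in> M" for f c
      using that by (intro functional_scale) (auto simp: M_def cZ_cpoly_Hp0)
    show "cmod (functional f) \<le> C * lp_norm 1 f" if "f \<in> M" for f using that C by (auto simp: M_def)
    show "C \<ge> 0" by fact
  qed blast
  then obtain \<psi> where \<psi>: "\<psi> \<in> Linf" "\<And>G. functional (cZ * cpoly G) = cint (\<psi> * circle_cnj (cZ * cpoly G))"
    by (auto simp: M_def)
  have "functional g = cint (\<psi> * circle_cnj g)" if g: "g \<in> Hp0 p" for g
  proof -
    obtain Q where Q: "(\<lambda>n. lp_norm p (g - cZ * cpoly (Q n))) \<longlonglongrightarrow> 0" using Hp0_poly_dense[OF p g] by blast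
    have 1: "(\<lambda>n. functional (cZ * cpoly (Q n))) \<longlonglongrightarrow> functional g"
      by (rule functional_tendsto[OF g cZ_cpoly_Hp0 Q])
    have "lp_norm p (circle_cnj g - circle_cnj (cZ * cpoly (Q n))) = lp_norm p (g - cZ * cpoly (Q n))" for n
      using lp_norm_cnj[of p "g - cZ * cpoly (Q n)"] by simp
    then have Q': "(\<lambda>n. lp_norm p (circle_cnj g - circle_cnj (cZ * cpoly (Q n)))) \<longlonglongrightarrow> 0" using Q by simp
    have "(\<lambda>n. cint (circle_cnj (cZ * cpoly (Q n)) * \<psi>)) \<longlonglongrightarrow> cint (circle_cnj g * \<psi>)"
      using pq by (intro Lp_cint_tendsto[OF p pq _ _ _ Q'] Lp_cnj Hp0_Lp g cZ_cpoly_Hp0 Linf_Lp[OF \<psi>(1)]) simp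
    then have 2: "(\<lambda>n. functional (cZ * cpoly (Q n))) \<longlonglongrightarrow> cint (\<psi> * circle_cnj g)"
      by (simp only: \<psi>(2) mult.commute[of \<psi>])
    show ?thesis by (rule LIMSEQ_unique[OF 1 2])
  qed
  then show thesis using that \<psi>(1) by blast
qed

lemma commutant_is_toeplitz: "\<exists>\<phi>\<in>Hinf. A = restrict (toeplitz p (circle_cnj \<phi>)) K"
proof -
  obtain \<psi> where \<psi>: "\<psi> \<in> Linf" and rep: "\<And>g. g \<in> Hp0 p \<Longrightarrow> functional g = cint (\<psi> * circle_cnj g)"
    using functional_representation by blast
  define \<phi> where "\<phi> = I * circle_cnj \<psi>"
  have \<phi>L: "\<phi> \<in> Linf" unfolding \<phi>_def by (intro Linf_mult I_Linf Linf_cnj \<psi>)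
  \<comment> \<open>The coefficient of \<phi> at -n is the conjugate of the functional at I z^n.
    There I cancels against its conjugate, and the projection kills the remaining conj z^n because n
    >= 1.\<close>
  have "\<phi> \<in> Hp 2" unfolding Hp_iff
  proof (intro conjI allI impI)
    show "\<phi> \<in> Lp 2" by (rule Linf_Lp[OF \<phi>L]) simp
    fix n :: nat assume n: "1 \<le> n"
    have Zn: "cZ ^ n \<in> Hp0 p"
    proof -
      obtain m where "n = Suc m" using n by (cases n) auto
      then show ?thesis using cZ_mult_Hp[OF p Hinf_Hp[OF Hinf_cZ_power exponent_bounds(3)[OF p]], of m] by simp
    qed
    have g: "I * cZ ^ n \<in> Hp0 p" by (rule Hinf_mult_Hp0[OF p I_Hinf Zn])
    have "I * circle_cnj (I * cZ ^ n) = (I * circle_cnj I) * circle_cnj (cZ ^ n)" by (simp add: mult_ac)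
    then have "model_proj (I * cZ ^ n) = 0"
      unfolding model_proj_def I_cnj using riesz_projection_cnj_Hp0[OF p Zn] by simp
    moreover have "A 0 = 0"
    proof -
      have "0 \<in> K" using model_proj_mem[OF g] calculation by simp
      from commutant_scale[OF this, of 0] show ?thesis by simp
    qed
    ultimately have "cint (\<psi> * circle_cnj (I * cZ ^ n)) = 0" using rep[OF g] by (simp add: functional_def)
    then have "cint (circle_cnj (\<psi> * circle_cnj (I * cZ ^ n))) = 0" unfolding cint_cnj by simp
    then show "cint (\<phi> * cZ ^ n) = 0" by (simp add: \<phi>_def mult_ac)
  qed
  then have \<phi>: "\<phi> \<in> Hinf" by (rule fatou_Hinf[OF \<phi>L])
  have "A = restrict (toeplitz p (circle_cnj \<phi>)) K"
  proof (rule extensionalityI[OF commutant_ext])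
    fix k assume k: "k \<in> K"
    obtain g where g: "g \<in> Hp0 p" "k = I * circle_cnj g" "k \<in> Hp p" using k by (rule model_space_obtain)
    have kg: "circle_cnj \<phi> * k = \<psi> * circle_cnj g"
    proof -
      have "circle_cnj \<phi> * k = (I * circle_cnj I) * (\<psi> * circle_cnj g)" by (simp add: \<phi>_def g(2) mult_ac)
      then show ?thesis by (simp add: I_cnj)
    qed
    have L: "circle_cnj \<phi> * k \<in> Lp p" by (rule Lp_cnj_Hinf_mult[OF p \<phi> model_space_Lp[OF k]])
    have AkH: "A k \<in> Hp p" using commutant_mem[OF k] by (simp add: model_space_def)
    \<comment> \<open>Both sides are the value of the functional at z^n g, the left by commutation
      and the right by the representation. Agreement of the nonnegative coefficients identifies
      \<open>A k\<close> as the projection of conj \<phi> k.\<close>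
    have coeff: "cint (A k * circle_cnj cZ ^ n) = cint (circle_cnj \<phi> * k * circle_cnj cZ ^ n)" for n
    proof -
      have "cint (A k * circle_cnj cZ ^ n) = cint (A (riesz_projection p (circle_cnj (cZ ^ n) * k)))"
        using cint_commutant_cpoly[OF k, of "monom 1 n"] by (simp add: cZ_power_cpoly[symmetric])
      also have "riesz_projection p (circle_cnj (cZ ^ n) * k) = model_proj (cZ ^ n * g)" by (simp add: g(2) model_proj_def mult_ac)
      also have "cint (A (model_proj (cZ ^ n * g))) = cint (\<psi> * circle_cnj (cZ ^ n * g))"
        using rep[OF Hinf_mult_Hp0[OF p Hinf_cZ_power g(1)]] by (simp add: functional_def)
      also have "\<psi> * circle_cnj (cZ ^ n * g) = circle_cnj \<phi> * k * circle_cnj cZ ^ n" unfolding kg by (simp add: mult_ac)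
      finally show ?thesis .
    qed
    have "riesz_projection p (circle_cnj \<phi> * k) = A k" by (rule riesz_projection_eqI[OF p L AkH coeff])
    then show "A k = restrict (toeplitz p (circle_cnj \<phi>)) K k" using k by (simp add: toeplitz_def)
  qed simp
  then show ?thesis using \<phi> by blast
qed

end

end

theorem corollary4p4:
  fixes p :: real and I :: circle_fun
  assumes "1 < p" and "inner_function I"
  shows "commutant p (model_space p I) (restrict (backward_shift p) (model_space p I)) =
    {restrict (toeplitz p (circle_cnj \<phi>)) (model_space p I) | \<phi>. \<phi> \<in> Hinf}"
  using toeplitz_in_commutant[OF assms] commutant_is_toeplitz[OF assms] by blast

end
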